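(* Let $(\mathbb{X},\mathbb{Y},\mathbb{A},P,Q,c)$ be a POMDP, and let the observation space $\mathbb{Y}$ be partitioned into two disjoint subsets $\mathbb{Y}_1$ and $\mathbb{Y}_2$ such that $\mathbb{Y}_1$ is open in $\mathbb{Y}$. Suppose that the following assumptions hold: (a) the stochastic kernels $P$ on $\mathbb{X}$ given $\mathbb{X}\times\mathbb{A}$ and $Q$ on $\mathbb{Y}$ given $\mathbb{A}\times\mathbb{X}$ are weakly continuous; (b) the measure $R'(\cdot|z,a)$ on $(\mathbb{Y}_2,\mathcal{B}(\mathbb{Y}_2))$ is setwise continuous in $(z,a)\in\mathbb{P}(\mathbb{X})\times\mathbb{A}$, that is, for every sequence $\{(z^{(n)},a^{(n)})\}_{n\ge1}$ in $\mathbb{P}(\mathbb{X})\times\mathbb{A}$ converging to $(z,a)\in\mathbb{P}(\mathbb{X})\times\mathbb{A}$ and for every $C\in\mathcal{B}(\mathbb{Y}_2)$, $R'(C|z^{(n)},a^{(n)})\to R'(C|z,a)$; (c) there exists a stochastic kernel $H$ on $\mathbb{X}$ given $\mathbb{P}(\mathbb{X})\times\mathbb{A}\times\mathbb{Y}$ satisfying the filtering equation (F) such that: (i) the stochastic kernel $H$ on $\mathbb{X}$ given $\mathbb{P}(\mathbb{X})\times\mathbb{A}\times\mathbb{Y}_1$ is weakly continuous; (ii) if a sequence $\{z^{(n)}\}_{n\ge1}\subseteq\mathbb{P}(\mathbb{X})$ converges weakly to $z\in\mathbb{P}(\mathbb{X})$ and a sequence $\{a^{(n)}\}_{n\ge1}\subseteq\mathbb{A}$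 converges to $a\in\mathbb{A}$, then there exist a subsequence $\{(z^{(n_k)},a^{(n_k)})\}_{k\ge1}$ and a measurable subset $C$ of $\mathbb{Y}_2$ such that $R'(\mathbb{Y}_2\setminus C|z,a)=0$ and $H(z^{(n_k)},a^{(n_k)},y)$ converges weakly to $H(z,a,y)$ for all $y\in C$. Then the stochastic kernel $q$ on $\mathbb{P}(\mathbb{X})$ given $\mathbb{P}(\mathbb{X})\times\mathbb{A}$ is weakly continuous. If, in addition to assumptions (a), (b), and (c), either Assumption (D) or Assumption (P) holds and $c$ is $\mathbb{K}$-inf-compact on $\mathbb{X}\times\mathbb{A}$, then the COMDP $(\mathbb{P}(\mathbb{X}),\mathbb{A},q,\bar c)$ satisfies Assumption (W* ), and therefore it has the optimality properties (O1)--(O6).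
   Context: Notation. $\overline{\mathbb{R}}=\mathbb{R}\cup\{+\infty\}$. For a metric space $\mathbb{S}$, $\mathcal{B}(\mathbb{S})$ is its Borel $\sigma$-field and $\mathbb{P}(\mathbb{S})$ is the set of probability measures on $(\mathbb{S},\mathcal{B}(\mathbb{S}))$, endowed with the topology of weak convergence. A stochastic kernel $T(ds_1|s_2)$ on $\mathbb{S}_1$ given $\mathbb{S}_2$ is a map such that $T(\cdot|s_2)\in\mathbb{P}(\mathbb{S}_1)$ for each $s_2$ and $T(B|\cdot)$ is Borel for each $B\in\mathcal{B}(\mathbb{S}_1)$; it is weakly continuous if $s_2^{(n)}\to s_2$ implies $T(\cdot|s_2^{(n)})\to T(\cdot|s_2)$ weakly. POMDP. A POMDP $(\mathbb{X},\mathbb{Y},\mathbb{A},P,Q,c)$ consists of nonempty Borel subsets $\mathbb{X}$ (states), $\mathbb{Y}$ (observations), $\mathbb{A}$ (actions) of Polish spaces, a stochastic kernel $P(dx'|x,a)$ on $\mathbb{X}$ given $\mathbb{X}\times\mathbb{A}$, a stochastic kernel $Q(dy|a,x)$ on $\mathbb{Y}$ given $\mathbb{A}\times\mathbb{X}$, and a bounded below Borel function $c:\mathbb{X}\times\mathbb{A}\to\overline{\mathbb{R}}$. $\alpha$ denotes the discount factor. Assumption (D): $c$ is bounded below on $\mathbb{X}\times\mathbb{A}$ and $\alpha\in[0,1)$. Assumption (P): $c$ is nonnegative on $\mathbb{X}\times\mathbb{A}$ and $\alpha\in[0,1]$. Inf-compactness. A function $f:\mathbb{S}_1\times\mathbb{S}_2\to\overline{\mathbb{R}}$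 ($\mathbb{S}_1,\mathbb{S}_2$ metric spaces) is inf-compact if $\{f\le\lambda\}$ is compact for every $\lambda\in\mathbb{R}$ (similarly for functions on a single metric space); it is $\mathbb{K}$-inf-compact on $\mathbb{S}_1\times\mathbb{S}_2$ if for every compact $K\subseteq\mathbb{S}_1$ its restriction to $K\times\mathbb{S}_2$ is inf-compact. Filtering. For $z\in\mathbb{P}(\mathbb{X})$, $a\in\mathbb{A}$, $B\in\mathcal{B}(\mathbb{X})$, $C\in\mathcal{B}(\mathbb{Y})$ let $R(B\times C|z,a)=\int_{\mathbb{X}}\int_B Q(C|a,x')P(dx'|x,a)z(dx)$, which defines a stochastic kernel on $\mathbb{X}\times\mathbb{Y}$ given $\mathbb{P}(\mathbb{X})\times\mathbb{A}$, and let $R'(C|z,a)=R(\mathbb{X}\times C|z,a)$. There exists a stochastic kernel $H(dx|z,a,y)$ on $\mathbb{X}$ given $\mathbb{P}(\mathbb{X})\times\mathbb{A}\times\mathbb{Y}$ satisfying the filtering equation (F) $R(B\times C|z,a)=\int_C H(B|z,a,y)R'(dy|z,a)$ for all $B,C,z,a$. Write $H(z,a,y)=H(\cdot|z,a,y)\in\mathbb{P}(\mathbb{X})$. Define the stochastic kernel $q$ on $\mathbb{P}(\mathbb{X})$ given $\mathbb{P}(\mathbb{X})\times\mathbb{A}$ by $q(D|z,a)=\int_{\mathbb{Y}}\mathbf{1}\{H(z,a,y)\in D\}R'(dy|z,a)$, $D\in\mathcal{B}(\mathbb{P}(\mathbb{X}))$; it does not depend on the choice of $H$ satisfying (F). COMDP.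 The COMDP $(\mathbb{P}(\mathbb{X}),\mathbb{A},q,\bar c)$ is the Markov decision process with state space $\mathbb{P}(\mathbb{X})$, action set $\mathbb{A}$ at every state, transition kernel $q$ and one-step cost $\bar c(z,a)=\int_{\mathbb{X}}c(x,a)z(dx)$. An $I$-policy is a sequence $\delta=\{\delta_t\}_{t\ge0}$ of stochastic kernels $\delta_t$ on $\mathbb{A}$ given $\mathbb{P}(\mathbb{X})\times(\mathbb{A}\times\mathbb{P}(\mathbb{X}))^t$ (histories $z_0,a_0,\dots,z_t$); it is Markov if it is given by Borel maps $\phi_t:\mathbb{P}(\mathbb{X})\to\mathbb{A}$ with $a_t=\phi_t(z_t)$, and stationary if moreover $\phi_t=\phi$ does not depend on $t$. For $T\in\{0,1,\dots\}\cup\{\infty\}$, $\bar v^{\delta}_{T,\alpha}(z)=\mathbb{E}^\delta_z\sum_{t=0}^{T-1}\alpha^t\bar c(z_t,a_t)$ with $z_0=z$, $\bar v_{T,\alpha}(z)=\inf_\delta\bar v^\delta_{T,\alpha}(z)$, and the subscript $T$ is dropped if $T=\infty$; $\bar v_{0,\alpha}=0$. A policy is $T$-horizon optimal (discount-optimal) if it attains the infimum for all $z$, for horizon $T$ (for $T=\infty$). Assumption (W* ) for the COMDP: $\bar c$ is $\mathbb{K}$-inf-compact on $\mathbb{P}(\mathbb{X})\times\mathbb{A}$, and $q(\cdot|z,a)$ is weakly continuous in $(z,a)\in\mathbb{P}(\mathbb{X})\times\mathbb{A}$. Optimality properties of the COMDP: (O1) $\bar v_{t,\alpha}$, $t=0,1,\dots$,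 and $\bar v_\alpha$ are lower semi-continuous on $\mathbb{P}(\mathbb{X})$, and $\bar v_{t,\alpha}(z)\to\bar v_\alpha(z)$ as $t\to\infty$ for all $z$. (O2) For all $z\in\mathbb{P}(\mathbb{X})$, $t=0,1,\dots$: $\bar v_{t+1,\alpha}(z)=\min_{a\in\mathbb{A}}\{\bar c(z,a)+\alpha\int\bar v_{t,\alpha}(z')q(dz'|z,a)\}=\min_{a\in\mathbb{A}}\{\int_{\mathbb{X}}c(x,a)z(dx)+\alpha\int_{\mathbb{X}}\int_{\mathbb{X}}\int_{\mathbb{Y}}\bar v_{t,\alpha}(H(z,a,y))Q(dy|a,x')P(dx'|x,a)z(dx)\}$; and the nonempty sets $A_{t,\alpha}(z)=\{a\in\mathbb{A}:\bar v_{t+1,\alpha}(z)=\bar c(z,a)+\alpha\int\bar v_{t,\alpha}(z')q(dz'|z,a)\}$ satisfy: the graph $\{(z,a):a\in A_{t,\alpha}(z)\}$ is a Borel subset of $\mathbb{P}(\mathbb{X})\times\mathbb{A}$; $A_{t,\alpha}(z)=\mathbb{A}$ if $\bar v_{t+1,\alpha}(z)=+\infty$, and $A_{t,\alpha}(z)$ is compact if $\bar v_{t+1,\alpha}(z)<+\infty$. (O3) For each $T=1,2,\dots$ there is an optimal Markov $T$-horizon $I$-policy $(\phi_0,\dots,\phi_{T-1})$; and any $T$-horizon Markov $I$-policy with $\phi_{T-1-t}(z)\in A_{t,\alpha}(z)$ for all $z$ and $t=0,\dots,T-1$ is $T$-horizon optimal. (O4) For all $z\in\mathbb{P}(\mathbb{X})$: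 $\bar v_\alpha(z)=\min_{a\in\mathbb{A}}\{\bar c(z,a)+\alpha\int\bar v_\alpha(z')q(dz'|z,a)\}=\min_{a\in\mathbb{A}}\{\int_{\mathbb{X}}c(x,a)z(dx)+\alpha\int_{\mathbb{X}}\int_{\mathbb{X}}\int_{\mathbb{Y}}\bar v_\alpha(H(z,a,y))Q(dy|a,x')P(dx'|x,a)z(dx)\}$; and the nonempty sets $A_\alpha(z)=\{a\in\mathbb{A}:\bar v_\alpha(z)=\bar c(z,a)+\alpha\int\bar v_\alpha(z')q(dz'|z,a)\}$ satisfy: the graph $\{(z,a):a\in A_\alpha(z)\}$ is a Borel subset of $\mathbb{P}(\mathbb{X})\times\mathbb{A}$; $A_\alpha(z)=\mathbb{A}$ if $\bar v_\alpha(z)=+\infty$, and $A_\alpha(z)$ is compact if $\bar v_\alpha(z)<+\infty$. (O5) For the infinite horizon there is a stationary discount-optimal $I$-policy, and a stationary $I$-policy $\phi$ is optimal if and only if $\phi(z)\in A_\alpha(z)$ for all $z\in\mathbb{P}(\mathbb{X})$. (O6) If $\bar c$ is inf-compact on $\mathbb{P}(\mathbb{X})\times\mathbb{A}$, then $\bar v_{t,\alpha}$, $t=1,2,\dots$, and $\bar v_\alpha$ are inf-compact on $\mathbb{P}(\mathbb{X})$. *)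

theory Defs
  imports "HOL-Probability.Probability"
begin

subsection \<open>Probability measures on topological spaces\<close>

definition borel_of :: "'s topology \<Rightarrow> 's measure" where
  "borel_of T = sigma (topspace T) {U. openin T U}"

abbreviation borel_on :: "'s::topological_space set \<Rightarrow> 's measure" where
  "borel_on S \<equiv> borel_of (top_of_set S)"

abbreviation prob_measures :: "'s topology \<Rightarrow> 's measure set" where
  "prob_measures T \<equiv> space (prob_algebra (borel_of T))"

text \<open>The coarsest topology on the probability measures for which integration of every bounded
  continuous real function is continuous. It is defined for abstract topologies, so that it can
  be iterated (transition kernels of the filter take values in measures on measures).\<close>

definition weak_topology :: "'s topology \<Rightarrow> 's measure topology" where
  "weak_topology T = topology_generated_by
     {{\<mu> \<in> prob_measures T. (\<integral>x. f x \<partial>\<mu>) \<in> U} | f U.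
        continuous_map T euclideanreal f \<and> bounded (f ` topspace T) \<and> open U}"

lemma space_borel_of [simp]: "space (borel_of T) = topspace T"
  and sets_borel_of: "sets (borel_of T) = sigma_sets (topspace T) {U. openin T U}"
proof -
  have "{U. openin T U} \<subseteq> Pow (topspace T)"
    by (auto dest: openin_subset)
  then show "space (borel_of T) = topspace T"
    and "sets (borel_of T) = sigma_sets (topspace T) {U. openin T U}"
    by (auto simp: borel_of_def)
qed

lemma sets_borel_on: "sets (borel_on S) = sets (restrict_space borel S)"
proof -
  have "sets (restrict_space borel S) =
      sets (vimage_algebra S (\<lambda>x. x) (sigma UNIV {U. open U}))"
    by (subst restrict_space_eq_vimage_algebra) (auto simp: borel_def)
  also have "\<dots> = sets (sigma S {(\<lambda>x. x) -` U \<inter> S | U. U \<in> {U. open U}})"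
    by (subst vimage_algebra_sigma) auto
  also have "{(\<lambda>x. x) -` U \<inter> S | U. U \<in> {U. open U}} = {U. openin (top_of_set S) U}"
    by (auto simp: openin_open)
  finally show ?thesis
    by (simp add: borel_of_def)
qed

lemma topspace_weak_topology [simp]: "topspace (weak_topology T) = prob_measures T"
proof -
  have "\<exists>f U. prob_measures T = {\<mu> \<in> prob_measures T. (\<integral>x. f x \<partial>\<mu>) \<in> U}
      \<and> continuous_map T euclideanreal f \<and> bounded (f ` topspace T) \<and> open U"
    by (rule exI[of _ "\<lambda>_. 0"], rule exI[of _ UNIV]) (auto simp: image_constant_conv)
  then show ?thesis
    unfolding weak_topology_def topology_generated_by_topspace by blast
qed

lemma limitin_weak_topology:
  assumes "\<And>n. \<mu> n \<in> prob_measures T" "\<nu> \<in> prob_measures T"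
  shows "limitin (weak_topology T) \<mu> \<nu> sequentially \<longleftrightarrow>
    (\<forall>f. continuous_map T euclideanreal f \<and> bounded (f ` topspace T) \<longrightarrow>
      (\<lambda>n. \<integral>x. f x \<partial>\<mu> n) \<longlonglongrightarrow> (\<integral>x. f x \<partial>\<nu>))"  (is "?L \<longleftrightarrow> ?R")
proof
  assume L: ?L
  show ?R
  proof (intro allI impI)
    fix f assume f: "continuous_map T euclideanreal f \<and> bounded (f ` topspace T)"
    show "(\<lambda>n. \<integral>x. f x \<partial>\<mu> n) \<longlonglongrightarrow> (\<integral>x. f x \<partial>\<nu>)"
    proof (rule topological_tendstoI)
      fix U :: "real set" assume U: "open U" "(\<integral>x. f x \<partial>\<nu>) \<in> U"
      let ?V = "{\<mu> \<in> prob_measures T. (\<integral>x. f x \<partial>\<mu>) \<in> U}"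
      have "openin (weak_topology T) ?V"
        unfolding weak_topology_def using f U by (intro topology_generated_by_Basis) blast
      moreover have "\<nu> \<in> ?V" using assms U by simp
      ultimately have "\<forall>\<^sub>F n in sequentially. \<mu> n \<in> ?V"
        using L unfolding limitin_def by blast
      then show "\<forall>\<^sub>F n in sequentially. (\<integral>x. f x \<partial>\<mu> n) \<in> U"
        by eventually_elim simp
    qed
  qed
next
  assume R: ?R
  show ?L
    unfolding limitin_def
  proof (intro conjI allI impI)
    show "\<nu> \<in> topspace (weak_topology T)" using assms by simp
    fix W assume W: "openin (weak_topology T) W \<and> \<nu> \<in> W"
    then have "generate_topology_on {{\<mu> \<in> prob_measures T. (\<integral>x. f x \<partial>\<mu>) \<in> U} | f U.
        continuous_map T euclideanreal f \<and> bounded (f ` topspace T) \<and> open U} W"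
      by (simp add: weak_topology_def openin_topology_generated_by_iff)
    then have "\<nu> \<in> W \<longrightarrow> (\<forall>\<^sub>F n in sequentially. \<mu> n \<in> W)"
    proof induction
      case (Int a b) then show ?case by (auto intro: eventually_conj)
    next
      case (UN K)
      show ?case
      proof
        assume "\<nu> \<in> \<Union>K"
        then obtain k where k: "k \<in> K" "\<nu> \<in> k" by blast
        with UN have "\<forall>\<^sub>F n in sequentially. \<mu> n \<in> k" by blast
        then show "\<forall>\<^sub>F n in sequentially. \<mu> n \<in> \<Union>K"
          by eventually_elim (use k in blast)
      qed
    next
      case (Basis s)
      then obtain f U where s: "s = {\<mu> \<in> prob_measures T. (\<integral>x. f x \<partial>\<mu>) \<in> U}"
        and f: "continuous_map T euclideanreal f \<and> bounded (f ` topspace T)" and U: "open U"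
        by blast
      show ?case
      proof
        assume "\<nu> \<in> s"
        then have "\<forall>\<^sub>F n in sequentially. (\<integral>x. f x \<partial>\<mu> n) \<in> U"
          using R f U s by (intro topological_tendstoD) auto
        then show "\<forall>\<^sub>F n in sequentially. \<mu> n \<in> s"
          by eventually_elim (use assms s in auto)
      qed
    qed auto
    then show "\<forall>\<^sub>F n in sequentially. \<mu> n \<in> W" using W by blast
  qed
qed

subsection \<open>Stochastic kernels\<close>

text \<open>A stochastic kernel on \<open>N\<close> given \<open>M\<close> is a measurable map from \<open>M\<close> to
  \<open>prob_algebra N\<close>. On products the product \<open>\<sigma>\<close>-algebra is used; all spaces involved
  are separable and metrizable, so it is the Borel \<open>\<sigma>\<close>-algebra of the product topology.\<close>

lemma stochastic_kernel_iff:
  "K \<in> M \<rightarrow>\<^sub>M prob_algebra N \<longleftrightarrow>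
     (\<forall>s\<in>space M. K s \<in> space (prob_algebra N)) \<and>
     (\<forall>B\<in>sets N. (\<lambda>s. measure (K s) B) \<in> borel_measurable M)"  (is "?L \<longleftrightarrow> ?R")
proof
  assume K: ?L
  then have "K \<in> M \<rightarrow>\<^sub>M subprob_algebra N" by (rule measurable_prob_algebraD)
  then show ?R
    using K by (auto dest: measurable_space intro!: measurable_compose[OF _ measurable_measure_subprob_algebra])
next
  assume R: ?R
  then have P: "prob_space (K s)" "sets (K s) = sets N" if "s \<in> space M" for s
    using that by (auto simp: space_prob_algebra)
  have "K \<in> M \<rightarrow>\<^sub>M subprob_algebra N"
  proof (rule measurable_subprob_algebra)
    fix B assume B: "B \<in> sets N"
    have "(\<lambda>s. emeasure (K s) B) \<in> borel_measurable M \<longleftrightarrow>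
        (\<lambda>s. ennreal (measure (K s) B)) \<in> borel_measurable M"
      by (rule measurable_cong)
        (metis P(1) prob_space_def finite_measure.emeasure_eq_measure)
    then show "(\<lambda>s. emeasure (K s) B) \<in> borel_measurable M" using R B by auto
  qed (use P in \<open>auto intro: prob_space_imp_subprob_space\<close>)
  then show ?L using P by (intro measurable_prob_algebraI) auto
qed

definition weakly_continuous :: "'s topology \<Rightarrow> 'r topology \<Rightarrow> ('s \<Rightarrow> 'r measure) \<Rightarrow> bool" where
  "weakly_continuous TS TR K \<longleftrightarrow>
     (\<forall>s s\<^sub>0. (\<forall>n. s n \<in> topspace TS) \<and> limitin TS s s\<^sub>0 sequentially \<longrightarrow>
        limitin (weak_topology TR) (\<lambda>n. K (s n)) (K s\<^sub>0) sequentially)"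

subsection \<open>Extended real functions\<close>

text \<open>Integral of an extended real function; only used for functions that are bounded
  below, with respect to probability measures, so the subtrahend is finite.\<close>

definition ereal_integral :: "'s measure \<Rightarrow> ('s \<Rightarrow> ereal) \<Rightarrow> ereal" where
  "ereal_integral M f =
     enn2ereal (\<integral>\<^sup>+s. e2ennreal (f s) \<partial>M) - enn2ereal (\<integral>\<^sup>+s. e2ennreal (- f s) \<partial>M)"

definition lower_semicontinuous :: "'s topology \<Rightarrow> ('s \<Rightarrow> ereal) \<Rightarrow> bool" where
  "lower_semicontinuous T f \<longleftrightarrow>
     (\<forall>s s\<^sub>0. (\<forall>n. s n \<in> topspace T) \<and> limitin T s s\<^sub>0 sequentially \<longrightarrow>
        f s\<^sub>0 \<le> liminf (\<lambda>n. f (s n)))"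

definition inf_compact :: "'s topology \<Rightarrow> ('s \<Rightarrow> ereal) \<Rightarrow> bool" where
  "inf_compact T f \<longleftrightarrow> (\<forall>l::real. compactin T {s \<in> topspace T. f s \<le> ereal l})"

definition K_inf_compact :: "'s topology \<Rightarrow> 'r topology \<Rightarrow> ('s \<times> 'r \<Rightarrow> ereal) \<Rightarrow> bool" where
  "K_inf_compact T1 T2 f \<longleftrightarrow>
     (\<forall>K. compactin T1 K \<longrightarrow> inf_compact (prod_topology (subtopology T1 K) T2) f)"

definition is_min :: "ereal \<Rightarrow> ('s \<Rightarrow> ereal) \<Rightarrow> 's set \<Rightarrow> bool" where
  "is_min m f S \<longleftrightarrow> (\<exists>s\<in>S. f s = m) \<and> (\<forall>s\<in>S. m \<le> f s)"

subsection \<open>Markov decision processes\<close>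

text \<open>State space \<open>S\<close>, action space \<open>A\<close>, transition kernel \<open>p\<close>, cost \<open>c\<close>. The trajectory
  \<open>z\<^sub>0, a\<^sub>0, z\<^sub>1, a\<^sub>1, \<dots>\<close> is encoded as \<open>(z\<^sub>0, \<omega>)\<close> with \<open>\<omega> t = (a\<^sub>t, z\<^sub>t\<^sub>+\<^sub>1)\<close>; a history up to
  \<open>z\<^sub>t\<close> is then an element of \<open>S \<times> (A \<times> S)\<^sup>t\<close>.\<close>

definition state_at :: "'s \<Rightarrow> (nat \<Rightarrow> 'a \<times> 's) \<Rightarrow> nat \<Rightarrow> 's" where
  "state_at z \<omega> t = (case t of 0 \<Rightarrow> z | Suc n \<Rightarrow> snd (\<omega> n))"

definition action_at :: "(nat \<Rightarrow> 'a \<times> 's) \<Rightarrow> nat \<Rightarrow> 'a" where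
  "action_at \<omega> t = fst (\<omega> t)"

type_synonym ('s, 'a) policy = "nat \<Rightarrow> 's \<times> (nat \<Rightarrow> 'a \<times> 's) \<Rightarrow> 'a measure"

definition policies :: "'s measure \<Rightarrow> 'a measure \<Rightarrow> ('s, 'a) policy set" where
  "policies S A =
     {\<delta>. \<forall>t. \<delta> t \<in> S \<Otimes>\<^sub>M (\<Pi>\<^sub>M i\<in>{0..<t}. A \<Otimes>\<^sub>M S) \<rightarrow>\<^sub>M prob_algebra A}"

definition mdp_step ::
    "'s measure \<Rightarrow> 'a measure \<Rightarrow> ('s \<times> 'a \<Rightarrow> 's measure) \<Rightarrow> ('s, 'a) policy \<Rightarrow> 's \<Rightarrow>
     nat \<Rightarrow> (nat \<Rightarrow> 'a \<times> 's) \<Rightarrow> ('a \<times> 's) measure" where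
  "mdp_step S A p \<delta> z t \<omega> =
     \<delta> t (z, \<omega>) \<bind> (\<lambda>a. p (state_at z \<omega> t, a) \<bind> (\<lambda>z'. return (A \<Otimes>\<^sub>M S) (a, z')))"

text \<open>The law of the trajectory given the initial state, by the Ionescu Tulcea theorem.\<close>

definition mdp_law ::
    "'s measure \<Rightarrow> 'a measure \<Rightarrow> ('s \<times> 'a \<Rightarrow> 's measure) \<Rightarrow> ('s, 'a) policy \<Rightarrow> 's \<Rightarrow>
     (nat \<Rightarrow> 'a \<times> 's) measure" where
  "mdp_law S A p \<delta> z =
     projective_family.lim UNIV
       (Ionescu_Tulcea.CI (mdp_step S A p \<delta> z) (\<lambda>_. A \<Otimes>\<^sub>M S)) (\<lambda>_. A \<Otimes>\<^sub>M S)"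

text \<open>\<open>T = \<infinity>\<close> is the infinite horizon. Note \<open>0 ^ 0 = 1\<close> and \<open>0 * \<infinity> = 0\<close> in the extended reals.\<close>

definition mdp_value ::
    "'s measure \<Rightarrow> 'a measure \<Rightarrow> ('s \<times> 'a \<Rightarrow> 's measure) \<Rightarrow> ('s \<times> 'a \<Rightarrow> ereal) \<Rightarrow> real \<Rightarrow>
     enat \<Rightarrow> ('s, 'a) policy \<Rightarrow> 's \<Rightarrow> ereal" where
  "mdp_value S A p c \<alpha> T \<delta> z =
     ereal_integral (mdp_law S A p \<delta> z)
       (\<lambda>\<omega>. \<Sum>t. if enat t < T then ereal (\<alpha> ^ t) * c (state_at z \<omega> t, action_at \<omega> t) else 0)"

definition mdp_opt_value ::
    "'s measure \<Rightarrow> 'a measure \<Rightarrow> ('s \<times> 'a \<Rightarrow> 's measure) \<Rightarrow> ('s \<times> 'a \<Rightarrow> ereal) \<Rightarrow> real \<Rightarrow>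
     enat \<Rightarrow> 's \<Rightarrow> ereal" where
  "mdp_opt_value S A p c \<alpha> T z = (INF \<delta>\<in>policies S A. mdp_value S A p c \<alpha> T \<delta> z)"

definition mdp_optimal ::
    "'s measure \<Rightarrow> 'a measure \<Rightarrow> ('s \<times> 'a \<Rightarrow> 's measure) \<Rightarrow> ('s \<times> 'a \<Rightarrow> ereal) \<Rightarrow> real \<Rightarrow>
     enat \<Rightarrow> ('s, 'a) policy \<Rightarrow> bool" where
  "mdp_optimal S A p c \<alpha> T \<delta> \<longleftrightarrow>
     \<delta> \<in> policies S A \<and>
     (\<forall>z\<in>space S. mdp_value S A p c \<alpha> T \<delta> z = mdp_opt_value S A p c \<alpha> T z)"

definition markov_policy :: "'a measure \<Rightarrow> (nat \<Rightarrow> 's \<Rightarrow> 'a) \<Rightarrow> ('s, 'a) policy" where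
  "markov_policy A \<phi> t = (\<lambda>(z, \<omega>). return A (\<phi> t (state_at z \<omega> t)))"

lemma measurable_state_at:
  "(\<lambda>(z, \<omega>). state_at z \<omega> t) \<in> S \<Otimes>\<^sub>M (\<Pi>\<^sub>M i\<in>{0..<t}. A \<Otimes>\<^sub>M S) \<rightarrow>\<^sub>M S"
  by (cases t) (auto simp: state_at_def split_beta intro!: measurable_compose[OF _ measurable_snd]
    measurable_compose[OF measurable_snd measurable_component_singleton])

lemma markov_policy_in_policies:
  assumes [measurable]: "\<And>t. \<phi> t \<in> S \<rightarrow>\<^sub>M A"
  shows "markov_policy A \<phi> \<in> policies S A"
proof -
  have "(\<lambda>h. return A (\<phi> t ((\<lambda>(z, \<omega>). state_at z \<omega> t) h)))
      \<in> S \<Otimes>\<^sub>M (\<Pi>\<^sub>M i\<in>{0..<t}. A \<Otimes>\<^sub>M S) \<rightarrow>\<^sub>M prob_algebra A" for t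
    by (rule measurable_compose[OF measurable_compose[OF measurable_state_at assms]
      measurable_return_prob_space])
  then show ?thesis
    by (simp add: policies_def markov_policy_def[abs_def] split_beta)
qed

lemma Ionescu_Tulcea_mdp_step:
  assumes p: "p \<in> S \<Otimes>\<^sub>M A \<rightarrow>\<^sub>M prob_algebra S" and \<delta>: "\<delta> \<in> policies S A" and z: "z \<in> space S"
  shows "Ionescu_Tulcea (mdp_step S A p \<delta> z) (\<lambda>_. A \<Otimes>\<^sub>M S)"
proof -
  have K: "mdp_step S A p \<delta> z t \<in> (\<Pi>\<^sub>M i\<in>{0..<t}. A \<Otimes>\<^sub>M S) \<rightarrow>\<^sub>M prob_algebra (A \<Otimes>\<^sub>M S)" for t
  proof -
    let ?H = "\<Pi>\<^sub>M i\<in>{0..<t}. A \<Otimes>\<^sub>M S"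
    have [measurable]: "(\<lambda>\<omega>. state_at z \<omega> t) \<in> ?H \<rightarrow>\<^sub>M S"
      using measurable_compose[OF measurable_Pair1'[OF z] measurable_state_at] by simp
    have [measurable]: "(\<lambda>\<omega>. \<delta> t (z, \<omega>)) \<in> ?H \<rightarrow>\<^sub>M prob_algebra A"
      using \<delta> measurable_compose[OF measurable_Pair1'[OF z]] by (auto simp: policies_def)
    note [measurable] = p
    show ?thesis
      unfolding mdp_step_def[abs_def] by measurable
  qed
  show ?thesis
  proof (rule Ionescu_Tulcea.intro)
    show "mdp_step S A p \<delta> z t \<in> (\<Pi>\<^sub>M i\<in>{0..<t}. A \<Otimes>\<^sub>M S) \<rightarrow>\<^sub>M subprob_algebra (A \<Otimes>\<^sub>M S)" for t
      using K by (rule measurable_prob_algebraD)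
    show "prob_space (mdp_step S A p \<delta> z t \<omega>)"
      if "\<omega> \<in> space (\<Pi>\<^sub>M i\<in>{0..<t}. A \<Otimes>\<^sub>M S)" for t \<omega>
      using measurable_space[OF K that] by (simp add: space_prob_algebra)
  qed
qed

lemma finite_marginal_mdp_law:
  assumes "p \<in> S \<Otimes>\<^sub>M A \<rightarrow>\<^sub>M prob_algebra S" "\<delta> \<in> policies S A" "z \<in> space S" "finite J"
  shows "distr (mdp_law S A p \<delta> z) (\<Pi>\<^sub>M i\<in>J. A \<Otimes>\<^sub>M S) (\<lambda>\<omega>. restrict \<omega> J) =
    Ionescu_Tulcea.CI (mdp_step S A p \<delta> z) (\<lambda>_. A \<Otimes>\<^sub>M S) J"
  unfolding mdp_law_def
  using Ionescu_Tulcea.distr_lim[OF Ionescu_Tulcea_mdp_step[OF assms(1-3)] assms(4)] .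

subsection \<open>Partially observable Markov decision processes\<close>

text \<open>The spaces \<open>X\<close> (states), \<open>Y\<close> (observations), \<open>A\<close> (actions) are nonempty Borel subsets of
  Polish spaces.\<close>

definition pomdp ::
    "'x::polish_space set \<Rightarrow> 'y::polish_space set \<Rightarrow> 'a::polish_space set \<Rightarrow>
     ('x \<times> 'a \<Rightarrow> 'x measure) \<Rightarrow> ('a \<times> 'x \<Rightarrow> 'y measure) \<Rightarrow> ('x \<times> 'a \<Rightarrow> ereal) \<Rightarrow> bool" where
  "pomdp X Y A P Q c \<longleftrightarrow>
     X \<in> sets borel \<and> X \<noteq> {} \<and> Y \<in> sets borel \<and> Y \<noteq> {} \<and> A \<in> sets borel \<and> A \<noteq> {} \<and>
     P \<in> borel_on X \<Otimes>\<^sub>M borel_on A \<rightarrow>\<^sub>M prob_algebra (borel_on X) \<and>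
     Q \<in> borel_on A \<Otimes>\<^sub>M borel_on X \<rightarrow>\<^sub>M prob_algebra (borel_on Y) \<and>
     c \<in> borel_measurable (borel_on X \<Otimes>\<^sub>M borel_on A) \<and>
     (\<exists>b::real. \<forall>s\<in>X \<times> A. ereal b \<le> c s)"

definition assumption_D :: "'x set \<Rightarrow> 'a set \<Rightarrow> ('x \<times> 'a \<Rightarrow> ereal) \<Rightarrow> real \<Rightarrow> bool" where
  "assumption_D X A c \<alpha> \<longleftrightarrow> (\<exists>b::real. \<forall>s\<in>X \<times> A. ereal b \<le> c s) \<and> 0 \<le> \<alpha> \<and> \<alpha> < 1"

definition assumption_P :: "'x set \<Rightarrow> 'a set \<Rightarrow> ('x \<times> 'a \<Rightarrow> ereal) \<Rightarrow> real \<Rightarrow> bool" where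
  "assumption_P X A c \<alpha> \<longleftrightarrow> (\<forall>s\<in>X \<times> A. 0 \<le> c s) \<and> 0 \<le> \<alpha> \<and> \<alpha> \<le> 1"

text \<open>The topological space of beliefs.\<close>

abbreviation belief_topology :: "'x::topological_space set \<Rightarrow> 'x measure topology" where
  "belief_topology X \<equiv> weak_topology (top_of_set X)"

abbreviation beliefs :: "'x::topological_space set \<Rightarrow> 'x measure set" where
  "beliefs X \<equiv> prob_measures (top_of_set X)"

definition joint_kernel ::
    "'x::topological_space set \<Rightarrow> 'y::topological_space set \<Rightarrow>
     ('x \<times> 'a \<Rightarrow> 'x measure) \<Rightarrow> ('a \<times> 'x \<Rightarrow> 'y measure) \<Rightarrow>
     'x measure \<times> 'a \<Rightarrow> ('x \<times> 'y) measure" where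
  "joint_kernel X Y P Q = (\<lambda>(z, a).
     z \<bind> (\<lambda>x. P (x, a) \<bind> (\<lambda>x'. Q (a, x') \<bind> (\<lambda>y.
       return (borel_on X \<Otimes>\<^sub>M borel_on Y) (x', y)))))"

definition obs_kernel ::
    "'x::topological_space set \<Rightarrow> 'y::topological_space set \<Rightarrow>
     ('x \<times> 'a \<Rightarrow> 'x measure) \<Rightarrow> ('a \<times> 'x \<Rightarrow> 'y measure) \<Rightarrow>
     'x measure \<times> 'a \<Rightarrow> 'y measure" where
  "obs_kernel X Y P Q s = distr (joint_kernel X Y P Q s) (borel_on Y) snd"

lemma emeasure_joint_kernel:
  assumes P [measurable]: "P \<in> borel_on X \<Otimes>\<^sub>M borel_on A \<rightarrow>\<^sub>M prob_algebra (borel_on X)"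
    and Q [measurable]: "Q \<in> borel_on A \<Otimes>\<^sub>M borel_on X \<rightarrow>\<^sub>M prob_algebra (borel_on Y)"
    and z: "z \<in> beliefs X" and a: "a \<in> A"
    and B [measurable]: "B \<in> sets (borel_on X)" and C [measurable]: "C \<in> sets (borel_on Y)"
  shows "emeasure (joint_kernel X Y P Q (z, a)) (B \<times> C) =
    (\<integral>\<^sup>+x. (\<integral>\<^sup>+x'\<in>B. emeasure (Q (a, x')) C \<partial>P (x, a)) \<partial>z)"
proof -
  let ?N = "borel_on X \<Otimes>\<^sub>M borel_on Y"
  let ?K2 = "\<lambda>x'. Q (a, x') \<bind> (\<lambda>y. return ?N (x', y))"
  let ?K1 = "\<lambda>x. P (x, a) \<bind> ?K2"
  have a' [measurable]: "a \<in> space (borel_on A)" using a by simp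
  have BC [measurable]: "B \<times> C \<in> sets ?N" by measurable
  have K2 [measurable]: "?K2 \<in> borel_on X \<rightarrow>\<^sub>M prob_algebra ?N" by measurable
  have K1: "?K1 \<in> borel_on X \<rightarrow>\<^sub>M prob_algebra ?N" by measurable
  have 2: "emeasure (?K2 x') (B \<times> C) = emeasure (Q (a, x')) C * indicator B x'" if x': "x' \<in> X" for x'
  proof -
    have Qx: "Q (a, x') \<in> space (prob_algebra (borel_on Y))"
      using measurable_space[OF Q, of "(a, x')"] a x' by (simp add: space_pair_measure)
    have C': "C \<in> sets (Q (a, x'))" using Qx C by (simp add: space_prob_algebra)
    have "emeasure (?K2 x') (B \<times> C) = (\<integral>\<^sup>+y. emeasure (return ?N (x', y)) (B \<times> C) \<partial>Q (a, x'))"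
      using x' by (intro emeasure_bind_prob_algebra[OF Qx _ BC]) measurable
    also have "\<dots> = (\<integral>\<^sup>+y. indicator B x' * indicator C y \<partial>Q (a, x'))"
      by (simp add: indicator_times)
    also have "\<dots> = emeasure (Q (a, x')) C * indicator B x'"
      using C' by (simp add: nn_integral_cmult mult.commute)
    finally show ?thesis .
  qed
  have 1: "emeasure (?K1 x) (B \<times> C) = (\<integral>\<^sup>+x'\<in>B. emeasure (Q (a, x')) C \<partial>P (x, a))" if x: "x \<in> X" for x
  proof -
    have Px: "P (x, a) \<in> space (prob_algebra (borel_on X))"
      using measurable_space[OF P, of "(x, a)"] a x by (simp add: space_pair_measure)
    then have "space (P (x, a)) = X"
      by (auto simp: space_prob_algebra dest: sets_eq_imp_space_eq)
    then have "(\<integral>\<^sup>+x'. emeasure (?K2 x') (B \<times> C) \<partial>P (x, a)) =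
        (\<integral>\<^sup>+x'\<in>B. emeasure (Q (a, x')) C \<partial>P (x, a))"
      by (intro nn_integral_cong 2) simp
    then show ?thesis
      by (simp only: emeasure_bind_prob_algebra[OF Px K2 BC])
  qed
  have "space z = X" using z by (auto simp: space_prob_algebra dest: sets_eq_imp_space_eq)
  then have "(\<integral>\<^sup>+x. emeasure (?K1 x) (B \<times> C) \<partial>z) =
      (\<integral>\<^sup>+x. (\<integral>\<^sup>+x'\<in>B. emeasure (Q (a, x')) C \<partial>P (x, a)) \<partial>z)"
    by (intro nn_integral_cong 1) simp
  then show ?thesis
    by (simp only: joint_kernel_def prod.case emeasure_bind_prob_algebra[OF z K1 BC])
qed

text \<open>The filtering equation; \<open>H (z, a, y)\<close> is a conditional law of the next state.\<close>

definition filter_kernel ::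
    "'x::topological_space set \<Rightarrow> 'y::topological_space set \<Rightarrow> 'a::topological_space set \<Rightarrow>
     ('x \<times> 'a \<Rightarrow> 'x measure) \<Rightarrow> ('a \<times> 'x \<Rightarrow> 'y measure) \<Rightarrow>
     ('x measure \<times> 'a \<times> 'y \<Rightarrow> 'x measure) \<Rightarrow> bool" where
  "filter_kernel X Y A P Q H \<longleftrightarrow>
     H \<in> borel_of (belief_topology X) \<Otimes>\<^sub>M borel_on A \<Otimes>\<^sub>M borel_on Y \<rightarrow>\<^sub>M
       prob_algebra (borel_on X) \<and>
     (\<forall>z\<in>beliefs X. \<forall>a\<in>A. \<forall>B\<in>sets (borel_on X). \<forall>C\<in>sets (borel_on Y).
        emeasure (joint_kernel X Y P Q (z, a)) (B \<times> C) =
        (\<integral>\<^sup>+y\<in>C. emeasure (H (z, a, y)) B \<partial>obs_kernel X Y P Q (z, a)))"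

definition comdp_kernel ::
    "'x::topological_space set \<Rightarrow> 'y::topological_space set \<Rightarrow>
     ('x \<times> 'a \<Rightarrow> 'x measure) \<Rightarrow> ('a \<times> 'x \<Rightarrow> 'y measure) \<Rightarrow>
     ('x measure \<times> 'a \<times> 'y \<Rightarrow> 'x measure) \<Rightarrow> 'x measure \<times> 'a \<Rightarrow> 'x measure measure" where
  "comdp_kernel X Y P Q H = (\<lambda>(z, a).
     distr (obs_kernel X Y P Q (z, a)) (borel_of (belief_topology X)) (\<lambda>y. H (z, a, y)))"

definition comdp_cost :: "('x \<times> 'a \<Rightarrow> ereal) \<Rightarrow> 'x measure \<times> 'a \<Rightarrow> ereal" where
  "comdp_cost c = (\<lambda>(z, a). ereal_integral z (\<lambda>x. c (x, a)))"

definition comdp_opt_value ::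
    "'x::topological_space set \<Rightarrow> 'y::topological_space set \<Rightarrow> 'a::topological_space set \<Rightarrow>
     ('x \<times> 'a \<Rightarrow> 'x measure) \<Rightarrow> ('a \<times> 'x \<Rightarrow> 'y measure) \<Rightarrow> ('x \<times> 'a \<Rightarrow> ereal) \<Rightarrow>
     real \<Rightarrow> ('x measure \<times> 'a \<times> 'y \<Rightarrow> 'x measure) \<Rightarrow> enat \<Rightarrow> 'x measure \<Rightarrow> ereal" where
  "comdp_opt_value X Y A P Q c \<alpha> H T z =
     mdp_opt_value (borel_of (belief_topology X)) (borel_on A)
       (comdp_kernel X Y P Q H) (comdp_cost c) \<alpha> T z"

definition comdp_optimal ::
    "'x::topological_space set \<Rightarrow> 'y::topological_space set \<Rightarrow> 'a::topological_space set \<Rightarrow>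
     ('x \<times> 'a \<Rightarrow> 'x measure) \<Rightarrow> ('a \<times> 'x \<Rightarrow> 'y measure) \<Rightarrow> ('x \<times> 'a \<Rightarrow> ereal) \<Rightarrow>
     real \<Rightarrow> ('x measure \<times> 'a \<times> 'y \<Rightarrow> 'x measure) \<Rightarrow> enat \<Rightarrow>
     (nat \<Rightarrow> 'x measure \<Rightarrow> 'a) \<Rightarrow> bool" where
  "comdp_optimal X Y A P Q c \<alpha> H T \<phi> \<longleftrightarrow>
     mdp_optimal (borel_of (belief_topology X)) (borel_on A)
       (comdp_kernel X Y P Q H) (comdp_cost c) \<alpha> T (markov_policy (borel_on A) \<phi>)"

definition W_star ::
    "'x::topological_space set \<Rightarrow> 'y::topological_space set \<Rightarrow> 'a::topological_space set \<Rightarrow>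
     ('x \<times> 'a \<Rightarrow> 'x measure) \<Rightarrow> ('a \<times> 'x \<Rightarrow> 'y measure) \<Rightarrow> ('x \<times> 'a \<Rightarrow> ereal) \<Rightarrow>
     ('x measure \<times> 'a \<times> 'y \<Rightarrow> 'x measure) \<Rightarrow> bool" where
  "W_star X Y A P Q c H \<longleftrightarrow>
     K_inf_compact (belief_topology X) (top_of_set A) (comdp_cost c) \<and>
     weakly_continuous (prod_topology (belief_topology X) (top_of_set A)) (belief_topology X)
       (comdp_kernel X Y P Q H)"

subsection \<open>Optimality properties\<close>

definition bellman ::
    "'x::topological_space set \<Rightarrow> 'y::topological_space set \<Rightarrow>
     ('x \<times> 'a \<Rightarrow> 'x measure) \<Rightarrow> ('a \<times> 'x \<Rightarrow> 'y measure) \<Rightarrow> ('x \<times> 'a \<Rightarrow> ereal) \<Rightarrow>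
     real \<Rightarrow> ('x measure \<times> 'a \<times> 'y \<Rightarrow> 'x measure) \<Rightarrow> ('x measure \<Rightarrow> ereal) \<Rightarrow>
     'x measure \<Rightarrow> 'a \<Rightarrow> ereal" where
  "bellman X Y P Q c \<alpha> H v z a =
     comdp_cost c (z, a) + ereal \<alpha> * ereal_integral (comdp_kernel X Y P Q H (z, a)) v"

definition bellman_filter ::
    "('x \<times> 'a \<Rightarrow> 'x measure) \<Rightarrow> ('a \<times> 'x \<Rightarrow> 'y measure) \<Rightarrow> ('x \<times> 'a \<Rightarrow> ereal) \<Rightarrow>
     real \<Rightarrow> ('x measure \<times> 'a \<times> 'y \<Rightarrow> 'x measure) \<Rightarrow> ('x measure \<Rightarrow> ereal) \<Rightarrow>
     'x measure \<Rightarrow> 'a \<Rightarrow> ereal" where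
  "bellman_filter P Q c \<alpha> H v z a =
     ereal_integral z (\<lambda>x. c (x, a)) +
     ereal \<alpha> * ereal_integral z (\<lambda>x. ereal_integral (P (x, a)) (\<lambda>x'.
       ereal_integral (Q (a, x')) (\<lambda>y. v (H (z, a, y)))))"

definition opt_actions ::
    "'x::topological_space set \<Rightarrow> 'y::topological_space set \<Rightarrow> 'a::topological_space set \<Rightarrow>
     ('x \<times> 'a \<Rightarrow> 'x measure) \<Rightarrow> ('a \<times> 'x \<Rightarrow> 'y measure) \<Rightarrow> ('x \<times> 'a \<Rightarrow> ereal) \<Rightarrow>
     real \<Rightarrow> ('x measure \<times> 'a \<times> 'y \<Rightarrow> 'x measure) \<Rightarrow> ('x measure \<Rightarrow> ereal) \<Rightarrow>
     ('x measure \<Rightarrow> ereal) \<Rightarrow> 'x measure \<Rightarrow> 'a set" where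
  "opt_actions X Y A P Q c \<alpha> H w v z = {a \<in> A. w z = bellman X Y P Q c \<alpha> H v z a}"

text \<open>The optimality equation expressing \<open>w\<close> through \<open>v\<close>, together with the properties of the
  sets of minimizers. For horizon \<open>t + 1\<close>, \<open>w\<close> and \<open>v\<close> are the optimal values for horizons
  \<open>t + 1\<close> and \<open>t\<close>; for the infinite horizon both are the optimal value.\<close>

definition optimality_equation ::
    "'x::topological_space set \<Rightarrow> 'y::topological_space set \<Rightarrow> 'a::topological_space set \<Rightarrow>
     ('x \<times> 'a \<Rightarrow> 'x measure) \<Rightarrow> ('a \<times> 'x \<Rightarrow> 'y measure) \<Rightarrow> ('x \<times> 'a \<Rightarrow> ereal) \<Rightarrow>
     real \<Rightarrow> ('x measure \<times> 'a \<times> 'y \<Rightarrow> 'x measure) \<Rightarrow> ('x measure \<Rightarrow> ereal) \<Rightarrow>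
     ('x measure \<Rightarrow> ereal) \<Rightarrow> bool" where
  "optimality_equation X Y A P Q c \<alpha> H w v \<longleftrightarrow>
     (let G = opt_actions X Y A P Q c \<alpha> H w v in
      (\<forall>z\<in>beliefs X.
         is_min (w z) (bellman X Y P Q c \<alpha> H v z) A \<and>
         is_min (w z) (bellman_filter P Q c \<alpha> H v z) A \<and>
         G z \<noteq> {} \<and>
         (w z = \<infinity> \<longrightarrow> G z = A) \<and>
         (w z < \<infinity> \<longrightarrow> compact (G z))) \<and>
      {(z, a). z \<in> beliefs X \<and> a \<in> G z} \<in> sets (borel_of (belief_topology X) \<Otimes>\<^sub>M borel_on A))"

definition optimality_properties ::
    "'x::topological_space set \<Rightarrow> 'y::topological_space set \<Rightarrow> 'a::topological_space set \<Rightarrow>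
     ('x \<times> 'a \<Rightarrow> 'x measure) \<Rightarrow> ('a \<times> 'x \<Rightarrow> 'y measure) \<Rightarrow> ('x \<times> 'a \<Rightarrow> ereal) \<Rightarrow>
     real \<Rightarrow> ('x measure \<times> 'a \<times> 'y \<Rightarrow> 'x measure) \<Rightarrow> bool" where
  "optimality_properties X Y A P Q c \<alpha> H \<longleftrightarrow>
     (let BX = borel_of (belief_topology X);
          v = comdp_opt_value X Y A P Q c \<alpha> H;
          opt = comdp_optimal X Y A P Q c \<alpha> H;
          G = (\<lambda>t. opt_actions X Y A P Q c \<alpha> H (v (enat (Suc t))) (v (enat t)));
          G_inf = opt_actions X Y A P Q c \<alpha> H (v \<infinity>) (v \<infinity>)
      in
      ((\<forall>t. lower_semicontinuous (belief_topology X) (v (enat t))) \<and>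
       lower_semicontinuous (belief_topology X) (v \<infinity>) \<and>
       (\<forall>z\<in>beliefs X. (\<lambda>t. v (enat t) z) \<longlonglongrightarrow> v \<infinity> z)) \<and>
      (\<forall>t. optimality_equation X Y A P Q c \<alpha> H (v (enat (Suc t))) (v (enat t))) \<and>
      \<comment> \<open>only the first \<open>T\<close> decision rules of \<open>\<phi>\<close> affect the value for horizon \<open>T\<close>\<close>
      (\<forall>T\<ge>1. (\<exists>\<phi>. (\<forall>t. \<phi> t \<in> BX \<rightarrow>\<^sub>M borel_on A) \<and> opt (enat T) \<phi>) \<and>
         (\<forall>\<phi>. (\<forall>t. \<phi> t \<in> BX \<rightarrow>\<^sub>M borel_on A) \<and>
            (\<forall>t<T. \<forall>z\<in>beliefs X. \<phi> (T - 1 - t) z \<in> G t z) \<longrightarrow> opt (enat T) \<phi>)) \<and>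
      optimality_equation X Y A P Q c \<alpha> H (v \<infinity>) (v \<infinity>) \<and>
      ((\<exists>\<phi>. \<phi> \<in> BX \<rightarrow>\<^sub>M borel_on A \<and> opt \<infinity> (\<lambda>_. \<phi>)) \<and>
       (\<forall>\<phi>. \<phi> \<in> BX \<rightarrow>\<^sub>M borel_on A \<longrightarrow>
          (opt \<infinity> (\<lambda>_. \<phi>) \<longleftrightarrow> (\<forall>z\<in>beliefs X. \<phi> z \<in> G_inf z)))) \<and>
      (inf_compact (prod_topology (belief_topology X) (top_of_set A)) (comdp_cost c) \<longrightarrow>
       (\<forall>t\<ge>1. inf_compact (belief_topology X) (v (enat t))) \<and>
       inf_compact (belief_topology X) (v \<infinity>)))"

end

theory Submission
  imports Defs
begin

text \<open>
  The transition kernel \<open>q\<close> of the filter is the image of the observation law \<open>R'(dy | z, a)\<close> under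
  \<open>y \<mapsto> H (z, a, y)\<close>. Its weak continuity says that the integrals of \<open>f (H (z\<^sub>n, a\<^sub>n, y))\<close> converge for bounded
  continuous \<open>f\<close>. Passing from \<open>f\<close> to \<open>f + B\<close> and \<open>B - f\<close>, it is enough to bound the limit by the lower limit of
  the integrals for \<open>f \<ge> 0\<close>, and to do so along some subsequence of every subsequence. On the open part \<open>Y1\<close>
  this is Fatou's lemma for weakly convergent measures and varying integrands (\<open>fatou_weak_convergence\<close>),
  where weak convergence of the observation laws comes from the continuity of \<open>P\<close> and \<open>Q\<close>. On \<open>Y2\<close> it is
  Fatou's lemma for setwise convergence (\<open>fatou_setwise_convergence\<close>). Filters agree almost everywhere, so
  the version \<open>H'\<close> with good continuity properties may be used.

  The averaged cost is lower semicontinuous, again by Fatou's lemma. For its K-inf-compactness it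
  remains to see that actions with bounded averaged costs accumulate: sublevel sets of the original costs
  carry half of the mass of the beliefs, and since the beliefs converge weakly, these sets accumulate
  at a state (\<open>sublevel_accumulation_point\<close>), where K-inf-compactness of the original cost applies.

  For the optimality properties the lower bound of the cost is split off, so that all values become
  nonnegative. Value iteration \<open>v\<^sub>n\<^sub>+\<^sub>1 z = inf\<^sub>a (C (z, a) + \<alpha> \<integral>v\<^sub>n dq)\<close> preserves lower semicontinuity, minima are
  attained, and limits in \<open>n\<close> may be exchanged with the minimum, all because near-minimizing actions
  accumulate (\<open>inf_Q_limit\<close>, \<open>v_inf_fixed_point\<close>). That \<open>v\<^sub>n\<close> bounds the cost of every history-dependent policy and
  is attained by Markov policies follows from one identity for a single step of the trajectory
  (\<open>one_step\<close>); the minimizing decision rules are measurable by a selection theorem for compact sets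
  (\<open>measurable_selection_compact\<close>).

  Throughout, topological properties of beliefs are checked on sequences and their measurability on
  evaluations. Both are legitimate because the probability measures on a separable metrizable space embed
  into \<open>\<real>\<^sup>\<nat>\<close> (\<open>weak_topology_embedding\<close>): the weak topology is metrizable and its Borel sets are generated by the
  evaluations.\<close>

section \<open>Sequences, semicontinuity and Borel sets\<close>

lemma second_countable_euclidean_subspace:
  "second_countable (top_of_set (S :: 'x::second_countable_topology set))"
proof -
  obtain B :: "'x set set" where B: "countable B" "topological_basis B"
    using ex_countable_basis by blast
  have "second_countable (euclidean :: 'x topology)"
    unfolding second_countable_def
  proof (intro exI[of _ B] conjI ballI allI impI)
    show "openin euclidean V" if "V \<in> B" for V using topological_basis_open[OF B(2) that] by simp
    show "\<exists>V\<in>B. x \<in> V \<and> V \<subseteq> U" if "openin euclidean U \<and> x \<in> U" for U x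
      using topological_basisE[OF B(2), of U x] that by (metis open_openin)
  qed (rule B(1))
  then show ?thesis by (rule second_countable_subtopology)
qed

lemma metrizable_euclidean_subspace: "metrizable_space (top_of_set (S :: 'x::metric_space set))"
  using metrizable_space_euclidean by (rule metrizable_space_subtopology)

lemma limitin_top_of_set:
  "(\<And>n. s n \<in> S) \<Longrightarrow> limitin (top_of_set S) s l sequentially \<longleftrightarrow> l \<in> S \<and> s \<longlonglongrightarrow> l"
  by (auto simp: limitin_subtopology)

text \<open>A convergence theorem that only supplies a subsequence, such as almost sure convergence of filters,
  still yields convergence of the whole sequence once the limit is known.\<close>

lemma limitin_if_subsequences:
  assumes l: "l \<in> topspace T"
    and sub: "\<And>r :: nat \<Rightarrow> nat. strict_mono r \<Longrightarrow>
      \<exists>r' :: nat \<Rightarrow> nat. strict_mono r' \<and> limitin T (\<lambda>n. X (r (r' n))) l sequentially"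
  shows "limitin T X l sequentially"
  unfolding limitin_def
proof (intro conjI l allI impI)
  fix U assume U: "openin T U \<and> l \<in> U"
  show "\<forall>\<^sub>F n in sequentially. X n \<in> U"
  proof (rule ccontr)
    assume "\<not> (\<forall>\<^sub>F n in sequentially. X n \<in> U)"
    then obtain r :: "nat \<Rightarrow> nat" where r: "strict_mono r" "\<And>n. X (r n) \<notin> U"
      by (auto dest: not_eventually_sequentiallyD)
    then obtain r' where "limitin T (\<lambda>n. X (r (r' n))) l sequentially" using sub by blast
    then have "\<forall>\<^sub>F n in sequentially. X (r (r' n)) \<in> U" using U by (auto simp: limitin_def)
    then show False using r(2) by auto
  qed
qed

text \<open>Lower semicontinuity along sequences with values in an arbitrary complete linear order. For extended
  real values it is \<^const>\<open>lower_semicontinuous\<close>; the value functions below take values in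
  \<^typ>\<open>ennreal\<close>.\<close>

definition seq_lsc :: "'s topology \<Rightarrow> ('s \<Rightarrow> 'b::complete_linorder) \<Rightarrow> bool" where
  "seq_lsc T f \<longleftrightarrow>
     (\<forall>s s\<^sub>0. (\<forall>n. s n \<in> topspace T) \<and> limitin T s s\<^sub>0 sequentially \<longrightarrow>
        f s\<^sub>0 \<le> liminf (\<lambda>n. f (s n)))"

lemma closedin_metrizable_sequentially:
  assumes T: "metrizable_space T" and S: "S \<subseteq> topspace T"
    and lim: "\<And>s l. (\<And>n. s n \<in> S) \<Longrightarrow> limitin T s l sequentially \<Longrightarrow> l \<in> S"
  shows "closedin T S"
proof -
  obtain M d where M: "Metric_space M d" and Td: "T = Metric_space.mtopology M d"
    using T unfolding metrizable_space_def by auto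
  interpret Metric_space M d by fact
  show ?thesis
    unfolding Td metric_closedin_iff_sequentially_closed
    using S lim by (simp add: Td image_subset_iff) blast
qed

lemma compactin_metrizable_sequentially:
  assumes T: "metrizable_space T"
  shows "compactin T S \<longleftrightarrow> S \<subseteq> topspace T \<and>
    (\<forall>s::nat \<Rightarrow> 'a. (\<forall>n. s n \<in> S) \<longrightarrow>
       (\<exists>l r. l \<in> S \<and> strict_mono r \<and> limitin T (s \<circ> r) l sequentially))"
proof -
  obtain M d where M: "Metric_space M d" and Td: "T = Metric_space.mtopology M d"
    using T unfolding metrizable_space_def by auto
  interpret Metric_space M d by fact
  show ?thesis
    unfolding Td compactin_sequentially by (simp add: image_subset_iff)
qed

lemma limitin_compose_filterlim:
  "limitin T s l F \<Longrightarrow> filterlim r F G \<Longrightarrow> limitin T (\<lambda>k. s (r k)) l G"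
  unfolding limitin_def filterlim_iff by blast

lemma seq_lsc_sublevel_closed:
  assumes T: "metrizable_space T" and f: "seq_lsc T f"
  shows "closedin T {s \<in> topspace T. f s \<le> l}"
proof (rule closedin_metrizable_sequentially[OF T])
  fix s s0 assume s: "\<And>n. s n \<in> {s \<in> topspace T. f s \<le> l}" and lim: "limitin T s s0 sequentially"
  have "f s0 \<le> liminf (\<lambda>n. f (s n))" using f s lim unfolding seq_lsc_def by blast
  also have "\<dots> \<le> liminf (\<lambda>n. l)" using s by (intro Liminf_mono) auto
  finally show "s0 \<in> {s \<in> topspace T. f s \<le> l}"
    using limitin_topspace[OF lim] by (simp add: Liminf_const)
qed auto

lemma seq_lsc_SUP:
  fixes f :: "'i \<Rightarrow> 's \<Rightarrow> 'b::complete_linorder"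
  assumes "\<And>i. i \<in> I \<Longrightarrow> seq_lsc T (f i)"
  shows "seq_lsc T (\<lambda>s. SUP i\<in>I. f i s)"
  unfolding seq_lsc_def
proof (intro allI impI SUP_least)
  fix s s0 i assume s: "(\<forall>n. s n \<in> topspace T) \<and> limitin T s s0 sequentially" and i: "i \<in> I"
  have "f i s0 \<le> liminf (\<lambda>n. f i (s n))" using assms[OF i] s unfolding seq_lsc_def by blast
  also have "\<dots> \<le> liminf (\<lambda>n. SUP i\<in>I. f i (s n))"
    using i by (intro Liminf_mono always_eventually allI SUP_upper)
  finally show "f i s0 \<le> liminf (\<lambda>n. SUP i\<in>I. f i (s n))" .
qed

lemma seq_lsc_ennreal_continuous:
  assumes f: "continuous_map T euclideanreal f"
  shows "seq_lsc T (\<lambda>x. ennreal (f x))"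
  unfolding seq_lsc_def
proof (intro allI impI)
  fix s s0 assume s: "(\<forall>n. s n \<in> topspace T) \<and> limitin T s s0 sequentially"
  then have "limitin euclideanreal (f \<circ> s) (f s0) sequentially"
    using continuous_map_limit[OF f] by blast
  then have "(\<lambda>n. ennreal (f (s n))) \<longlonglongrightarrow> ennreal (f s0)"
    by (intro tendsto_ennrealI) (simp add: comp_def)
  then show "ennreal (f s0) \<le> liminf (\<lambda>n. ennreal (f (s n)))"
    using lim_imp_Liminf[OF sequentially_bot] by (metis order_refl)
qed

lemma seq_lsc_open_indicator:
  assumes U: "openin T U"
  shows "seq_lsc T (indicator U :: 's \<Rightarrow> ennreal)"
  unfolding seq_lsc_def
proof (intro allI impI)
  fix s x assume s: "(\<forall>n. s n \<in> topspace T) \<and> limitin T s x sequentially"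
  show "indicator U x \<le> liminf (\<lambda>n. indicator U (s n) :: ennreal)"
  proof (cases "x \<in> U")
    case True
    with s U have "\<forall>\<^sub>F n in sequentially. s n \<in> U" by (auto simp: limitin_def)
    then have "\<forall>\<^sub>F n in sequentially. 1 \<le> (indicator U (s n) :: ennreal)" by eventually_elim simp
    then have "1 \<le> liminf (\<lambda>n. indicator U (s n) :: ennreal)" by (rule Liminf_bounded)
    then show ?thesis using True by simp
  qed simp
qed

lemma closedin_in_borel_of: "closedin T S \<Longrightarrow> S \<in> sets (borel_of T)"
proof -
  assume S: "closedin T S"
  then have "topspace T - S \<in> sets (borel_of T)" 
    by (auto simp: sets_borel_of intro: sigma_sets.Basic)
  then have "topspace T - (topspace T - S) \<in> sets (borel_of T)"
    using sets.compl_sets[of "topspace T - S" "borel_of T"] by simp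
  then show ?thesis using closedin_subset[OF S] by (simp add: double_diff)
qed

lemma openin_in_borel_of: "openin T S \<Longrightarrow> S \<in> sets (borel_of T)"
  by (auto simp: sets_borel_of intro: sigma_sets.Basic)

lemma seq_lsc_measurable:
  fixes f :: "'s \<Rightarrow> ennreal"
  assumes T: "metrizable_space T" and f: "seq_lsc T f"
  shows "f \<in> borel_measurable (borel_of T)"
proof (rule borel_measurableI_le)
  fix l
  show "{x \<in> space (borel_of T). f x \<le> l} \<in> sets (borel_of T)"
    using closedin_in_borel_of[OF seq_lsc_sublevel_closed[OF T f]] by simp
qed

lemma continuous_map_borel_of:
  assumes f: "continuous_map T euclidean f"
  shows "f \<in> borel_measurable (borel_of T)"
proof (rule borel_measurableI)
  fix U :: "'b set" assume "open U"
  then have "openin T {x \<in> topspace T. f x \<in> U}" using f by (auto simp: continuous_map_def)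
  then show "f -` U \<inter> space (borel_of T) \<in> sets (borel_of T)"
    using openin_in_borel_of by (simp add: vimage_def Int_def conj_commute)
qed

lemma prob_measuresD:
  assumes "\<mu> \<in> prob_measures T"
  shows "prob_space \<mu>" "sets \<mu> = sets (borel_of T)" "space \<mu> = topspace T"
  using assms by (auto simp: space_prob_algebra dest: sets_eq_imp_space_eq)

text \<open>The finite intersections of members of a countable base form a countable \<open>\<pi>\<close>-system, so two
  measures that are compared on countably many sets can be compared everywhere.\<close>

lemma countable_generator_borel_of:
  assumes sc: "second_countable T"
  obtains E where "countable E" "Int_stable E" "E \<subseteq> Pow (topspace T)" "topspace T \<in> E"
    "sets (borel_of T) = sigma_sets (topspace T) E"
proof -
  obtain B where B': "countable B \<and> (\<forall>V \<in> B. openin T V) \<and>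
      (\<forall>U x. openin T U \<and> x \<in> U \<longrightarrow> (\<exists>V \<in> B. x \<in> V \<and> V \<subseteq> U))"
    using sc unfolding second_countable_def by auto
  then have B: "countable B" "\<And>V. V \<in> B \<Longrightarrow> openin T V"
    "\<And>U x. openin T U \<Longrightarrow> x \<in> U \<Longrightarrow> \<exists>V\<in>B. x \<in> V \<and> V \<subseteq> U"
    by simp_all
  define E where "E = (\<lambda>F. topspace T \<inter> \<Inter>F) ` {F. finite F \<and> F \<subseteq> B}"
  have cE: "countable E" unfolding E_def using B(1) by (intro countable_image countable_Collect_finite_subset)
  have openE: "openin T V" if VE: "V \<in> E" for V
  proof -
    obtain F where F: "finite F" "F \<subseteq> B" "V = topspace T \<inter> \<Inter>F"
      using VE unfolding E_def by blast
    have "openin T (topspace T \<inter> \<Inter>F)"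
      using F(1,2)
    proof (induction F rule: finite_induct)
      case (insert V F)
      then have "openin T V" "openin T (topspace T \<inter> \<Inter>F)" using B(2) by blast+
      then have "openin T (V \<inter> (topspace T \<inter> \<Inter>F))" by (rule openin_Int)
      then show ?case by (simp add: Int_left_commute)
    qed simp
    then show ?thesis using F by simp
  qed
  have BE: "B \<subseteq> E"
  proof
    fix V assume "V \<in> B"
    then show "V \<in> E" unfolding E_def using B(2)[THEN openin_subset, of V]
      by (intro image_eqI[of _ _ "{V}"]) auto
  qed
  show thesis
  proof (rule that[OF cE])
    show "Int_stable E"
      unfolding Int_stable_def
    proof (intro ballI)
      fix U V assume "U \<in> E" "V \<in> E"
      then obtain F G where "finite F" "F \<subseteq> B" "U = topspace T \<inter> \<Inter>F" "finite G" "G \<subseteq> B" "V = topspace T \<inter> \<Inter>G"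
        unfolding E_def by blast
      then show "U \<inter> V \<in> E" unfolding E_def by (intro image_eqI[of _ _ "F \<union> G"]) auto
    qed
    show "E \<subseteq> Pow (topspace T)" using openE openin_subset by blast
    show "topspace T \<in> E" unfolding E_def by (intro image_eqI[of _ _ "{}"]) auto
    show "sets (borel_of T) = sigma_sets (topspace T) E"
      unfolding sets_borel_of
    proof (rule sigma_sets_eqI)
      fix U assume "U \<in> {U. openin T U}"
      then have U: "openin T U" by simp
      have "U = \<Union>{V\<in>B. V \<subseteq> U}" using B(3)[OF U] by blast
      moreover have "\<Union>{V\<in>B. V \<subseteq> U} \<in> sigma_sets (topspace T) E"
        using BE B(1) by (intro sigma_sets_UNION) (auto intro: sigma_sets.Basic)
      ultimately show "U \<in> sigma_sets (topspace T) E" by simp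
    qed (use openE in \<open>auto intro: sigma_sets.Basic\<close>)
  qed
qed


section \<open>Fatou's lemma for weakly convergent measures\<close>

text \<open>The functions \<open>h m x = inf {min m (gs k y) + m d(x, y) | k \<ge> m, y}\<close> are
  Moreau--Yosida regularizations, taken jointly over a tail of a sequence of functions: \<open>h m\<close> is
  \<open>m\<close>-Lipschitz as an infimum of \<open>m\<close>-Lipschitz functions, increases with \<open>m\<close> and stays below \<open>gs k\<close> for
  \<open>k \<ge> m\<close> (take \<open>y = x\<close>). If all \<open>h m x\<close> stayed below some \<open>t < l\<close>, the penalty
  \<open>m d(x, y)\<close> would force near-minimizers \<open>(k, y)\<close> with \<open>y \<rightarrow> x\<close>, \<open>k \<rightarrow> \<infinity>\<close> and values below \<open>t\<close>,
  which the hypothesis on \<open>l\<close> excludes.\<close>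

lemma yosida_regularization:
  fixes gs :: "nat \<Rightarrow> 's \<Rightarrow> ennreal"
  assumes T: "metrizable_space T"
  shows "\<exists>h :: nat \<Rightarrow> 's \<Rightarrow> real. (\<forall>m. continuous_map T euclideanreal (h m)) \<and>
    (\<forall>m. \<forall>x\<in>topspace T. 0 \<le> h m x \<and> h m x \<le> real m) \<and>
    (\<forall>x\<in>topspace T. \<forall>m m'. m \<le> m' \<longrightarrow> h m x \<le> h m' x) \<and>
    (\<forall>x\<in>topspace T. \<forall>m k. m \<le> k \<longrightarrow> ennreal (h m x) \<le> gs k x) \<and>
    (\<forall>x\<in>topspace T. \<forall>l.
       (\<forall>r s. filterlim r sequentially sequentially \<and> (\<forall>n. s n \<in> topspace T) \<and>
         limitin T s x sequentially \<longrightarrow> l \<le> liminf (\<lambda>n. gs (r n) (s n))) \<longrightarrow>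
       l \<le> (SUP m. ennreal (h m x)))"
proof -
  obtain M d where M: "Metric_space M d" and Td: "T = Metric_space.mtopology M d"
    using T unfolding metrizable_space_def by auto
  interpret Metric_space M d by fact
  have top: "topspace T = M" by (simp add: Td)
  define H where "H m x = (INF p\<in>{m..}\<times>M.
      min (of_nat m) (gs (fst p) (snd p)) + ennreal (real m * d x (snd p)))" for m x
  have le: "H m x \<le> min (of_nat m) (gs k x)" if "x \<in> M" "m \<le> k" for m k x
    unfolding H_def by (rule INF_lower2[of "(k, x)"]) (use that in auto)
  have fin: "H m x \<le> of_nat m" if "x \<in> M" for m x
    using le[OF that order_refl, of m] by simp
  have lip: "H m x \<le> H m y + ennreal (real m * d x y)" if xy: "x \<in> M" "y \<in> M" for m x y
  proof -
    have "H m x - ennreal (real m * d x y) \<le> H m y"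
      unfolding H_def[of m y]
    proof (rule INF_greatest)
      fix p assume p: "p \<in> {m..} \<times> M"
      have "real m * d x (snd p) \<le> real m * d x y + real m * d y (snd p)"
        using triangle[of x y "snd p"] p xy
        by (auto simp: mult_left_mono simp flip: distrib_left)
      then have "ennreal (real m * d x (snd p)) \<le> ennreal (real m * d x y) + ennreal (real m * d y (snd p))"
        by (simp add: ennreal_leI flip: ennreal_plus)
      then have "min (of_nat m) (gs (fst p) (snd p)) + ennreal (real m * d x (snd p)) \<le>
          ennreal (real m * d x y) + (min (of_nat m) (gs (fst p) (snd p)) + ennreal (real m * d y (snd p)))"
        by (metis add_left_mono add.left_commute)
      moreover have "H m x \<le> min (of_nat m) (gs (fst p) (snd p)) + ennreal (real m * d x (snd p))"
        unfolding H_def using p by (rule INF_lower)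
      ultimately have "H m x \<le> ennreal (real m * d x y) +
          (min (of_nat m) (gs (fst p) (snd p)) + ennreal (real m * d y (snd p)))"
        by (rule order_trans[rotated])
      then show "H m x - ennreal (real m * d x y) \<le>
          min (of_nat m) (gs (fst p) (snd p)) + ennreal (real m * d y (snd p))"
        unfolding ennreal_minus_le_iff by simp
    qed
    then show ?thesis by (simp add: ennreal_minus_le_iff add.commute)
  qed
  define h where "h m x = enn2real (H m x)" for m x
  have hH: "ennreal (h m x) = H m x" if "x \<in> M" for m x
    unfolding h_def using fin[OF that, of m]
    by (intro ennreal_enn2real) (auto simp: less_top[symmetric] top_unique)
  have h0: "0 \<le> h m x" for m x by (simp add: h_def)
  have hlip: "h m x \<le> h m y + real m * d x y" if xy: "x \<in> M" "y \<in> M" for m x y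
  proof -
    have "ennreal (h m x) \<le> ennreal (h m y + real m * d x y)"
      using lip[OF xy, of m] xy h0 by (simp add: hH ennreal_plus)
    then show ?thesis using h0[of m y] xy by (subst (asm) ennreal_le_iff) auto
  qed
  show ?thesis
  proof (intro exI[of _ h] conjI ballI allI impI)
    show "continuous_map T euclideanreal (h m)" for m
    proof -
      have "Lipschitz_continuous_map (metric (M, d)) euclidean_metric (h m)"
        unfolding Lipschitz_continuous_map_def
      proof (intro conjI exI[of _ "real m"] ballI)
        fix x y assume "x \<in> mspace (metric (M, d))" "y \<in> mspace (metric (M, d))"
        then have "x \<in> M" "y \<in> M" by auto
        with hlip[of x y m] hlip[of y x m] show "mdist euclidean_metric (h m x) (h m y) \<le> real m * mdist (metric (M, d)) x y"
          by (auto simp: dist_real_def commute)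
      qed auto
      from Lipschitz_continuous_imp_continuous_map[OF this] show ?thesis by (simp add: Td mtopology_of_def)
    qed
    show "0 \<le> h m x" if "x \<in> topspace T" for m x
      by (rule h0)
    show "h m x \<le> real m" if "x \<in> topspace T" for m x
    proof -
      have "ennreal (h m x) \<le> ennreal (real m)" using fin[of x m] that hH[of x m] top by (simp add: ennreal_of_nat_eq_real_of_nat)
      then show ?thesis using h0 by (simp add: ennreal_le_iff)
    qed
    show "h m x \<le> h m' x" if x: "x \<in> topspace T" and m: "m \<le> m'" for m m' x
    proof -
      have "H m x \<le> H m' x"
        unfolding H_def
      proof (rule INF_mono)
        fix p assume p: "p \<in> {m'..} \<times> M"
        show "\<exists>q\<in>{m..} \<times> M. min (of_nat m) (gs (fst q) (snd q)) + ennreal (real m * d x (snd q))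
          \<le> min (of_nat m') (gs (fst p) (snd p)) + ennreal (real m' * d x (snd p))"
          using p m x top
          by (intro bexI[of _ p] add_mono min.mono ennreal_leI mult_right_mono) auto
      qed
      then have "ennreal (h m x) \<le> ennreal (h m' x)" using x top hH by simp
      then show ?thesis using h0 by (simp add: ennreal_le_iff)
    qed
    show "ennreal (h m x) \<le> gs k x" if "x \<in> topspace T" "m \<le> k" for m k x
      using le[of x m k] that hH top by simp
    show "l \<le> (SUP m. ennreal (h m x))"
      if x: "x \<in> topspace T" and lsc: "\<forall>r s. filterlim r sequentially sequentially \<and>
         (\<forall>n. s n \<in> topspace T) \<and>
         limitin T s x sequentially \<longrightarrow> l \<le> liminf (\<lambda>n. gs (r n) (s n))" for x l
    proof (rule ccontr)
      assume "\<not> ?thesis"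
      then obtain t where t: "(SUP m. ennreal (h m x)) < t" "t < l"
        using dense by (metis not_le)
      then have tfin: "t < top" by (metis top.not_eq_extremum not_less_iff_gr_or_eq order_less_trans top_greatest leD)
      obtain tr where tr: "t = ennreal tr" "0 \<le> tr" using tfin by (cases t) auto
      have ex: "\<exists>p\<in>{m..}\<times>M. min (of_nat m) (gs (fst p) (snd p)) + ennreal (real m * d x (snd p)) < t" for m
      proof -
        have "H m x < t" using t(1) hH[of x m] x top by (metis SUP_lessD UNIV_I)
        then show ?thesis unfolding H_def INF_less_iff .
      qed
      then obtain p where p: "\<And>m. p m \<in> {m..}\<times>M"
        "\<And>m. min (of_nat m) (gs (fst (p m)) (snd (p m))) + ennreal (real m * d x (snd (p m))) < t"
        by metis
      define r where "r m = fst (p m)" for m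
      define s where "s m = snd (p m)" for m
      have r: "m \<le> r m" and s: "s m \<in> M" for m using p(1)[of m] by (auto simp: r_def s_def mem_Times_iff)
      have p1: "min (of_nat m) (gs (r m) (s m)) < t" for m
        by (rule le_less_trans[OF _ p(2)[of m]]) (auto simp: r_def s_def intro: add_increasing2)
      have p2: "real m * d x (s m) < tr" for m
      proof -
        have "ennreal (real m * d x (s m)) < ennreal tr"
          unfolding tr(1)[symmetric]
          by (rule le_less_trans[OF _ p(2)[of m]]) (auto simp: s_def intro: add_increasing)
        then show ?thesis by (subst (asm) ennreal_less_iff) auto
      qed
      have rl: "filterlim r sequentially sequentially"
        using r by (rule filterlim_at_top_mono[OF filterlim_ident, OF always_eventually[OF allI]])
      have "(\<lambda>m. d (s m) x) \<longlonglongrightarrow> 0"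
      proof (rule tendsto_sandwich[where f="\<lambda>_. 0" and h="\<lambda>m. tr / real m"])
        show "\<forall>\<^sub>F m in sequentially. d (s m) x \<le> tr / real m"
          using eventually_gt_at_top[of 0]
        proof eventually_elim
          case (elim m) then show ?case using p2[of m] by (simp add: field_simps commute less_imp_le)
        qed
        show "(\<lambda>m. tr / real m) \<longlonglongrightarrow> 0" by (rule lim_const_over_n)
      qed auto
      then have "limitin T s x sequentially"
        unfolding Td limit_metric_sequentially using x s top
        by (auto simp: LIMSEQ_def)
      then have "l \<le> liminf (\<lambda>n. gs (r n) (s n))" using rl s top lsc by auto
      with t(2) have "t < liminf (\<lambda>n. gs (r n) (s n))" by simp
      then have "\<forall>\<^sub>F n in sequentially. t < gs (r n) (s n)"
        using less_LiminfD by blast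
      moreover have "\<forall>\<^sub>F n in sequentially. tr < real n"
        using filterlim_real_sequentially by (simp add: filterlim_at_top_dense)
      ultimately have "\<forall>\<^sub>F n in sequentially. False"
      proof eventually_elim
        case (elim n)
        have "t \<le> of_nat n" using elim(2) tr by (simp add: ennreal_leI flip: ennreal_of_nat_eq_real_of_nat)
        with elim(1) p1[of n] show False by (auto simp: min_def split: if_splits)
      qed
      then show False by simp
    qed
  qed
qed

lemma liminf_add_le_ennreal:
  fixes f g :: "nat \<Rightarrow> ennreal"
  shows "liminf f + liminf g \<le> liminf (\<lambda>n. f n + g n)"
proof -
  have inc: "incseq (\<lambda>n. INF m\<in>{n..}. f m)" for f :: "nat \<Rightarrow> ennreal"
    by (intro monoI INF_superset_mono) auto
  have "liminf f + liminf g = (SUP n. (INF m\<in>{n..}. f m) + (INF m\<in>{n..}. g m))"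
    unfolding liminf_SUP_INF by (rule ennreal_SUP_add[OF inc inc, symmetric])
  also have "\<dots> \<le> liminf (\<lambda>n. f n + g n)"
    unfolding liminf_SUP_INF by (intro SUP_mono' INF_greatest add_mono INF_lower) auto
  finally show ?thesis .
qed

lemma mult_liminf_le_ennreal:
  fixes f :: "nat \<Rightarrow> ennreal"
  shows "c * liminf f \<le> liminf (\<lambda>n. c * f n)"
  unfolding liminf_SUP_INF SUP_mult_left_ennreal
  by (intro SUP_mono' INF_greatest mult_left_mono INF_lower) auto

lemma weak_limitD:
  assumes "\<And>n. \<mu> n \<in> prob_measures T" and lim: "limitin (weak_topology T) \<mu> \<nu> sequentially"
    and "continuous_map T euclideanreal f" "bounded (f ` topspace T)"
  shows "(\<lambda>n. \<integral>x. f x \<partial>\<mu> n) \<longlonglongrightarrow> (\<integral>x. f x \<partial>\<nu>)"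
proof -
  have "\<nu> \<in> prob_measures T" using lim by (simp add: limitin_def)
  from limitin_weak_topology[of \<mu>, OF assms(1) this] lim assms(3,4) show ?thesis by auto
qed

text \<open>Both the measures and the integrands vary. The regularizations \<open>h m\<close> of the integrands are bounded
  and continuous, so their integrals converge; they lie below \<open>gs n\<close> for \<open>n \<ge> m\<close>, and their supremum
  dominates \<open>g\<close>. The constant sequence \<open>gs n = g\<close> gives lower semicontinuity of the integral of a
  lower semicontinuous function, and indicators give the portmanteau inequality for open sets.\<close>

lemma fatou_weak_convergence:
  fixes gs :: "nat \<Rightarrow> 's \<Rightarrow> ennreal"
  assumes T: "metrizable_space T"
    and \<mu>: "\<And>n. \<mu> n \<in> prob_measures T" and lim: "limitin (weak_topology T) \<mu> \<nu> sequentially"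
    and lsc: "\<And>r s x. filterlim r sequentially sequentially \<Longrightarrow> (\<And>n. s n \<in> topspace T) \<Longrightarrow>
      limitin T s x sequentially \<Longrightarrow> g x \<le> liminf (\<lambda>n. gs (r n) (s n))"
  shows "(\<integral>\<^sup>+x. g x \<partial>\<nu>) \<le> liminf (\<lambda>n. \<integral>\<^sup>+x. gs n x \<partial>\<mu> n)"
proof -
  have \<nu>: "\<nu> \<in> prob_measures T" using lim by (simp add: limitin_def)
  obtain h :: "nat \<Rightarrow> 's \<Rightarrow> real"
    where h: "\<forall>m. continuous_map T euclideanreal (h m)"
      "\<forall>m. \<forall>x\<in>topspace T. 0 \<le> h m x \<and> h m x \<le> real m"
      "\<forall>x\<in>topspace T. \<forall>m m'. m \<le> m' \<longrightarrow> h m x \<le> h m' x"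
      "\<forall>x\<in>topspace T. \<forall>m k. m \<le> k \<longrightarrow> ennreal (h m x) \<le> gs k x"
      "\<forall>x\<in>topspace T. \<forall>l. (\<forall>r s. filterlim r sequentially sequentially \<and>
         (\<forall>n. s n \<in> topspace T) \<and> limitin T s x sequentially \<longrightarrow>
         l \<le> liminf (\<lambda>n. gs (r n) (s n))) \<longrightarrow> l \<le> (SUP m. ennreal (h m x))"
    using yosida_regularization[OF T, of gs] by (elim exE conjE) (rule that; assumption)
  have meas: "h m \<in> borel_measurable (borel_of T)" for m
    using h(1) by (intro continuous_map_borel_of) blast
  have nn: "(\<integral>\<^sup>+x. ennreal (h m x) \<partial>\<rho>) = ennreal (\<integral>x. h m x \<partial>\<rho>)" if \<rho>: "\<rho> \<in> prob_measures T" for m \<rho>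
  proof -
    note P = prob_measuresD[OF \<rho>]
    interpret prob_space \<rho> by fact
    show ?thesis
    proof (rule nn_integral_eq_integral)
      show "integrable \<rho> (h m)"
        using h(2) meas[of m] P
        by (intro integrable_const_bound[where B="real m"]) (auto simp: measurable_cong_sets[OF P(2) refl])
      show "AE x in \<rho>. 0 \<le> h m x" using h(2) P by (intro AE_I2) auto
    qed
  qed
  have "(\<integral>\<^sup>+x. g x \<partial>\<nu>) \<le> (\<integral>\<^sup>+x. (SUP m. ennreal (h m x)) \<partial>\<nu>)"
  proof (rule nn_integral_mono)
    fix x assume "x \<in> space \<nu>"
    then show "g x \<le> (SUP m. ennreal (h m x))"
      using prob_measuresD(3)[OF \<nu>] lsc h(5) by blast
  qed
  also have "\<dots> = (SUP m. \<integral>\<^sup>+x. ennreal (h m x) \<partial>\<nu>)"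
  proof (rule nn_integral_monotone_convergence_SUP_AE)
    show "AE x in \<nu>. ennreal (h i x) \<le> ennreal (h (Suc i) x)" for i
      using h(3) prob_measuresD(3)[OF \<nu>] by (intro AE_I2 ennreal_leI) auto
    show "(\<lambda>x. ennreal (h i x)) \<in> borel_measurable \<nu>" for i
      using meas[of i] by (auto simp: measurable_cong_sets[OF prob_measuresD(2)[OF \<nu>] refl])
  qed
  also have "\<dots> \<le> liminf (\<lambda>n. \<integral>\<^sup>+x. gs n x \<partial>\<mu> n)"
  proof (rule SUP_least)
    fix m
    have bd: "bounded (h m ` topspace T)"
      using h(2) by (intro boundedI[where B="real m"]) auto
    have "(\<lambda>n. \<integral>x. h m x \<partial>\<mu> n) \<longlonglongrightarrow> (\<integral>x. h m x \<partial>\<nu>)"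
      using \<mu> lim h(1) bd by (intro weak_limitD) auto
    then have "(\<lambda>n. \<integral>\<^sup>+x. ennreal (h m x) \<partial>\<mu> n) \<longlonglongrightarrow> (\<integral>\<^sup>+x. ennreal (h m x) \<partial>\<nu>)"
      unfolding nn[OF \<mu>] nn[OF \<nu>] by (rule tendsto_ennrealI)
    then have "(\<integral>\<^sup>+x. ennreal (h m x) \<partial>\<nu>) = liminf (\<lambda>n. \<integral>\<^sup>+x. ennreal (h m x) \<partial>\<mu> n)"
      using lim_imp_Liminf[OF sequentially_bot] by metis
    also have "\<dots> \<le> liminf (\<lambda>n. \<integral>\<^sup>+x. gs n x \<partial>\<mu> n)"
    proof (rule Liminf_mono)
      show "\<forall>\<^sub>F n in sequentially. (\<integral>\<^sup>+x. ennreal (h m x) \<partial>\<mu> n) \<le> (\<integral>\<^sup>+x. gs n x \<partial>\<mu> n)"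
        using eventually_ge_at_top[of m]
      proof eventually_elim
        case (elim n)
        show ?case using h(4) elim prob_measuresD(3)[OF \<mu>[of n]] by (intro nn_integral_mono) auto
      qed
    qed
    finally show "(\<integral>\<^sup>+x. ennreal (h m x) \<partial>\<nu>) \<le> liminf (\<lambda>n. \<integral>\<^sup>+x. gs n x \<partial>\<mu> n)" .
  qed
  finally show ?thesis .
qed

section \<open>The weak topology is metrizable\<close>

definition approximates_indicator :: "'s topology \<Rightarrow> 's set \<Rightarrow> (nat \<Rightarrow> 's \<Rightarrow> real) \<Rightarrow> bool" where
  "approximates_indicator T U h \<longleftrightarrow>
     (\<forall>m. continuous_map T euclideanreal (h m)) \<and>
     (\<forall>m. \<forall>x\<in>topspace T. 0 \<le> h m x \<and> h m x \<le> indicator U x) \<and>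
     (\<forall>m m'. \<forall>x\<in>topspace T. m \<le> m' \<longrightarrow> h m x \<le> h m' x) \<and>
     (\<forall>x\<in>topspace T. (\<lambda>m. h m x) \<longlonglongrightarrow> indicator U x)"

lemma approximates_indicatorD:
  assumes h: "approximates_indicator T U h"
  shows "continuous_map T euclideanreal (h m)"
    and "x \<in> topspace T \<Longrightarrow> 0 \<le> h m x \<and> h m x \<le> indicator U x"
    and "x \<in> topspace T \<Longrightarrow> m \<le> m' \<Longrightarrow> h m x \<le> h m' x"
    and "x \<in> topspace T \<Longrightarrow> (\<lambda>m. h m x) \<longlonglongrightarrow> indicator U x"
    and "bounded (h m ` topspace T)"
proof -
  show le: "x \<in> topspace T \<Longrightarrow> 0 \<le> h m x \<and> h m x \<le> indicator U x" for m x
    using h unfolding approximates_indicator_def by blast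
  show "continuous_map T euclideanreal (h m)" "x \<in> topspace T \<Longrightarrow> m \<le> m' \<Longrightarrow> h m x \<le> h m' x"
    "x \<in> topspace T \<Longrightarrow> (\<lambda>m. h m x) \<longlonglongrightarrow> indicator U x"
    using h unfolding approximates_indicator_def by blast+
  have "norm (h m x) \<le> 1" if "x \<in> topspace T" for x
    using le[OF that, of m] indicator_le_1[of U x, where ?'a=real] by (simp only: real_norm_def) linarith
  then show "bounded (h m ` topspace T)" by (intro boundedI[where B=1]) auto
qed

lemma open_indicator_approximation:
  fixes T :: "'s topology"
  assumes T: "metrizable_space T" and U: "openin T U"
  shows "\<exists>h. approximates_indicator T U h"
proof -
  obtain h :: "nat \<Rightarrow> 's \<Rightarrow> real"
    where h: "\<forall>m. continuous_map T euclideanreal (h m)"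
      "\<forall>m. \<forall>x\<in>topspace T. 0 \<le> h m x \<and> h m x \<le> real m"
      "\<forall>x\<in>topspace T. \<forall>m m'. m \<le> m' \<longrightarrow> h m x \<le> h m' x"
      "\<forall>x\<in>topspace T. \<forall>m k. m \<le> k \<longrightarrow> ennreal (h m x) \<le> indicator U x"
      "\<forall>x\<in>topspace T. \<forall>l. (\<forall>(r::nat \<Rightarrow> nat) s. filterlim r sequentially sequentially \<and>
         (\<forall>n. s n \<in> topspace T) \<and> limitin T s x sequentially \<longrightarrow>
         l \<le> liminf (\<lambda>n. indicator U (s n))) \<longrightarrow> l \<le> (SUP m. ennreal (h m x))"
    using yosida_regularization[OF T, of "\<lambda>_. indicator U"] by (elim exE conjE) (rule that; assumption)
  have le: "h m x \<le> indicator U x" if "x \<in> topspace T" for m x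
    using h(4)[rule_format, OF that order_refl, of m] h(2)[rule_format, OF that, of m]
    by (auto simp: indicator_def split: if_splits)
  show ?thesis
    unfolding approximates_indicator_def
  proof (intro exI[of _ h] conjI allI ballI impI)
    show "continuous_map T euclideanreal (h m)" for m using h(1) by blast
    show "h m x \<le> h m' x" if "x \<in> topspace T" "m \<le> m'" for m m' x using h(3) that by blast
    show "0 \<le> h m x" "h m x \<le> indicator U x" if "x \<in> topspace T" for m x
      using h(2) le that by blast+
    show "(\<lambda>m. h m x) \<longlonglongrightarrow> indicator U x" if x: "x \<in> topspace T" for x
    proof -
      have "(SUP m. ennreal (h m x)) = indicator U x"
      proof (rule antisym)
        show "(SUP m. ennreal (h m x)) \<le> indicator U x" using h(4)[rule_format, OF x] by (intro SUP_least) blast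
        show "indicator U x \<le> (SUP m. ennreal (h m x))"
        proof (rule h(5)[rule_format, OF x])
          fix r :: "nat \<Rightarrow> nat" and s :: "nat \<Rightarrow> 's"
          assume "filterlim r sequentially sequentially \<and> (\<forall>n. s n \<in> topspace T) \<and> limitin T s x sequentially"
          then show "indicator U x \<le> liminf (\<lambda>n. indicator U (s n) :: ennreal)"
            using seq_lsc_open_indicator[OF U] unfolding seq_lsc_def by blast
        qed
      qed
      moreover have "(\<lambda>m. ennreal (h m x)) \<longlonglongrightarrow> (SUP m. ennreal (h m x))"
        using h(3)[rule_format, OF x] by (intro LIMSEQ_SUP monoI ennreal_leI) auto
      ultimately have "(\<lambda>m. ennreal (h m x)) \<longlonglongrightarrow> ennreal (indicator U x)"
        by (simp add: ennreal_indicator)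
      then show ?thesis
        using h(2)[rule_format, OF x] by (subst (asm) tendsto_ennreal_iff) auto
    qed
  qed
qed

text \<open>Multiples \<open>q * h\<^sub>V\<^sub>,\<^sub>m\<close>, with \<open>q\<close> rational and \<open>h\<^sub>V\<^sub>,\<^sub>m\<close> increasing to the indicator of a member
  \<open>V\<close> of a countable base, approximate every nonnegative continuous function from below at every point.
  Closing this countable family under finite maxima makes the approximation increasing, hence compatible
  with integration.\<close>

lemma countable_lower_approximation:
  assumes T: "metrizable_space T" and sc: "second_countable T"
  obtains F :: "nat \<Rightarrow> 's \<Rightarrow> real" where
    "\<And>i. continuous_map T euclideanreal (F i)"
    "\<And>i. \<exists>B. \<forall>x\<in>topspace T. 0 \<le> F i x \<and> F i x \<le> B"
    "\<And>f. continuous_map T euclideanreal f \<Longrightarrow> (\<And>x. x \<in> topspace T \<Longrightarrow> 0 \<le> f x) \<Longrightarrow>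
      \<exists>i::nat \<Rightarrow> nat. \<forall>x\<in>topspace T. (\<forall>n. F (i n) x \<le> f x) \<and> (\<lambda>n. F (i n) x) \<longlonglongrightarrow> f x"
proof -
  obtain \<B> where \<B>': "countable \<B> \<and> (\<forall>V \<in> \<B>. openin T V) \<and>
      (\<forall>U x. openin T U \<and> x \<in> U \<longrightarrow> (\<exists>V \<in> \<B>. x \<in> V \<and> V \<subseteq> U))"
    using sc unfolding second_countable_def by auto
  have \<B>: "countable \<B>" "\<And>V. V \<in> \<B> \<Longrightarrow> openin T V"
    "\<And>U x. openin T U \<Longrightarrow> x \<in> U \<Longrightarrow> \<exists>V\<in>\<B>. x \<in> V \<and> V \<subseteq> U"
    using \<B>' by simp_all
  have "\<forall>V. \<exists>h. V \<in> \<B> \<longrightarrow> approximates_indicator T V h"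
    using open_indicator_approximation[OF T \<B>(2)] by blast
  then obtain h :: "'s set \<Rightarrow> nat \<Rightarrow> 's \<Rightarrow> real" where h: "\<And>V. V \<in> \<B> \<Longrightarrow> approximates_indicator T V (h V)"
    by metis
  note h1 = approximates_indicatorD(1)[OF h] and h2 = approximates_indicatorD(2)[OF h]
    and h3 = approximates_indicatorD(4)[OF h]
  define I :: "('s set \<times> nat \<times> rat) set" where "I = \<B> \<times> UNIV \<times> {0..}"
  have I: "countable I" unfolding I_def using \<B>(1) by auto
  define b where "b = (\<lambda>(V, m, q) x. real_of_rat q * h V m x)"
  have b0: "0 \<le> b p x" if "p \<in> I" "x \<in> topspace T" for p x
    using that h2 by (auto simp: b_def I_def split: prod.splits)
  have bc: "continuous_map T euclideanreal (b p)" if "p \<in> I" for p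
    using that h1 by (auto simp: b_def I_def split_beta intro!: continuous_map_real_mult_left)
  have bB: "b p x \<le> real_of_rat (snd (snd p))" if "p \<in> I" "x \<in> topspace T" for p x
  proof -
    obtain V m q where p: "p = (V, m, q)" by (cases p)
    have "h V m x \<le> 1"
      using h2[of V x m] that p by (auto simp: I_def intro: order_trans[OF _ indicator_le_1])
    then show ?thesis using that p by (auto simp: b_def I_def intro: mult_left_le)
  qed
  \<comment> \<open>the maximum over a list of indices; the empty list gives \<open>0\<close>\<close>
  define G where "G ps x = foldr (\<lambda>p. max (b p x)) ps 0" for ps x
  have G0: "0 \<le> G ps x" for ps x unfolding G_def by (induction ps) auto
  have Gge: "b p x \<le> G ps x" if "p \<in> set ps" for p ps x
    using that unfolding G_def by (induction ps) (auto simp: le_max_iff_disj)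
  have Gle: "G ps x \<le> c" if "\<And>p. p \<in> set ps \<Longrightarrow> b p x \<le> c" "0 \<le> c" for ps x c
    using that unfolding G_def by (induction ps) auto
  have Gc: "continuous_map T euclideanreal (G ps)" if "set ps \<subseteq> I" for ps
    using that
  proof (induction ps)
    case Nil then show ?case by (simp add: G_def[abs_def])
  next
    case (Cons p ps)
    then show ?case using continuous_map_real_max[OF bc[of p] Cons.IH] by (simp add: G_def[abs_def])
  qed
  define F where "F i = G (from_nat_into (lists I) i)" for i
  have L: "from_nat_into (lists I) i \<in> lists I" for i by (rule from_nat_into) auto
  have Lc: "countable (lists I)" using I by (rule countable_lists)
  show thesis
  proof (rule that[of F])
    show "continuous_map T euclideanreal (F i)" for i
      unfolding F_def using L[of i] by (intro Gc) auto
    show "\<exists>B. \<forall>x\<in>topspace T. 0 \<le> F i x \<and> F i x \<le> B" for i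
    proof -
      let ?ps = "from_nat_into (lists I) i"
      have "G ?ps x \<le> (\<Sum>p\<in>set ?ps. real_of_rat (snd (snd p)))" if "x \<in> topspace T" for x
      proof (rule Gle)
        fix p assume p: "p \<in> set ?ps"
        then have "b p x \<le> real_of_rat (snd (snd p))" using L[of i] that by (intro bB) auto
        also have "\<dots> \<le> (\<Sum>p\<in>set ?ps. real_of_rat (snd (snd p)))"
          using p L[of i] by (intro member_le_sum) (auto simp: I_def)
        finally show "b p x \<le> (\<Sum>p\<in>set ?ps. real_of_rat (snd (snd p)))" .
      qed (use L[of i] in \<open>auto intro!: sum_nonneg simp: I_def\<close>)
      then show ?thesis using G0 by (auto simp: F_def)
    qed
    fix f assume f: "continuous_map T euclideanreal f" "\<And>x. x \<in> topspace T \<Longrightarrow> 0 \<le> f x"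
    \<comment> \<open>finite maxima of these indices increase to \<open>f\<close>\<close>
    define J where "J = {p\<in>I. \<forall>x\<in>topspace T. b p x \<le> f x}"
    have Jc: "countable J" using I unfolding J_def by auto
    define ps where "ps n = (if J = {} then [] else map (from_nat_into J) [0..<n])" for n
    have psJ: "set (ps n) \<subseteq> J" for n using from_nat_into[of J] by (simp add: ps_def image_subset_iff del: split_paired_All)
    have "\<forall>n. \<exists>i. from_nat_into (lists I) i = ps n"
    proof
      fix n
      have "ps n \<in> lists I" using psJ[of n] by (auto simp: J_def)
      then show "\<exists>i. from_nat_into (lists I) i = ps n"
        using from_nat_into_surj[OF Lc] by blast
    qed
    then obtain i where i: "\<And>n. from_nat_into (lists I) (i n) = ps n" by metis
    have Fi: "F (i n) = G (ps n)" for n by (simp add: F_def i)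
    have Fle: "F (i n) x \<le> f x" if "x \<in> topspace T" for n x
      unfolding Fi using psJ[of n] f(2)[OF that] that by (intro Gle) (auto simp: J_def)
    have "(\<lambda>n. F (i n) x) \<longlonglongrightarrow> f x" if x: "x \<in> topspace T" for x
    proof (rule order_tendstoI)
      fix a assume a: "a < f x"
      show "\<forall>\<^sub>F n in sequentially. a < F (i n) x"
      proof (cases "a < 0")
        case True
        then show ?thesis unfolding Fi using G0 by (intro always_eventually) (auto intro: less_le_trans)
      next
        case False
        obtain q where q: "a < real_of_rat q" "real_of_rat q < f x" using of_rat_dense[OF a] by auto
        with False have q0: "0 \<le> q" using zero_le_of_rat_iff[of q, where ?'a=real] by linarith
        have "openin T {y \<in> topspace T. f y \<in> {real_of_rat q<..}}"
          using f(1) by (rule openin_continuous_map_preimage) auto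
        with \<B>(3)[OF this, of x] x q obtain V where V: "V \<in> \<B>" "x \<in> V"
          "\<And>y. y \<in> V \<Longrightarrow> real_of_rat q < f y" by auto
        have "(\<lambda>m. real_of_rat q * h V m x) \<longlonglongrightarrow> real_of_rat q * indicator V x"
          using h3[OF V(1) x] by (intro tendsto_intros)
        then have "\<forall>\<^sub>F m in sequentially. a < real_of_rat q * h V m x"
          using V(2) q by (intro order_tendstoD) auto
        then obtain m where m: "a < b (V, m, q) x" by (auto simp: b_def dest: eventually_happens)
        have "(V, m, q) \<in> J"
        proof -
          have "real_of_rat q * h V m y \<le> f y" if y: "y \<in> topspace T" for y
          proof (cases "y \<in> V")
            case True
            have "real_of_rat q * h V m y \<le> real_of_rat q"
              using h2[OF V(1) y, of m] True q0 by (intro mult_left_le) auto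
            then show ?thesis using V(3)[OF True] by simp
          next
            case False
            then have "h V m y = 0" using h2[OF V(1) y, of m] by auto
            then show ?thesis using f(2)[OF y] by simp
          qed
          then show ?thesis using V(1) q0 by (auto simp: J_def I_def b_def)
        qed
        then obtain k where k: "from_nat_into J k = (V, m, q)" using from_nat_into_surj[OF Jc] by blast
        show ?thesis
          using eventually_gt_at_top[of k]
        proof eventually_elim
          case (elim n)
          then have "(V, m, q) \<in> set (ps n)" using \<open>(V, m, q) \<in> J\<close> k by (auto simp: ps_def intro!: image_eqI[of _ _ k])
          from Gge[OF this, of x] m show ?case unfolding Fi by simp
        qed
      qed
    next
      fix a assume "f x < a"
      then show "\<forall>\<^sub>F n in sequentially. F (i n) x < a"
        using Fle[OF x] by (intro always_eventually) (auto intro: le_less_trans)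
    qed
    with Fle show "\<exists>i::nat \<Rightarrow> nat. \<forall>x\<in>topspace T. (\<forall>n. F (i n) x \<le> f x) \<and> (\<lambda>n. F (i n) x) \<longlonglongrightarrow> f x"
      by blast
  qed
qed

lemma integrable_bounded_continuous:
  assumes \<mu>: "\<mu> \<in> prob_measures T" and f: "continuous_map T euclideanreal f" "bounded (f ` topspace T)"
  shows "integrable \<mu> f"
proof -
  note P = prob_measuresD[OF \<mu>]
  interpret prob_space \<mu> by fact
  obtain B where B: "\<And>x. x \<in> topspace T \<Longrightarrow> norm (f x) \<le> B" using f(2) by (auto simp: bounded_iff)
  show ?thesis
    using B continuous_map_borel_of[OF f(1)] P
    by (intro integrable_const_bound[where B=B]) (auto simp: measurable_cong_sets[OF P(2) refl])
qed

text \<open>One-sided bounds suffice for weak convergence: apply them to \<open>f + B\<close> and to \<open>B - f\<close>, where \<open>B\<close>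
  bounds \<open>f\<close>.\<close>

lemma limitin_weak_topology_liminfI:
  assumes \<mu>: "\<And>n. \<mu> n \<in> prob_measures T" and \<nu>: "\<nu> \<in> prob_measures T"
    and le: "\<And>f. continuous_map T euclideanreal f \<Longrightarrow> (\<And>x. x \<in> topspace T \<Longrightarrow> 0 \<le> f x) \<Longrightarrow>
      (\<integral>\<^sup>+x. ennreal (f x) \<partial>\<nu>) \<le> liminf (\<lambda>n. \<integral>\<^sup>+x. ennreal (f x) \<partial>\<mu> n)"
  shows "limitin (weak_topology T) \<mu> \<nu> sequentially"
  unfolding limitin_weak_topology[of \<mu>, OF \<mu> \<nu>]
proof (intro allI impI)
  fix f assume "continuous_map T euclideanreal f \<and> bounded (f ` topspace T)"
  then have f: "continuous_map T euclideanreal f" "bounded (f ` topspace T)" by auto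
  obtain B where B: "\<And>x. x \<in> topspace T \<Longrightarrow> norm (f x) \<le> B" using f(2) by (auto simp: bounded_iff)
  have lower: "r < (\<integral>x. g x \<partial>\<nu>) \<Longrightarrow> \<forall>\<^sub>F n in sequentially. r < (\<integral>x. g x \<partial>\<mu> n)"
    if g: "continuous_map T euclideanreal g" "bounded (g ` topspace T)"
      and gB: "\<And>x. x \<in> topspace T \<Longrightarrow> - B \<le> g x" for g r
  proof -
    assume r: "r < (\<integral>x. g x \<partial>\<nu>)"
    let ?h = "\<lambda>x. g x + B"
    have h: "continuous_map T euclideanreal ?h" using g(1) by (intro continuous_intros) auto
    have h0: "0 \<le> ?h x" if "x \<in> topspace T" for x using gB[OF that] by simp
    have nn: "(\<integral>\<^sup>+x. ennreal (?h x) \<partial>\<rho>) = ennreal ((\<integral>x. g x \<partial>\<rho>) + B)" "0 \<le> (\<integral>x. g x \<partial>\<rho>) + B"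
      if \<rho>: "\<rho> \<in> prob_measures T" for \<rho>
    proof -
      note P = prob_measuresD[OF \<rho>]
      interpret prob_space \<rho> by fact
      have I: "integrable \<rho> g" using \<rho> g by (rule integrable_bounded_continuous)
      have eq: "(\<integral>x. ?h x \<partial>\<rho>) = (\<integral>x. g x \<partial>\<rho>) + B" using I by (simp add: prob_space)
      show "(\<integral>\<^sup>+x. ennreal (?h x) \<partial>\<rho>) = ennreal ((\<integral>x. g x \<partial>\<rho>) + B)"
        unfolding eq[symmetric] using I h0 P by (intro nn_integral_eq_integral) auto
      show "0 \<le> (\<integral>x. g x \<partial>\<rho>) + B"
        unfolding eq[symmetric] using h0 P by (intro integral_nonneg_AE AE_I2) auto
    qed
    have "ennreal (r + B) < ennreal ((\<integral>x. g x \<partial>\<nu>) + B) \<or> r + B < 0"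
      using r by (cases "r + B < 0") (auto simp: ennreal_less_iff)
    then show ?thesis
    proof
      assume "ennreal (r + B) < ennreal ((\<integral>x. g x \<partial>\<nu>) + B)"
      also have "\<dots> \<le> liminf (\<lambda>n. \<integral>\<^sup>+x. ennreal (?h x) \<partial>\<mu> n)"
        unfolding nn(1)[OF \<nu>, symmetric] using h h0 by (rule le)
      finally have "\<forall>\<^sub>F n in sequentially. ennreal (r + B) < (\<integral>\<^sup>+x. ennreal (?h x) \<partial>\<mu> n)"
        by (rule less_LiminfD)
      then show ?thesis
        unfolding nn(1)[OF \<mu>]
      proof eventually_elim
        case (elim n)
        show ?case
        proof (rule ccontr)
          assume "\<not> ?case"
          then have "ennreal ((\<integral>x. g x \<partial>\<mu> n) + B) \<le> ennreal (r + B)" by (intro ennreal_leI) simp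
          with elim show False by simp
        qed
      qed
    next
      assume "r + B < 0"
      then show ?thesis using nn(2)[OF \<mu>] by (intro always_eventually allI) (smt (verit))
    qed
  qed
  show "(\<lambda>n. \<integral>x. f x \<partial>\<mu> n) \<longlonglongrightarrow> (\<integral>x. f x \<partial>\<nu>)"
  proof (rule order_tendstoI)
    fix r assume "r < (\<integral>x. f x \<partial>\<nu>)"
    moreover have "- B \<le> f x" if "x \<in> topspace T" for x using B[OF that] by (auto simp: abs_le_iff)
    ultimately show "\<forall>\<^sub>F n in sequentially. r < (\<integral>x. f x \<partial>\<mu> n)"
      using f by (intro lower)
  next
    fix r assume r: "(\<integral>x. f x \<partial>\<nu>) < r"
    have "\<forall>\<^sub>F n in sequentially. - r < (\<integral>x. - f x \<partial>\<mu> n)"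
    proof (rule lower)
      show "continuous_map T euclideanreal (\<lambda>x. - f x)" using f(1) by (intro continuous_intros)
      show "bounded ((\<lambda>x. - f x) ` topspace T)" using f(2) by (auto simp: bounded_iff)
    qed (use B r in \<open>auto simp: abs_le_iff\<close>)
    then show "\<forall>\<^sub>F n in sequentially. (\<integral>x. f x \<partial>\<mu> n) < r" by simp
  qed
qed

lemma emeasure_open_eq_SUP:
  fixes h :: "nat \<Rightarrow> 's \<Rightarrow> real"
  assumes \<mu>: "\<mu> \<in> prob_measures T" and U: "openin T U"
    and h': "approximates_indicator T U h"
  shows "emeasure \<mu> U = (SUP m. ennreal (\<integral>x. h m x \<partial>\<mu>))"
proof -
  note P = prob_measuresD[OF \<mu>]
  note h = approximates_indicatorD[OF h']
  have U': "U \<in> sets \<mu>" using U P openin_in_borel_of by auto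
  have "emeasure \<mu> U = (\<integral>\<^sup>+x. indicator U x \<partial>\<mu>)" using U' by simp
  also have "\<dots> = (\<integral>\<^sup>+x. (SUP m. ennreal (h m x)) \<partial>\<mu>)"
  proof (rule nn_integral_cong)
    fix x assume "x \<in> space \<mu>"
    then have x: "x \<in> topspace T" using P by simp
    have "(\<lambda>m. ennreal (h m x)) \<longlonglongrightarrow> (SUP m. ennreal (h m x))"
      using h(3)[OF x] by (intro LIMSEQ_SUP monoI ennreal_leI) auto
    moreover have "(\<lambda>m. ennreal (h m x)) \<longlonglongrightarrow> ennreal (indicator U x)"
      using h(4)[OF x] by (rule tendsto_ennrealI)
    ultimately show "indicator U x = (SUP m. ennreal (h m x))"
      using LIMSEQ_unique by (metis ennreal_indicator)
  qed
  also have "\<dots> = (SUP m. \<integral>\<^sup>+x. ennreal (h m x) \<partial>\<mu>)"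
  proof (rule nn_integral_monotone_convergence_SUP_AE)
    show "AE x in \<mu>. ennreal (h i x) \<le> ennreal (h (Suc i) x)" for i
      using h(3) P(3) by (intro AE_I2 ennreal_leI) auto
    show "(\<lambda>x. ennreal (h i x)) \<in> borel_measurable \<mu>" for i
      using continuous_map_borel_of[OF h(1)] by (auto simp: measurable_cong_sets[OF P(2) refl])
  qed
  also have "\<dots> = (SUP m. ennreal (\<integral>x. h m x \<partial>\<mu>))"
  proof (intro SUP_cong refl nn_integral_eq_integral)
    show "integrable \<mu> (h m)" for m
      using \<mu> h(1,5) by (rule integrable_bounded_continuous)
    show "AE x in \<mu>. 0 \<le> h m x" for m using h(2) P by (intro AE_I2) auto
  qed
  finally show ?thesis .
qed

lemma continuous_map_integral:
  assumes f: "continuous_map T euclideanreal f" "bounded (f ` topspace T)"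
  shows "continuous_map (weak_topology T) euclideanreal (\<lambda>\<mu>. \<integral>x. f x \<partial>\<mu>)"
  unfolding continuous_map_def
proof (intro conjI allI impI)
  fix U :: "real set" assume "openin euclidean U"
  then show "openin (weak_topology T) {\<mu> \<in> topspace (weak_topology T). (\<integral>x. f x \<partial>\<mu>) \<in> U}"
    unfolding weak_topology_def topspace_weak_topology[unfolded weak_topology_def]
    using f by (intro topology_generated_by_Basis) auto
qed auto

lemma prob_measures_eqI:
  fixes T :: "'s topology"
  assumes T: "metrizable_space T" and \<mu>: "\<mu> \<in> prob_measures T" and \<nu>: "\<nu> \<in> prob_measures T"
    and eq: "\<And>f. continuous_map T euclideanreal f \<Longrightarrow> bounded (f ` topspace T) \<Longrightarrow>
       (\<And>x. x \<in> topspace T \<Longrightarrow> 0 \<le> f x) \<Longrightarrow> (\<integral>x. f x \<partial>\<mu>) = (\<integral>x. f x \<partial>\<nu>)"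
  shows "\<mu> = \<nu>"
proof (rule measure_eqI_generator_eq[where E="{U. openin T U}" and \<Omega>="topspace T" and A="\<lambda>_. topspace T"])
  show "Int_stable {U. openin T U}" by (auto simp: Int_stable_def)
  show "{U. openin T U} \<subseteq> Pow (topspace T)" by (auto dest: openin_subset)
  show "sets \<mu> = sigma_sets (topspace T) {U. openin T U}" "sets \<nu> = sigma_sets (topspace T) {U. openin T U}"
    using prob_measuresD(2)[OF \<mu>] prob_measuresD(2)[OF \<nu>] by (simp_all add: sets_borel_of)
  show "emeasure \<mu> (topspace T) \<noteq> \<infinity>"
    using prob_space.emeasure_space_1[OF prob_measuresD(1)[OF \<mu>]] prob_measuresD(3)[OF \<mu>] by simp
  fix U assume "U \<in> {U. openin T U}"
  then have U: "openin T U" by simp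
  obtain h where h': "approximates_indicator T U h" using open_indicator_approximation[OF T U] by blast
  note h = approximates_indicatorD[OF h']
  have "(\<integral>x. h m x \<partial>\<mu>) = (\<integral>x. h m x \<partial>\<nu>)" for m
    using h(1,2,5) by (intro eq) auto
  then show "emeasure \<mu> U = emeasure \<nu> U"
    using emeasure_open_eq_SUP[OF \<mu> U h'] emeasure_open_eq_SUP[OF \<nu> U h'] by simp
qed auto

text \<open>The integrals of the functions of the countable approximating family embed the
  probability measures into \<open>\<real>\<^sup>\<nat>\<close>. Convergence of these countably many integrals controls all others:
  \<open>\<integral>f\<close> exceeds \<open>r\<close> exactly if the integral of one of the approximants of \<open>f\<close> does, so integration of
  \<open>f\<close> is lower semicontinuous in the topology pulled back from \<open>\<real>\<^sup>\<nat>\<close>, and applying this to \<open>- f\<close> it is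
  continuous.\<close>

lemma weak_topology_embedding:
  fixes T :: "'s topology"
  assumes T: "metrizable_space T" and sc: "second_countable T"
  obtains \<Phi> :: "'s measure \<Rightarrow> nat \<Rightarrow> real" where
    "homeomorphic_map (weak_topology T) (top_of_set (\<Phi> ` prob_measures T)) \<Phi>"
    "\<Phi> \<in> borel_measurable (prob_algebra (borel_of T))"
    "\<And>W. openin (weak_topology T) W \<Longrightarrow> \<exists>V. open V \<and> W = \<Phi> -` V \<inter> prob_measures T"
proof -
  let ?P = "prob_measures T"
  from countable_lower_approximation[OF T sc] obtain F :: "nat \<Rightarrow> 's \<Rightarrow> real" where
    F1: "\<And>i. continuous_map T euclideanreal (F i)" and
    F2: "\<And>i. \<exists>B. \<forall>x\<in>topspace T. 0 \<le> F i x \<and> F i x \<le> B" and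
    F3: "\<And>f. continuous_map T euclideanreal f \<Longrightarrow> (\<And>x. x \<in> topspace T \<Longrightarrow> 0 \<le> f x) \<Longrightarrow>
      \<exists>i::nat \<Rightarrow> nat. \<forall>x\<in>topspace T. (\<forall>n. F (i n) x \<le> f x) \<and> (\<lambda>n. F (i n) x) \<longlonglongrightarrow> f x"
    by blast
  have F0: "0 \<le> F i x" if "x \<in> topspace T" for i x using F2[of i] that by auto
  have bF: "bounded (F i ` topspace T)" for i
  proof -
    obtain B where "\<forall>x\<in>topspace T. 0 \<le> F i x \<and> F i x \<le> B" using F2 by blast
    then show ?thesis by (intro boundedI[where B=B]) auto
  qed
  define \<Phi> where "\<Phi> \<mu> i = (\<integral>x. F i x \<partial>\<mu>)" for \<mu> :: "'s measure" and i
  have conv: "(\<lambda>n. \<Phi> \<mu> (i n)) \<longlonglongrightarrow> (\<integral>x. f x \<partial>\<mu>)" "\<Phi> \<mu> (i n) \<le> (\<integral>x. f x \<partial>\<mu>)"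
    if f: "continuous_map T euclideanreal f" "bounded (f ` topspace T)"
      and i: "\<forall>x\<in>topspace T. (\<forall>n. F (i n) x \<le> f x) \<and> (\<lambda>n. F (i n) x) \<longlonglongrightarrow> f x"
      and \<mu>: "\<mu> \<in> ?P" for f \<mu> n and i :: "nat \<Rightarrow> nat"
  proof -
    note P = prob_measuresD[OF \<mu>]
    have If: "integrable \<mu> f" using \<mu> f by (rule integrable_bounded_continuous)
    have IF: "integrable \<mu> (F j)" for j using \<mu> F1 bF by (rule integrable_bounded_continuous)
    show "\<Phi> \<mu> (i n) \<le> (\<integral>x. f x \<partial>\<mu>)"
      unfolding \<Phi>_def using i P IF If by (intro integral_mono) auto
    show "(\<lambda>n. \<Phi> \<mu> (i n)) \<longlonglongrightarrow> (\<integral>x. f x \<partial>\<mu>)"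
      unfolding \<Phi>_def
    proof (rule integral_dominated_convergence[where w=f])
      show "AE x in \<mu>. (\<lambda>n. F (i n) x) \<longlonglongrightarrow> f x" using i P by (intro AE_I2) auto
      show "AE x in \<mu>. norm (F (i n) x) \<le> f x" for n using i P F0 by (intro AE_I2) auto
    qed (use If IF in auto)
  qed
  let ?T' = "pullback_topology ?P \<Phi> (euclidean :: (nat \<Rightarrow> real) topology)"
  have top': "topspace ?T' = ?P" by (simp add: topspace_pullback_topology)
  have lower: "openin ?T' {\<mu> \<in> ?P. r < (\<integral>x. f x \<partial>\<mu>)}"
    if f: "continuous_map T euclideanreal f" "bounded (f ` topspace T)" for f r
  proof -
    obtain B where B: "\<And>x. x \<in> topspace T \<Longrightarrow> norm (f x) \<le> B" using f(2) by (auto simp: bounded_iff)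
    \<comment> \<open>the approximating family is nonnegative, so \<open>f\<close> is shifted first\<close>
    let ?g = "\<lambda>x. f x + B"
    have g: "continuous_map T euclideanreal ?g" using f(1) by (intro continuous_intros) auto
    have g0: "0 \<le> ?g x" if "x \<in> topspace T" for x using B[OF that] by auto
    have gb: "bounded (?g ` topspace T)"
      using B by (intro boundedI[where B="B + B"]) (force simp: abs_le_iff)
    obtain i :: "nat \<Rightarrow> nat" where
      i: "\<forall>x\<in>topspace T. (\<forall>n. F (i n) x \<le> ?g x) \<and> (\<lambda>n. F (i n) x) \<longlonglongrightarrow> ?g x"
      using F3[OF g g0] by blast
    have "r < (\<integral>x. f x \<partial>\<mu>) \<longleftrightarrow> (\<exists>n. r + B < \<Phi> \<mu> (i n))" if \<mu>: "\<mu> \<in> ?P" for \<mu>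
    proof -
      note c = conv[OF g gb i \<mu>]
      interpret prob_space \<mu> using prob_measuresD[OF \<mu>] by simp
      have "(\<integral>x. ?g x \<partial>\<mu>) = (\<integral>x. f x \<partial>\<mu>) + B"
        using integrable_bounded_continuous[OF \<mu> f] by (simp add: prob_space)
      moreover have "r + B < (\<integral>x. ?g x \<partial>\<mu>) \<Longrightarrow> \<exists>n. r + B < \<Phi> \<mu> (i n)"
        using eventually_happens[OF order_tendstoD(1)[OF c(1)]] by auto
      moreover have "r + B < \<Phi> \<mu> (i n) \<Longrightarrow> r + B < (\<integral>x. ?g x \<partial>\<mu>)" for n
        using c(2)[of n] by linarith
      ultimately show ?thesis by auto
    qed
    then have "{\<mu> \<in> ?P. r < (\<integral>x. f x \<partial>\<mu>)} = \<Phi> -` (\<Union>n. {y. r + B < y (i n)}) \<inter> ?P"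
      by auto
    moreover have "open (\<Union>n. {y :: nat \<Rightarrow> real. r + B < y (i n)})"
      by (intro open_UN ballI open_Collect_less continuous_intros) auto
    ultimately show ?thesis unfolding openin_pullback_topology by (intro exI[of _ "\<Union>n. {y. r + B < y (i n)}"]) (simp only: open_openin)
  qed
  have cont': "continuous_map ?T' euclideanreal (\<lambda>\<mu>. \<integral>x. f x \<partial>\<mu>)"
    if f: "continuous_map T euclideanreal f" "bounded (f ` topspace T)" for f
    unfolding continuous_map_upper_lower_semicontinuous_lt top'
  proof (intro conjI allI)
    show "openin ?T' {\<mu> \<in> ?P. r < (\<integral>x. f x \<partial>\<mu>)}" for r using lower[OF f] .
    have "openin ?T' {\<mu> \<in> ?P. - r < (\<integral>x. - f x \<partial>\<mu>)}" for r
      using f by (intro lower continuous_intros) (auto simp: bounded_iff)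
    then show "openin ?T' {\<mu> \<in> ?P. (\<integral>x. f x \<partial>\<mu>) < r}" for r by simp
  qed
  have pull: "openin ?T' W" if W: "openin (weak_topology T) W" for W
  proof -
    have "generate_topology_on {{\<mu> \<in> ?P. (\<integral>x. f x \<partial>\<mu>) \<in> U} | f U.
        continuous_map T euclideanreal f \<and> bounded (f ` topspace T) \<and> open U} W"
      using W by (simp add: weak_topology_def openin_topology_generated_by_iff)
    then show ?thesis
    proof induction
      case (Basis s)
      then obtain f U where "s = {\<mu> \<in> ?P. (\<integral>x. f x \<partial>\<mu>) \<in> U}"
        and f: "continuous_map T euclideanreal f" "bounded (f ` topspace T)" and U: "open U"
        by blast
      with openin_continuous_map_preimage[OF cont'[OF f], of U] show ?case by (simp add: top')
    qed (auto intro: openin_Union)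
  qed
  have ex: "\<exists>V. open V \<and> W = \<Phi> -` V \<inter> ?P" if "openin (weak_topology T) W" for W
    using pull[OF that] by (auto simp: openin_pullback_topology)
  have inj: "inj_on \<Phi> ?P"
  proof (rule inj_onI)
    fix \<mu> \<nu> assume \<mu>: "\<mu> \<in> ?P" and \<nu>: "\<nu> \<in> ?P" and eq: "\<Phi> \<mu> = \<Phi> \<nu>"
    show "\<mu> = \<nu>"
    proof (rule prob_measures_eqI[OF T \<mu> \<nu>])
      fix f assume f: "continuous_map T euclideanreal f" "bounded (f ` topspace T)"
        "\<And>x. x \<in> topspace T \<Longrightarrow> 0 \<le> f x"
      obtain i :: "nat \<Rightarrow> nat" where
        i: "\<forall>x\<in>topspace T. (\<forall>n. F (i n) x \<le> f x) \<and> (\<lambda>n. F (i n) x) \<longlonglongrightarrow> f x"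
        using F3[OF f(1,3)] by blast
      show "(\<integral>x. f x \<partial>\<mu>) = (\<integral>x. f x \<partial>\<nu>)"
        using conv(1)[OF f(1,2) i \<mu>] conv(1)[OF f(1,2) i \<nu>] eq LIMSEQ_unique by metis
    qed
  qed
  have cont: "continuous_map (weak_topology T) euclidean \<Phi>"
    unfolding euclidean_product_topology[symmetric] continuous_map_componentwise_UNIV
    unfolding \<Phi>_def using F1 bF by (intro allI continuous_map_integral)
  show thesis
  proof (rule that[of \<Phi>])
    show "homeomorphic_map (weak_topology T) (top_of_set (\<Phi> ` ?P)) \<Phi>"
    proof (rule bijective_open_imp_homeomorphic_map)
      show "continuous_map (weak_topology T) (top_of_set (\<Phi> ` ?P)) \<Phi>"
        using cont by (auto simp: continuous_map_in_subtopology)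
      show "open_map (weak_topology T) (top_of_set (\<Phi> ` ?P)) \<Phi>"
        unfolding open_map_def
      proof (intro allI impI)
        fix W assume "openin (weak_topology T) W"
        then obtain V where V: "open V" "W = \<Phi> -` V \<inter> ?P" using ex by blast
        then have "\<Phi> ` W = \<Phi> ` ?P \<inter> V" by auto
        then show "openin (top_of_set (\<Phi> ` ?P)) (\<Phi> ` W)" using V(1) by (auto simp: openin_open)
      qed
    qed (use inj in auto)
    show "\<Phi> \<in> borel_measurable (prob_algebra (borel_of T))"
    proof (rule measurable_coordinatewise_then_product)
      fix i
      have "(\<lambda>\<mu>. \<integral>x. F i x \<partial>\<mu>) \<in> borel_measurable (subprob_algebra (borel_of T))"
        using continuous_map_borel_of[OF F1] by (rule integral_measurable_subprob_algebra)
      then show "(\<lambda>\<mu>. \<Phi> \<mu> i) \<in> borel_measurable (prob_algebra (borel_of T))"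
        unfolding \<Phi>_def prob_algebra_def by (rule measurable_restrict_space1)
    qed
    show "\<exists>V. open V \<and> W = \<Phi> -` V \<inter> ?P" if "openin (weak_topology T) W" for W
      using ex that .
  qed
qed

lemma metrizable_weak_topology:
  fixes T :: "'s topology"
  assumes T: "metrizable_space T" and sc: "second_countable T"
  shows "metrizable_space (weak_topology T)"
proof -
  obtain \<Phi> :: "'s measure \<Rightarrow> nat \<Rightarrow> real" where
    "homeomorphic_map (weak_topology T) (top_of_set (\<Phi> ` prob_measures T)) \<Phi>"
    using weak_topology_embedding[OF assms] by metis
  then have "weak_topology T homeomorphic_space (top_of_set (\<Phi> ` prob_measures T))"
    by (rule homeomorphic_map_imp_homeomorphic_space)
  then show ?thesis
    using homeomorphic_metrizable_space metrizable_space_subtopology metrizable_space_euclidean by blast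
qed

text \<open>This makes measurability of kernels, which refers to evaluations \<open>\<mu> \<mapsto> \<mu> B\<close>, the same as Borel
  measurability for the weak topology. In one direction open sets are preimages of open sets under the
  measurable embedding into \<open>\<real>\<^sup>\<nat>\<close>; in the other, \<open>\<mu> U\<close> is a supremum of continuous functions of \<open>\<mu>\<close> for
  open \<open>U\<close>.\<close>

lemma sets_borel_of_weak_topology:
  fixes T :: "'s topology"
  assumes T: "metrizable_space T" and sc: "second_countable T"
  shows "sets (borel_of (weak_topology T)) = sets (prob_algebra (borel_of T))"
proof
  obtain \<Phi> :: "'s measure \<Rightarrow> nat \<Rightarrow> real" where
    \<Phi>: "\<Phi> \<in> borel_measurable (prob_algebra (borel_of T))"
    "\<And>W. openin (weak_topology T) W \<Longrightarrow> \<exists>V. open V \<and> W = \<Phi> -` V \<inter> prob_measures T"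
    using weak_topology_embedding[OF assms] by metis
  have "{W. openin (weak_topology T) W} \<subseteq> sets (prob_algebra (borel_of T))"
  proof
    fix W assume "W \<in> {W. openin (weak_topology T) W}"
    then obtain V where "open V" "W = \<Phi> -` V \<inter> prob_measures T" using \<Phi>(2) by blast
    then show "W \<in> sets (prob_algebra (borel_of T))"
      using measurable_sets[OF \<Phi>(1), of V] by simp
  qed
  then show "sets (borel_of (weak_topology T)) \<subseteq> sets (prob_algebra (borel_of T))"
    unfolding sets_borel_of topspace_weak_topology by (rule sets.sigma_sets_subset)
next
  have id: "(\<lambda>\<mu>. \<mu>) \<in> borel_of (weak_topology T) \<rightarrow>\<^sub>M prob_algebra (borel_of T)"
  proof (rule measurable_prob_algebra_generated[OF sets_borel_of])
    show "Int_stable {U. openin T U}" by (auto simp: Int_stable_def)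
    show "{U. openin T U} \<subseteq> Pow (topspace T)" by (auto dest: openin_subset)
    show "prob_space \<mu>" "sets \<mu> = sets (borel_of T)" if "\<mu> \<in> space (borel_of (weak_topology T))" for \<mu>
      using that prob_measuresD[of \<mu> T] by simp_all
    fix U assume "U \<in> {U. openin T U}"
    then have U: "openin T U" by simp
    obtain h where h': "approximates_indicator T U h" using open_indicator_approximation[OF T U] by blast
  note h = approximates_indicatorD[OF h']
    have [measurable]: "(\<lambda>\<mu>. \<integral>x. h m x \<partial>\<mu>) \<in> borel_measurable (borel_of (weak_topology T))" for m
      using h(1,5) by (intro continuous_map_borel_of continuous_map_integral)
    have "(\<lambda>\<mu>. SUP m. ennreal (\<integral>x. h m x \<partial>\<mu>)) \<in> borel_measurable (borel_of (weak_topology T))"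
      by measurable
    then show "(\<lambda>\<mu>. emeasure \<mu> U) \<in> borel_measurable (borel_of (weak_topology T))"
      by (rule measurable_cong[THEN iffD2, rotated]) (use emeasure_open_eq_SUP[OF _ U h'] in auto)
  qed
  show "sets (prob_algebra (borel_of T)) \<subseteq> sets (borel_of (weak_topology T))"
  proof
    fix B assume B: "B \<in> sets (prob_algebra (borel_of T))"
    then have "B \<subseteq> prob_measures T" using sets.sets_into_space by blast
    then show "B \<in> sets (borel_of (weak_topology T))"
      using measurable_sets[OF id B] by (simp add: Int_absorb2)
  qed
qed

section \<open>Fatou's lemma for setwise convergent measures\<close>

text \<open>For a fixed integrand the inequality passes from indicators to simple functions to their suprema. For
  varying integrands it is applied to \<open>inf {gs k | k \<ge> m}\<close>, which lies below \<open>gs n\<close> for \<open>n \<ge> m\<close>.\<close>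

lemma fatou_setwise_convergence:
  assumes sets: "\<And>n. sets (\<mu> n) = sets N" "sets \<nu> = sets N" and S: "S \<in> sets N"
    and conv: "\<And>C. C \<in> sets N \<Longrightarrow> C \<subseteq> S \<Longrightarrow> (\<lambda>n. emeasure (\<mu> n) C) \<longlonglongrightarrow> emeasure \<nu> C"
    and gs: "\<And>n. gs n \<in> borel_measurable N"
    and le: "AE y in \<nu>. y \<in> S \<longrightarrow> g y \<le> liminf (\<lambda>n. gs n y)"
  shows "(\<integral>\<^sup>+y\<in>S. g y \<partial>\<nu>) \<le> liminf (\<lambda>n. \<integral>\<^sup>+y\<in>S. gs n y \<partial>\<mu> n)"
proof -
  note cong = measurable_cong_sets[OF sets(1) refl] measurable_cong_sets[OF sets(2) refl]
  have fixed: "(\<integral>\<^sup>+y\<in>S. h y \<partial>\<nu>) \<le> liminf (\<lambda>n. \<integral>\<^sup>+y\<in>S. h y \<partial>\<mu> n)"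
    if "h \<in> borel_measurable N" for h :: "_ \<Rightarrow> ennreal"
    using that
  proof (induction rule: borel_measurable_induct)
    case (cong f g)
    have sp: "space (\<mu> n) = space N" "space \<nu> = space N" for n
      using sets sets_eq_imp_space_eq by blast+
    have "(\<integral>\<^sup>+y\<in>S. f y \<partial>\<mu> n) = (\<integral>\<^sup>+y\<in>S. g y \<partial>\<mu> n)" for n
      using cong(3) sp by (intro nn_integral_cong) auto
    moreover have "(\<integral>\<^sup>+y\<in>S. f y \<partial>\<nu>) = (\<integral>\<^sup>+y\<in>S. g y \<partial>\<nu>)"
      using cong(3) sp by (intro nn_integral_cong) auto
    ultimately show ?case using cong(4) by simp
  next
    case (set B)
    have "(\<integral>\<^sup>+y\<in>S. indicator B y \<partial>\<rho>) = emeasure \<rho> (B \<inter> S)" if "sets \<rho> = sets N" for \<rho>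
      using set S that by (simp flip: indicator_inter_arith)
    with sets conv[of "B \<inter> S"] set S show ?case
      using lim_imp_Liminf[OF sequentially_bot conv[of "B \<inter> S"]] by simp
  next
    case (mult u c)
    have "(\<integral>\<^sup>+y\<in>S. c * u y \<partial>\<rho>) = c * (\<integral>\<^sup>+y\<in>S. u y \<partial>\<rho>)" if "sets \<rho> = sets N" for \<rho>
      using mult(2) S that by (simp add: mult.assoc nn_integral_cmult measurable_cong_sets[OF that refl])
    moreover have "c * liminf (\<lambda>n. \<integral>\<^sup>+y\<in>S. u y \<partial>\<mu> n) \<le> liminf (\<lambda>n. c * (\<integral>\<^sup>+y\<in>S. u y \<partial>\<mu> n))"
      by (rule mult_liminf_le_ennreal)
    ultimately show ?case using mult(4) sets by (auto intro: order_trans[OF mult_left_mono])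
  next
    case (add u v)
    have IH: "(\<integral>\<^sup>+y\<in>S. v y \<partial>\<nu>) \<le> liminf (\<lambda>n. \<integral>\<^sup>+y\<in>S. v y \<partial>\<mu> n)"
      "(\<integral>\<^sup>+y\<in>S. u y \<partial>\<nu>) \<le> liminf (\<lambda>n. \<integral>\<^sup>+y\<in>S. u y \<partial>\<mu> n)" by fact+
    have "(\<integral>\<^sup>+y\<in>S. v y + u y \<partial>\<rho>) = (\<integral>\<^sup>+y\<in>S. v y \<partial>\<rho>) + (\<integral>\<^sup>+y\<in>S. u y \<partial>\<rho>)" if "sets \<rho> = sets N" for \<rho>
      using add S that by (simp add: distrib_right nn_integral_add measurable_cong_sets[OF that refl])
    moreover have "liminf f + liminf g \<le> liminf (\<lambda>n. f n + g n)" for f g :: "nat \<Rightarrow> ennreal"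
      by (rule liminf_add_le_ennreal)
    ultimately show ?case using add_mono[OF IH] sets by (auto intro: order_trans)
  next
    case (seq U)
    have "(\<integral>\<^sup>+y\<in>S. (SUP i. U i) y \<partial>\<rho>) = (SUP i. \<integral>\<^sup>+y\<in>S. U i y \<partial>\<rho>)" if "sets \<rho> = sets N" for \<rho>
    proof -
      have "(\<integral>\<^sup>+y. (SUP i. U i y * indicator S y) \<partial>\<rho>) = (SUP i. \<integral>\<^sup>+y\<in>S. U i y \<partial>\<rho>)"
        using seq S that by (intro nn_integral_monotone_convergence_SUP)
          (auto simp: incseq_def le_fun_def measurable_cong_sets[OF that refl] intro!: mult_right_mono)
      then show ?thesis by (simp add: SUP_mult_right_ennreal image_comp)
    qed
    then have "(\<integral>\<^sup>+y\<in>S. (SUP i. U i) y \<partial>\<nu>) = (SUP i. \<integral>\<^sup>+y\<in>S. U i y \<partial>\<nu>)"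
      "(\<integral>\<^sup>+y\<in>S. (SUP i. U i) y \<partial>\<mu> n) = (SUP i. \<integral>\<^sup>+y\<in>S. U i y \<partial>\<mu> n)" for n
      using sets by blast+
    moreover have "(SUP i. \<integral>\<^sup>+y\<in>S. U i y \<partial>\<nu>) \<le> liminf (\<lambda>n. SUP i. \<integral>\<^sup>+y\<in>S. U i y \<partial>\<mu> n)"
    proof (rule SUP_least)
      fix i
      have "(\<integral>\<^sup>+y\<in>S. U i y \<partial>\<nu>) \<le> liminf (\<lambda>n. \<integral>\<^sup>+y\<in>S. U i y \<partial>\<mu> n)" by fact
      also have "\<dots> \<le> liminf (\<lambda>n. SUP i. \<integral>\<^sup>+y\<in>S. U i y \<partial>\<mu> n)"
        by (intro Liminf_mono always_eventually allI SUP_upper) auto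
      finally show "(\<integral>\<^sup>+y\<in>S. U i y \<partial>\<nu>) \<le> liminf (\<lambda>n. SUP i. \<integral>\<^sup>+y\<in>S. U i y \<partial>\<mu> n)" .
    qed
    ultimately show ?case by simp
  qed
  define h where "h m y = (INF k\<in>{m..}. gs k y)" for m y
  have hm: "h m \<in> borel_measurable N" for m unfolding h_def using gs by measurable
  have "(\<integral>\<^sup>+y\<in>S. g y \<partial>\<nu>) \<le> (\<integral>\<^sup>+y. (SUP m. h m y * indicator S y) \<partial>\<nu>)"
    using le
    by (intro nn_integral_mono_AE)
      (auto simp: h_def liminf_SUP_INF SUP_mult_right_ennreal[symmetric] split: split_indicator elim: eventually_mono)
  also have "\<dots> = (SUP m. \<integral>\<^sup>+y\<in>S. h m y \<partial>\<nu>)"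
  proof (rule nn_integral_monotone_convergence_SUP)
    show "incseq (\<lambda>m y. h m y * indicator S y)"
      unfolding h_def by (auto simp: incseq_def le_fun_def intro!: mult_right_mono INF_superset_mono)
  qed (use hm S sets in \<open>auto simp: cong\<close>)
  also have "\<dots> \<le> liminf (\<lambda>n. \<integral>\<^sup>+y\<in>S. gs n y \<partial>\<mu> n)"
  proof (rule SUP_least)
    fix m
    have "(\<integral>\<^sup>+y\<in>S. h m y \<partial>\<nu>) \<le> liminf (\<lambda>n. \<integral>\<^sup>+y\<in>S. h m y \<partial>\<mu> n)" by (rule fixed[OF hm])
    also have "\<dots> \<le> liminf (\<lambda>n. \<integral>\<^sup>+y\<in>S. gs n y \<partial>\<mu> n)"
    proof (rule Liminf_mono)
      show "\<forall>\<^sub>F n in sequentially. (\<integral>\<^sup>+y\<in>S. h m y \<partial>\<mu> n) \<le> (\<integral>\<^sup>+y\<in>S. gs n y \<partial>\<mu> n)"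
        using eventually_ge_at_top[of m]
        by eventually_elim (auto simp: h_def intro!: nn_integral_mono mult_right_mono INF_lower)
    qed
    finally show "(\<integral>\<^sup>+y\<in>S. h m y \<partial>\<nu>) \<le> liminf (\<lambda>n. \<integral>\<^sup>+y\<in>S. gs n y \<partial>\<mu> n)" .
  qed
  finally show ?thesis .
qed

section \<open>Measurable selection from compact sets\<close>

text \<open>A case of the Kuratowski--Ryll-Nardzewski theorem. In step \<open>n\<close> the set \<open>G z\<close> is cut down by the first
  closed ball of radius \<open>1 / 2 ^ n\<close>, in a fixed enumeration of centres, that it still meets. Compactness
  leaves a point in the intersection, the radii leave only one, and that point lies in a closed set
  \<open>F\<close> exactly if all the cut-down sets meet \<open>F\<close>.\<close>

lemma measurable_selection_compact:
  fixes G :: "'z \<Rightarrow> 'a::{metric_space, second_countable_topology} set"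
  assumes compact: "\<And>z. z \<in> space M \<Longrightarrow> compact (G z)"
    and ne: "\<And>z. z \<in> space M \<Longrightarrow> G z \<noteq> {}"
    and hit: "\<And>F. closed F \<Longrightarrow> {z \<in> space M. G z \<inter> F \<noteq> {}} \<in> sets M"
  obtains \<phi> where "\<phi> \<in> borel_measurable M" "\<And>z. z \<in> space M \<Longrightarrow> \<phi> z \<in> G z"
proof -
  obtain D :: "'a set" where D: "countable D" "\<forall>U. open U \<longrightarrow> U \<noteq> {} \<longrightarrow> (\<exists>d\<in>D. d \<in> U)"
    using countable_dense_exists by blast
  define d where "d = from_nat_into D"
  have d: "\<exists>i. x \<in> cball (d i) e" if "e > 0" for x e
  proof -
    have "ball x e \<noteq> {}" using that by simp
    from D(2)[rule_format, OF open_ball this] obtain y where y: "y \<in> D" "y \<in> ball x e" by (elim bexE) (rule that)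
    then obtain i where "d i = y" using from_nat_into_surj[OF D(1)] by (auto simp: d_def)
    with y show ?thesis by (intro exI[of _ i]) (auto simp: dist_commute)
  qed
  define pick where "pick z F n = (LEAST i. G z \<inter> F \<inter> cball (d i) (1 / 2 ^ n) \<noteq> {})" for z F and n :: nat
  define C where "C z = rec_nat UNIV (\<lambda>n F. F \<inter> cball (d (pick z F n)) (1 / 2 ^ n))" for z
  have C0: "C z 0 = UNIV" and CSuc: "C z (Suc n) = C z n \<inter> cball (d (pick z (C z n) n)) (1 / 2 ^ n)" for z n
    by (simp_all add: C_def)
  have closed: "closed (C z n)" for z n by (induction n) (auto simp: C0 CSuc)
  have pick: "G z \<inter> C z n \<inter> cball (d (pick z (C z n) n)) (1 / 2 ^ n) \<noteq> {}"
    if "G z \<inter> C z n \<noteq> {}" for z n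
  proof -
    obtain x where x: "x \<in> G z \<inter> C z n" using \<open>G z \<inter> C z n \<noteq> {}\<close> by blast
    obtain i where i: "x \<in> cball (d i) (1 / 2 ^ n)" using d[of "1 / 2 ^ n" x] by auto
    then have "G z \<inter> C z n \<inter> cball (d i) (1 / 2 ^ n) \<noteq> {}" using x by blast
    then show ?thesis unfolding pick_def by (rule LeastI)
  qed
  have nonempty: "G z \<inter> C z n \<noteq> {}" if "z \<in> space M" for z n
  proof (induction n)
    case 0 then show ?case using ne[OF that] by (simp add: C0)
  next
    case (Suc n) then show ?case using pick[OF Suc] by (simp add: CSuc Int_assoc)
  qed
  have dec: "C z n \<subseteq> C z m" if "m \<le> n" for z m n
    using that by (induction rule: dec_induct) (auto simp: CSuc)
  have meas: "{z \<in> space M. G z \<inter> C z n \<inter> F \<noteq> {}} \<in> sets M" if "closed F" for n F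
    using that
  proof (induction n arbitrary: F)
    case 0 then show ?case using hit by (simp add: C0)
  next
    case (Suc n)
    let ?B = "\<lambda>i. cball (d i) (1 / 2 ^ n)"
    let ?E = "\<lambda>F. {z \<in> space M. G z \<inter> C z n \<inter> F \<noteq> {}}"
    have "{z \<in> space M. G z \<inter> C z (Suc n) \<inter> F \<noteq> {}} =
        (\<Union>i. ?E (?B i \<inter> F) - (\<Union>j\<in>{..<i}. ?E (?B j)))" (is "?L = ?R")
    proof (intro equalityI subsetI)
      fix z assume z: "z \<in> ?L"
      let ?i = "pick z (C z n) n"
      have "z \<notin> ?E (?B j)" if "j < ?i" for j
        using not_less_Least[OF that[unfolded pick_def]] by blast
      moreover have "z \<in> ?E (?B ?i \<inter> F)" using z by (auto simp: CSuc)
      ultimately show "z \<in> ?R" by blast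
    next
      fix z assume "z \<in> ?R"
      then obtain i where i: "z \<in> ?E (?B i \<inter> F)" "\<And>j. j < i \<Longrightarrow> z \<notin> ?E (?B j)" by blast
      have "pick z (C z n) n = i"
        unfolding pick_def
      proof (rule Least_equality)
        show "G z \<inter> C z n \<inter> ?B i \<noteq> {}" using i(1) by blast
        show "i \<le> j" if "G z \<inter> C z n \<inter> ?B j \<noteq> {}" for j
          using i(2)[of j] i(1) that by (cases "j < i") auto
      qed
      then show "z \<in> ?L" using i(1) by (auto simp: CSuc)
    qed
    also have "\<dots> \<in> sets M"
      using Suc.prems by (intro sets.countable_UN sets.Diff sets.finite_UN image_subsetI Suc.IH) auto
    finally show ?case .
  qed
  have nest: "(\<Inter>n. G z \<inter> C z n \<inter> F) \<noteq> {}"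
    if z: "z \<in> space M" and "closed F" and "\<And>n. G z \<inter> C z n \<inter> F \<noteq> {}" for z F
  proof -
    have "G z \<inter> (\<Inter>n\<in>UNIV. C z n \<inter> F) \<noteq> {}"
    proof (rule compact_imp_fip_image[OF compact[OF z]])
      show "closed (C z n \<inter> F)" for n using closed that(2) by (rule closed_Int)
      fix I :: "nat set" assume I: "finite I"
      have "C z (Max I) \<subseteq> C z n" if "n \<in> I" for n using I that by (intro dec) simp
      then show "G z \<inter> (\<Inter>n\<in>I. C z n \<inter> F) \<noteq> {}" using that(3)[of "Max I"] by blast
    qed
    then show ?thesis by blast
  qed
  define \<phi> where "\<phi> z = (SOME x. x \<in> (\<Inter>n. G z \<inter> C z n))" for z
  have \<phi>: "\<phi> z \<in> G z \<inter> C z n" if z: "z \<in> space M" for z n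
  proof -
    have "(\<Inter>n. G z \<inter> C z n) \<noteq> {}" using nest[OF z, of UNIV] nonempty[OF z] by simp
    then have "\<phi> z \<in> (\<Inter>n. G z \<inter> C z n)" unfolding \<phi>_def by (rule some_in_eq[THEN iffD2])
    then show ?thesis by blast
  qed
  have unique: "x = y" if "\<And>n. x \<in> C z n" "\<And>n. y \<in> C z n" for x y z
  proof -
    have "dist x y \<le> 2 * (1 / 2) ^ n" for n
    proof -
      have "x \<in> C z (Suc n)" "y \<in> C z (Suc n)" using that by blast+
      then have "dist (d (pick z (C z n) n)) x \<le> 1 / 2 ^ n" "dist (d (pick z (C z n) n)) y \<le> 1 / 2 ^ n"
        by (auto simp: CSuc)
      then show ?thesis using dist_triangle3[of x y "d (pick z (C z n) n)"]
        by (simp add: power_one_over)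
    qed
    moreover have "(\<lambda>n. 2 * (1 / 2 :: real) ^ n) \<longlonglongrightarrow> 2 * 0"
      by (intro tendsto_intros LIMSEQ_realpow_zero) auto
    ultimately have "dist x y \<le> 2 * 0" by (intro LIMSEQ_le_const[of "\<lambda>n. 2 * (1 / 2) ^ n"]) blast+
    then show ?thesis by simp
  qed
  have "\<phi> \<in> borel_measurable M"
  proof (rule borel_measurableI)
    fix U :: "'a set" assume "open U"
    then have F: "closed (- U)" by (simp add: closed_def)
    have "\<phi> -` (- U) \<inter> space M = (\<Inter>n. {z \<in> space M. G z \<inter> C z n \<inter> - U \<noteq> {}})" (is "?L = ?R")
    proof (intro equalityI subsetI)
      fix z assume "z \<in> ?L" then show "z \<in> ?R" using \<phi>[of z] by blast
    next
      fix z assume z: "z \<in> ?R"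
      then obtain x where x: "x \<in> (\<Inter>n. G z \<inter> C z n \<inter> - U)" using nest[of z, OF _ F] by blast
      have "x = \<phi> z" using x \<phi>[of z] z by (intro unique) auto
      then show "z \<in> ?L" using x z by auto
    qed
    also have "\<dots> \<in> sets M" using meas[OF F] by auto
    finally have "space M - (\<phi> -` (- U) \<inter> space M) \<in> sets M" by auto
    moreover have "space M - (\<phi> -` (- U) \<inter> space M) = \<phi> -` U \<inter> space M" by auto
    ultimately show "\<phi> -` U \<inter> space M \<in> sets M" by simp
  qed
  with \<phi> that show thesis by blast
qed

section \<open>Decision processes with nonnegative costs\<close>

text \<open>With nonnegative costs all expectations exist in \<^typ>\<open>ennreal\<close> and sums, integrals and suprema can
  be exchanged freely. \<open>Q u\<close> is the cost of one step followed by the terminal cost \<open>u\<close>.\<close>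

locale cost_mdp =
  fixes S :: "'s measure" and A :: "'a measure" and p :: "'s \<times> 'a \<Rightarrow> 's measure"
    and C :: "'s \<times> 'a \<Rightarrow> ennreal" and \<alpha> :: real
  assumes p [measurable]: "p \<in> S \<Otimes>\<^sub>M A \<rightarrow>\<^sub>M prob_algebra S"
    and C [measurable]: "C \<in> borel_measurable (S \<Otimes>\<^sub>M A)"
    and \<alpha>: "0 \<le> \<alpha>"
begin

definition Q :: "('s \<Rightarrow> ennreal) \<Rightarrow> 's \<times> 'a \<Rightarrow> ennreal" where
  "Q u s = C s + ennreal \<alpha> * (\<integral>\<^sup>+z. u z \<partial>p s)"

lemma Q_measurable [measurable]:
  assumes [measurable]: "u \<in> borel_measurable S"
  shows "Q u \<in> borel_measurable (S \<Otimes>\<^sub>M A)"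
proof -
  have [measurable]: "p \<in> S \<Otimes>\<^sub>M A \<rightarrow>\<^sub>M subprob_algebra S" using p by (rule measurable_prob_algebraD)
  show ?thesis unfolding Q_def by measurable
qed

lemma p_in: "z \<in> space S \<Longrightarrow> a \<in> space A \<Longrightarrow> p (z, a) \<in> space (prob_algebra S)"
  using measurable_space[OF p, of "(z, a)"] by (simp add: space_pair_measure)

lemma Q_mono:
  assumes "z \<in> space S" "a \<in> space A" "\<And>z. z \<in> space S \<Longrightarrow> u z \<le> v z"
  shows "Q u (z, a) \<le> Q v (z, a)"
proof -
  have "space (p (z, a)) = space S"
    using p_in[OF assms(1,2)] by (auto simp: space_prob_algebra dest: sets_eq_imp_space_eq)
  then show ?thesis
    unfolding Q_def using assms by (intro add_left_mono mult_left_mono nn_integral_mono) auto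
qed

lemma Q_cong:
  assumes "z \<in> space S" "a \<in> space A" "\<And>z. z \<in> space S \<Longrightarrow> u z = v z"
  shows "Q u (z, a) = Q v (z, a)"
  using assms by (intro antisym Q_mono) auto

lemma Q_SUP:
  assumes "z \<in> space S" "a \<in> space A" "\<And>n. u n \<in> borel_measurable S"
    and mono: "\<And>n z. z \<in> space S \<Longrightarrow> u n z \<le> u (Suc n) z"
  shows "Q (\<lambda>z. SUP n. u n z) (z, a) = (SUP n. Q (u n) (z, a))"
proof -
  have P: "sets (p (z, a)) = sets S" "space (p (z, a)) = space S"
    using p_in[OF assms(1,2)] by (auto simp: space_prob_algebra dest: sets_eq_imp_space_eq)
  have "(\<integral>\<^sup>+z. (SUP n. u n z) \<partial>p (z, a)) = (SUP n. \<integral>\<^sup>+z. u n z \<partial>p (z, a))"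
    using assms P by (intro nn_integral_monotone_convergence_SUP_AE AE_I2)
      (auto simp: measurable_cong_sets[OF P(1) refl])
  then show ?thesis
    unfolding Q_def by (simp add: SUP_mult_left_ennreal ennreal_SUP_add_right)
qed

context
  fixes \<delta> :: "('s, 'a) policy" and z :: 's
  assumes \<delta>: "\<delta> \<in> policies S A" and z: "z \<in> space S"
begin

abbreviation "law \<equiv> mdp_law S A p \<delta> z"

interpretation IT: Ionescu_Tulcea "mdp_step S A p \<delta> z" "\<lambda>_. A \<Otimes>\<^sub>M S"
  by (rule Ionescu_Tulcea_mdp_step[OF p \<delta> z])

lemma sets_law: "sets law = sets (\<Pi>\<^sub>M i\<in>UNIV. A \<Otimes>\<^sub>M S)"
  unfolding mdp_law_def by (rule IT.PF.sets_lim)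

lemma space_law: "space law = space (\<Pi>\<^sub>M i\<in>UNIV. A \<Otimes>\<^sub>M S)"
  unfolding mdp_law_def by (rule IT.PF.space_lim)

lemma prob_space_law: "prob_space law"
proof (rule prob_space_distrD[of "\<lambda>\<omega>. restrict \<omega> {}"])
  show "(\<lambda>\<omega>. restrict \<omega> {}) \<in> law \<rightarrow>\<^sub>M (\<Pi>\<^sub>M i\<in>{}. A \<Otimes>\<^sub>M S)"
    by (subst measurable_cong_sets[OF sets_law refl]) (rule measurable_restrict_subset, auto)
  show "prob_space (distr law (\<Pi>\<^sub>M i\<in>{}. A \<Otimes>\<^sub>M S) (\<lambda>\<omega>. restrict \<omega> {}))"
    using finite_marginal_mdp_law[OF p \<delta> z, of "{}"] IT.PF.prob_space_P[of "{}"] by simp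
qed

lemma CI_initial_segment: "IT.CI {0..<n} = IT.C 0 n (\<lambda>_. undefined)"
proof (rule measure_eqI)
  have u: "(\<lambda>_. undefined) \<in> space (\<Pi>\<^sub>M i\<in>{0..<0::nat}. A \<Otimes>\<^sub>M S)" by (simp add: space_PiM)
  show "sets (IT.CI {0..<n}) = sets (IT.C 0 n (\<lambda>_. undefined))"
    using IT.sets_C[OF u, of n] by (simp add: IT.CI_def)
  fix X assume "X \<in> sets (IT.CI {0..<n})"
  then have X: "X \<in> sets (\<Pi>\<^sub>M i\<in>{0..<n}. A \<Otimes>\<^sub>M S)" by (simp add: IT.CI_def)
  have "prod_emb {0..<n} (\<lambda>_. A \<Otimes>\<^sub>M S) {0..<n} X = X"
    using sets.sets_into_space[OF X] by (simp add: prod_emb_id space_PiM)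
  then show "emeasure (IT.CI {0..<n}) X = emeasure (IT.C 0 n (\<lambda>_. undefined)) X"
    using IT.emeasure_CI[OF order_refl X] by simp
qed

lemma nn_integral_law_segment:
  assumes f: "f \<in> borel_measurable (\<Pi>\<^sub>M i\<in>{0..<n}. A \<Otimes>\<^sub>M S)"
  shows "(\<integral>\<^sup>+\<omega>. f (restrict \<omega> {0..<n}) \<partial>law) = (\<integral>\<^sup>+\<omega>. f \<omega> \<partial>IT.C 0 n (\<lambda>_. undefined))"
proof -
  have "(\<integral>\<^sup>+\<omega>. f (restrict \<omega> {0..<n}) \<partial>law) =
      (\<integral>\<^sup>+\<omega>. f \<omega> \<partial>distr law (\<Pi>\<^sub>M i\<in>{0..<n}. A \<Otimes>\<^sub>M S) (\<lambda>\<omega>. restrict \<omega> {0..<n}))"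
  proof (rule nn_integral_distr[symmetric])
    show "f \<in> borel_measurable (distr law (\<Pi>\<^sub>M i\<in>{0..<n}. A \<Otimes>\<^sub>M S) (\<lambda>\<omega>. restrict \<omega> {0..<n}))"
      using f by simp
    show "(\<lambda>\<omega>. restrict \<omega> {0..<n}) \<in> law \<rightarrow>\<^sub>M (\<Pi>\<^sub>M i\<in>{0..<n}. A \<Otimes>\<^sub>M S)"
      by (subst measurable_cong_sets[OF sets_law refl]) (rule measurable_restrict_subset, auto)
  qed
  then show ?thesis
    using finite_marginal_mdp_law[OF p \<delta> z, of "{0..<n}"] by (simp add: CI_initial_segment)
qed

lemma nn_integral_mdp_step:
  assumes \<omega>: "\<omega> \<in> space (\<Pi>\<^sub>M i\<in>{0..<k}. A \<Otimes>\<^sub>M S)" and f [measurable]: "f \<in> borel_measurable (A \<Otimes>\<^sub>M S)"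
  shows "(\<integral>\<^sup>+y. f y \<partial>mdp_step S A p \<delta> z k \<omega>) =
    (\<integral>\<^sup>+a. (\<integral>\<^sup>+z'. f (a, z') \<partial>p (state_at z \<omega> k, a)) \<partial>\<delta> k (z, \<omega>))"
proof -
  have s [measurable]: "state_at z \<omega> k \<in> space S"
    using measurable_space[OF measurable_state_at, of "(z, \<omega>)" S k A] \<omega> z by (simp add: space_pair_measure)
  have d: "\<delta> k (z, \<omega>) \<in> space (prob_algebra A)"
    using \<delta> measurable_space[of "\<delta> k" _ _ "(z, \<omega>)"] \<omega> z by (fastforce simp: policies_def space_pair_measure)
  then have dA: "sets (\<delta> k (z, \<omega>)) = sets A" "space (\<delta> k (z, \<omega>)) = space A"
    by (auto simp: space_prob_algebra dest: sets_eq_imp_space_eq)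
  let ?K = "\<lambda>a. p (state_at z \<omega> k, a) \<bind> (\<lambda>z'. return (A \<Otimes>\<^sub>M S) (a, z'))"
  have K: "?K \<in> A \<rightarrow>\<^sub>M prob_algebra (A \<Otimes>\<^sub>M S)" by measurable
  have "(\<integral>\<^sup>+y. f y \<partial>mdp_step S A p \<delta> z k \<omega>) = (\<integral>\<^sup>+a. (\<integral>\<^sup>+y. f y \<partial>?K a) \<partial>\<delta> k (z, \<omega>))"
    unfolding mdp_step_def
    by (rule nn_integral_bind[OF f]) (simp add: measurable_cong_sets[OF dA(1) refl] measurable_prob_algebraD[OF K])
  also have "\<dots> = (\<integral>\<^sup>+a. (\<integral>\<^sup>+z'. f (a, z') \<partial>p (state_at z \<omega> k, a)) \<partial>\<delta> k (z, \<omega>))"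
  proof (rule nn_integral_cong)
    fix a assume "a \<in> space (\<delta> k (z, \<omega>))"
    then have a [measurable]: "a \<in> space A" using dA by simp
    have P: "sets (p (state_at z \<omega> k, a)) = sets S" "space (p (state_at z \<omega> k, a)) = space S"
      using p_in[OF s a] by (auto simp: space_prob_algebra dest: sets_eq_imp_space_eq)
    have "(\<integral>\<^sup>+y. f y \<partial>?K a) = (\<integral>\<^sup>+z'. (\<integral>\<^sup>+y. f y \<partial>return (A \<Otimes>\<^sub>M S) (a, z')) \<partial>p (state_at z \<omega> k, a))"
      by (rule nn_integral_bind[OF f]) (simp add: measurable_cong_sets[OF P(1) refl])
    also have "\<dots> = (\<integral>\<^sup>+z'. f (a, z') \<partial>p (state_at z \<omega> k, a))"
      using a P by (intro nn_integral_cong nn_integral_return) (auto simp: space_pair_measure)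
    finally show "(\<integral>\<^sup>+y. f y \<partial>?K a) = (\<integral>\<^sup>+z'. f (a, z') \<partial>p (state_at z \<omega> k, a))" .
  qed
  finally show ?thesis .
qed

text \<open>The trajectory law is only known through its finite marginals. The marginal on the first \<open>k + 1\<close> steps is
  the one on the first \<open>k\<close> steps extended by the step kernel, which splits into the choice of an action
  and a transition.\<close>

lemma nn_integral_law_step:
  assumes g [measurable]: "g \<in> borel_measurable (S \<Otimes>\<^sub>M (A \<Otimes>\<^sub>M S))"
  shows "(\<integral>\<^sup>+\<omega>. g (state_at z \<omega> k, \<omega> k) \<partial>law) =
    (\<integral>\<^sup>+\<omega>. (\<integral>\<^sup>+a. (\<integral>\<^sup>+z'. g (state_at z \<omega> k, (a, z')) \<partial>p (state_at z \<omega> k, a))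
       \<partial>\<delta> k (z, restrict \<omega> {0..<k})) \<partial>law)"
proof -
  let ?PM = "\<lambda>n. \<Pi>\<^sub>M i\<in>{0..<n::nat}. A \<Otimes>\<^sub>M S"
  let ?C = "\<lambda>k. IT.C 0 k (\<lambda>_. undefined)"
  have u: "(\<lambda>_. undefined) \<in> space (\<Pi>\<^sub>M i\<in>{0..<0::nat}. A \<Otimes>\<^sub>M S)" by (simp add: space_PiM)
  have st: "(\<lambda>\<omega>. state_at z \<omega> n) \<in> ?PM n \<rightarrow>\<^sub>M S" for n
    using measurable_compose[OF measurable_Pair1'[OF z] measurable_state_at] by simp
  have st_restrict: "state_at z (restrict \<omega> {0..<n}) n = state_at z \<omega> n" for \<omega> n
    by (auto simp: state_at_def split: nat.split)
  have st_upd: "state_at z (fun_upd \<omega> n y) n = state_at z \<omega> n" for \<omega> n y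
    by (auto simp: state_at_def split: nat.split)
  let ?f = "\<lambda>\<omega>. g (state_at z \<omega> k, \<omega> k)"
  let ?h = "\<lambda>\<omega>. \<integral>\<^sup>+a. (\<integral>\<^sup>+z'. g (state_at z \<omega> k, (a, z')) \<partial>p (state_at z \<omega> k, a)) \<partial>\<delta> k (z, \<omega>)"
  have st': "(\<lambda>\<omega>. state_at z \<omega> k) \<in> ?PM (Suc k) \<rightarrow>\<^sub>M S"
  proof (cases k)
    case 0 then show ?thesis using z by (simp add: state_at_def)
  next
    case (Suc n) then show ?thesis unfolding state_at_def by simp measurable
  qed
  have f: "?f \<in> borel_measurable (?PM (Suc k))"
    using st' by measurable
  have eP: "(\<integral>\<^sup>+\<omega>'. ?f \<omega>' \<partial>IT.eP k \<omega>) = ?h \<omega>" if \<omega>: "\<omega> \<in> space (?PM k)" for \<omega>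
  proof -
    have s: "state_at z \<omega> k \<in> space S" using measurable_space[OF st \<omega>] .
    have "(\<integral>\<^sup>+\<omega>'. ?f \<omega>' \<partial>IT.eP k \<omega>) = (\<integral>\<^sup>+y. g (state_at z \<omega> k, y) \<partial>mdp_step S A p \<delta> z k \<omega>)"
      using \<omega> f by (subst IT.nn_integral_eP) (simp_all add: st_upd)
    also have "\<dots> = ?h \<omega>"
      using s by (intro nn_integral_mdp_step[OF \<omega>]) measurable
    finally show ?thesis .
  qed
  have h: "?h \<in> borel_measurable (?PM k)"
  proof (subst measurable_cong[OF eP[symmetric]])
    show "(\<lambda>\<omega>. \<integral>\<^sup>+\<omega>'. ?f \<omega>' \<partial>IT.eP k \<omega>) \<in> borel_measurable (?PM k)"
      using f by measurable
  qed
  have "(\<integral>\<^sup>+\<omega>. ?f \<omega> \<partial>law) = (\<integral>\<^sup>+\<omega>. ?f (restrict \<omega> {0..<Suc k}) \<partial>law)"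
  proof (rule nn_integral_cong)
    fix \<omega> :: "nat \<Rightarrow> 'a \<times> 's"
    have "state_at z (restrict \<omega> {0..<Suc k}) k = state_at z \<omega> k"
      by (auto simp: state_at_def split: nat.split)
    then show "?f \<omega> = ?f (restrict \<omega> {0..<Suc k})" by simp
  qed
  also have "\<dots> = (\<integral>\<^sup>+\<omega>. ?f \<omega> \<partial>?C (Suc k))" by (rule nn_integral_law_segment[OF f])
  also have "\<dots> = (\<integral>\<^sup>+\<omega>. (\<integral>\<^sup>+\<omega>'. ?f \<omega>' \<partial>IT.eP k \<omega>) \<partial>?C k)"
    unfolding IT.C.simps(2) add_0
    using IT.measurable_eP[of k] by (intro nn_integral_bind[OF f]) (simp add: measurable_cong_sets[OF IT.sets_C[OF u] refl])
  also have "\<dots> = (\<integral>\<^sup>+\<omega>. ?h \<omega> \<partial>?C k)"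
    using IT.space_C[OF u, of k] by (intro nn_integral_cong eP) simp
  also have "\<dots> = (\<integral>\<^sup>+\<omega>. ?h (restrict \<omega> {0..<k}) \<partial>law)" by (rule nn_integral_law_segment[OF h, symmetric])
  finally show ?thesis by (simp only: st_restrict)
qed

lemma state_at_law [measurable]: "(\<lambda>\<omega>. state_at z \<omega> k) \<in> law \<rightarrow>\<^sub>M S"
  unfolding measurable_cong_sets[OF sets_law refl]
proof (cases k)
  case 0 then show "(\<lambda>\<omega>. state_at z \<omega> k) \<in> (\<Pi>\<^sub>M i\<in>UNIV. A \<Otimes>\<^sub>M S) \<rightarrow>\<^sub>M S" using z by (simp add: state_at_def)
next
  case (Suc n) then show "(\<lambda>\<omega>. state_at z \<omega> k) \<in> (\<Pi>\<^sub>M i\<in>UNIV. A \<Otimes>\<^sub>M S) \<rightarrow>\<^sub>M S"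
    unfolding state_at_def by simp measurable
qed

lemma action_at_law [measurable]: "(\<lambda>\<omega>. action_at \<omega> k) \<in> law \<rightarrow>\<^sub>M A"
  unfolding measurable_cong_sets[OF sets_law refl] action_at_def by measurable

lemma stage_cost_measurable [measurable]:
  "(\<lambda>\<omega>. C (state_at z \<omega> k, action_at \<omega> k)) \<in> borel_measurable law"
  by measurable

text \<open>All dynamic programming arguments below use the trajectory law through this identity.\<close>

lemma one_step:
  assumes u [measurable]: "u \<in> borel_measurable S"
  shows "(\<integral>\<^sup>+\<omega>. C (state_at z \<omega> k, action_at \<omega> k) \<partial>law) + ennreal \<alpha> * (\<integral>\<^sup>+\<omega>. u (state_at z \<omega> (Suc k)) \<partial>law) =
    (\<integral>\<^sup>+\<omega>. (\<integral>\<^sup>+a. Q u (state_at z \<omega> k, a) \<partial>\<delta> k (z, restrict \<omega> {0..<k})) \<partial>law)"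
proof -
  let ?g = "\<lambda>(s, a, z'). C (s, a) + ennreal \<alpha> * u z'"
  have "(\<integral>\<^sup>+\<omega>. C (state_at z \<omega> k, action_at \<omega> k) \<partial>law) + ennreal \<alpha> * (\<integral>\<^sup>+\<omega>. u (state_at z \<omega> (Suc k)) \<partial>law)
    = (\<integral>\<^sup>+\<omega>. C (state_at z \<omega> k, action_at \<omega> k) + ennreal \<alpha> * u (state_at z \<omega> (Suc k)) \<partial>law)"
    by (simp add: nn_integral_add nn_integral_cmult)
  also have "\<dots> = (\<integral>\<^sup>+\<omega>. ?g (state_at z \<omega> k, \<omega> k) \<partial>law)"
    by (simp add: state_at_def[of _ _ "Suc k"] action_at_def split_beta)
  also have "\<dots> = (\<integral>\<^sup>+\<omega>. (\<integral>\<^sup>+a. (\<integral>\<^sup>+z'. ?g (state_at z \<omega> k, (a, z')) \<partial>p (state_at z \<omega> k, a))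
       \<partial>\<delta> k (z, restrict \<omega> {0..<k})) \<partial>law)"
    by (rule nn_integral_law_step) measurable
  also have "\<dots> = (\<integral>\<^sup>+\<omega>. (\<integral>\<^sup>+a. Q u (state_at z \<omega> k, a) \<partial>\<delta> k (z, restrict \<omega> {0..<k})) \<partial>law)"
  proof (intro nn_integral_cong)
    fix \<omega> a assume \<omega>: "\<omega> \<in> space law" and "a \<in> space (\<delta> k (z, restrict \<omega> {0..<k}))"
    moreover have "restrict \<omega> {0..<k} \<in> space (\<Pi>\<^sub>M i\<in>{0..<k}. A \<Otimes>\<^sub>M S)"
      using \<omega> by (auto simp: space_law space_PiM PiE_iff)
    then have "\<delta> k (z, restrict \<omega> {0..<k}) \<in> space (prob_algebra A)"
      using \<delta> measurable_space[of "\<delta> k" _ _ "(z, restrict \<omega> {0..<k})"] z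
      by (fastforce simp: policies_def space_pair_measure)
    ultimately have a: "a \<in> space A"
      by (auto simp: space_prob_algebra dest: sets_eq_imp_space_eq)
    have s: "state_at z \<omega> k \<in> space S" using measurable_space[OF state_at_law \<omega>] .
    from p_in[OF s a] have P: "sets (p (state_at z \<omega> k, a)) = sets S" "prob_space (p (state_at z \<omega> k, a))"
      by (auto simp: space_prob_algebra)
    interpret prob_space "p (state_at z \<omega> k, a)" by fact
    show "(\<integral>\<^sup>+z'. ?g (state_at z \<omega> k, (a, z')) \<partial>p (state_at z \<omega> k, a)) = Q u (state_at z \<omega> k, a)"
      unfolding Q_def
      by (simp add: nn_integral_add nn_integral_cmult measurable_cong_sets[OF P(1) refl] emeasure_space_1)
  qed
  finally show ?thesis .
qed

end

definition V :: "nat \<Rightarrow> ('s, 'a) policy \<Rightarrow> 's \<Rightarrow> ennreal" where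
  "V n \<delta> z = (\<integral>\<^sup>+\<omega>. (\<Sum>k<n. ennreal (\<alpha> ^ k) * C (state_at z \<omega> k, action_at \<omega> k)) \<partial>mdp_law S A p \<delta> z)"

lemma V_Suc:
  assumes \<delta>: "\<delta> \<in> policies S A" and z: "z \<in> space S"
  shows "V (Suc n) \<delta> z = V n \<delta> z +
    ennreal (\<alpha> ^ n) * (\<integral>\<^sup>+\<omega>. C (state_at z \<omega> n, action_at \<omega> n) \<partial>mdp_law S A p \<delta> z)"
proof -
  note [measurable] = stage_cost_measurable[OF \<delta> z]
  show ?thesis unfolding V_def by (simp add: nn_integral_add nn_integral_cmult)
qed

lemma value_and_continuation_step:
  assumes \<delta>: "\<delta> \<in> policies S A" and z: "z \<in> space S" and u: "u \<in> borel_measurable S"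
  shows "V (Suc n) \<delta> z + ennreal (\<alpha> ^ Suc n) * (\<integral>\<^sup>+\<omega>. u (state_at z \<omega> (Suc n)) \<partial>mdp_law S A p \<delta> z) =
    V n \<delta> z + ennreal (\<alpha> ^ n) *
      (\<integral>\<^sup>+\<omega>. (\<integral>\<^sup>+a. Q u (state_at z \<omega> n, a) \<partial>\<delta> n (z, restrict \<omega> {0..<n})) \<partial>mdp_law S A p \<delta> z)"
proof -
  have "ennreal (\<alpha> ^ Suc n) = ennreal (\<alpha> ^ n) * ennreal \<alpha>"
    using \<alpha> by (simp add: ennreal_mult' mult.commute)
  then show ?thesis
    unfolding V_Suc[OF \<delta> z] one_step[OF \<delta> z u, symmetric]
    by (simp add: distrib_left mult.assoc add.assoc)
qed

text \<open>Dynamic programming for arbitrary history-dependent randomized policies: by the one-step identity the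
  right-hand side is nondecreasing in the number of steps, because \<open>u k\<close> lies below the average of
  \<open>Q (u (Suc k))\<close> over any choice of actions.\<close>

lemma policy_lower_bound:
  assumes \<delta>: "\<delta> \<in> policies S A" and z: "z \<in> space S"
    and u: "\<And>k. u k \<in> borel_measurable S"
    and le: "\<And>k z a. k < n \<Longrightarrow> z \<in> space S \<Longrightarrow> a \<in> space A \<Longrightarrow> u k z \<le> Q (u (Suc k)) (z, a)"
  shows "u 0 z \<le> V n \<delta> z + ennreal (\<alpha> ^ n) * (\<integral>\<^sup>+\<omega>. u n (state_at z \<omega> n) \<partial>mdp_law S A p \<delta> z)"
  using le
proof (induction n)
  case 0
  interpret prob_space "mdp_law S A p \<delta> z" by (rule prob_space_law[OF \<delta> z])
  show ?case by (simp add: V_def state_at_def emeasure_space_1)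
next
  case (Suc n)
  have "(\<integral>\<^sup>+\<omega>. u n (state_at z \<omega> n) \<partial>mdp_law S A p \<delta> z) \<le>
    (\<integral>\<^sup>+\<omega>. (\<integral>\<^sup>+a. Q (u (Suc n)) (state_at z \<omega> n, a) \<partial>\<delta> n (z, restrict \<omega> {0..<n})) \<partial>mdp_law S A p \<delta> z)"
  proof (rule nn_integral_mono)
    fix \<omega> assume \<omega>: "\<omega> \<in> space (mdp_law S A p \<delta> z)"
    have s: "state_at z \<omega> n \<in> space S" using measurable_space[OF state_at_law[OF \<delta> z] \<omega>] .
    have "restrict \<omega> {0..<n} \<in> space (\<Pi>\<^sub>M i\<in>{0..<n}. A \<Otimes>\<^sub>M S)"
      using \<omega> by (auto simp: space_law[OF \<delta> z] space_PiM PiE_iff)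
    then have d: "\<delta> n (z, restrict \<omega> {0..<n}) \<in> space (prob_algebra A)"
      using \<delta> measurable_space[of "\<delta> n" _ _ "(z, restrict \<omega> {0..<n})"] z
      by (fastforce simp: policies_def space_pair_measure)
    then have d': "prob_space (\<delta> n (z, restrict \<omega> {0..<n}))" "space (\<delta> n (z, restrict \<omega> {0..<n})) = space A"
      by (auto simp: space_prob_algebra dest: sets_eq_imp_space_eq)
    interpret prob_space "\<delta> n (z, restrict \<omega> {0..<n})" by (rule d'(1))
    have "u n (state_at z \<omega> n) = (\<integral>\<^sup>+a. u n (state_at z \<omega> n) \<partial>\<delta> n (z, restrict \<omega> {0..<n}))"
      by (simp add: emeasure_space_1)
    also have "\<dots> \<le> (\<integral>\<^sup>+a. Q (u (Suc n)) (state_at z \<omega> n, a) \<partial>\<delta> n (z, restrict \<omega> {0..<n}))"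
      using s d' by (intro nn_integral_mono Suc.prems) auto
    finally show "u n (state_at z \<omega> n) \<le> (\<integral>\<^sup>+a. Q (u (Suc n)) (state_at z \<omega> n, a) \<partial>\<delta> n (z, restrict \<omega> {0..<n}))" .
  qed
  then have "V n \<delta> z + ennreal (\<alpha> ^ n) * (\<integral>\<^sup>+\<omega>. u n (state_at z \<omega> n) \<partial>mdp_law S A p \<delta> z) \<le>
     V (Suc n) \<delta> z + ennreal (\<alpha> ^ Suc n) * (\<integral>\<^sup>+\<omega>. u (Suc n) (state_at z \<omega> (Suc n)) \<partial>mdp_law S A p \<delta> z)"
    unfolding value_and_continuation_step[OF \<delta> z u] by (intro add_left_mono mult_left_mono) auto
  moreover have "u 0 z \<le> V n \<delta> z + ennreal (\<alpha> ^ n) * (\<integral>\<^sup>+\<omega>. u n (state_at z \<omega> n) \<partial>mdp_law S A p \<delta> z)"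
    using Suc by simp
  ultimately show ?case by (rule order_trans[rotated])
qed

text \<open>The same telescoping, with equality when the actions are those for which \<open>u k\<close> is computed.\<close>

lemma markov_policy_value:
  assumes \<phi>: "\<And>k. \<phi> k \<in> S \<rightarrow>\<^sub>M A" and z: "z \<in> space S"
    and u: "\<And>k. u k \<in> borel_measurable S"
    and eq: "\<And>k z. k < n \<Longrightarrow> z \<in> space S \<Longrightarrow> u k z = Q (u (Suc k)) (z, \<phi> k z)"
  shows "u 0 z = V n (markov_policy A \<phi>) z +
    ennreal (\<alpha> ^ n) * (\<integral>\<^sup>+\<omega>. u n (state_at z \<omega> n) \<partial>mdp_law S A p (markov_policy A \<phi>) z)"
  using eq
proof (induction n)
  have \<delta>: "markov_policy A \<phi> \<in> policies S A" using \<phi> by (rule markov_policy_in_policies)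
  {
    case 0
    interpret prob_space "mdp_law S A p (markov_policy A \<phi>) z" by (rule prob_space_law[OF \<delta> z])
    show ?case by (simp add: V_def state_at_def emeasure_space_1)
  next
    case (Suc n)
    let ?\<delta> = "markov_policy A \<phi>"
    have "(\<integral>\<^sup>+\<omega>. u n (state_at z \<omega> n) \<partial>mdp_law S A p ?\<delta> z) =
      (\<integral>\<^sup>+\<omega>. (\<integral>\<^sup>+a. Q (u (Suc n)) (state_at z \<omega> n, a) \<partial>?\<delta> n (z, restrict \<omega> {0..<n})) \<partial>mdp_law S A p ?\<delta> z)"
    proof (rule nn_integral_cong)
      fix \<omega> assume \<omega>: "\<omega> \<in> space (mdp_law S A p ?\<delta> z)"
      have s: "state_at z \<omega> n \<in> space S" using measurable_space[OF state_at_law[OF \<delta> z] \<omega>] .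
      have st_restrict: "state_at z (restrict \<omega> {0..<n}) n = state_at z \<omega> n"
        by (auto simp: state_at_def split: nat.split)
      have "(\<lambda>a. Q (u (Suc n)) (state_at z \<omega> n, a)) \<in> borel_measurable A"
        using measurable_compose[OF measurable_Pair1'[OF s] Q_measurable[OF u]] by simp
      moreover have "\<phi> n (state_at z \<omega> n) \<in> space A" using measurable_space[OF \<phi> s] .
      ultimately have "(\<integral>\<^sup>+a. Q (u (Suc n)) (state_at z \<omega> n, a) \<partial>?\<delta> n (z, restrict \<omega> {0..<n})) =
          Q (u (Suc n)) (state_at z \<omega> n, \<phi> n (state_at z \<omega> n))"
        unfolding markov_policy_def by (simp add: st_restrict nn_integral_return)
      then show "u n (state_at z \<omega> n) = (\<integral>\<^sup>+a. Q (u (Suc n)) (state_at z \<omega> n, a) \<partial>?\<delta> n (z, restrict \<omega> {0..<n}))"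
        using Suc.prems[of n] s by simp
    qed
    then show ?case
      using Suc value_and_continuation_step[OF \<delta> z u[of "Suc n"], of n] by simp
  }
qed

definition V_inf :: "('s, 'a) policy \<Rightarrow> 's \<Rightarrow> ennreal" where
  "V_inf \<delta> z = (\<integral>\<^sup>+\<omega>. (\<Sum>k. ennreal (\<alpha> ^ k) * C (state_at z \<omega> k, action_at \<omega> k)) \<partial>mdp_law S A p \<delta> z)"

lemma V_inf_eq_SUP:
  assumes \<delta>: "\<delta> \<in> policies S A" and z: "z \<in> space S"
  shows "V_inf \<delta> z = (SUP n. V n \<delta> z)"
proof -
  note [measurable] = stage_cost_measurable[OF \<delta> z]
  show ?thesis unfolding V_def V_inf_def suminf_eq_SUP
    by (rule nn_integral_monotone_convergence_SUP) (auto simp: incseq_def le_fun_def intro!: sum_mono2)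
qed

lemma V_mono: "V n \<delta> z \<le> V (Suc n) \<delta> z"
  unfolding V_def by (intro nn_integral_mono) (simp add: add_increasing2)

end

section \<open>Value iteration\<close>

lemma ennreal_less_add_pos: "x < top \<Longrightarrow> 0 < e \<Longrightarrow> x < x + ennreal e"
  by (cases x) (auto simp: ennreal_less_iff simp flip: ennreal_plus)

text \<open>\<open>C_lsc\<close> and \<open>C_proper\<close> together are the sequential form of \<open>K\<close>-inf-compactness of the cost.\<close>

locale continuous_mdp = cost_mdp "borel_of TS" "borel_on A" p C \<alpha>
  for TS :: "'s topology" and A :: "'a::polish_space set" and p C \<alpha> +
  assumes TS: "metrizable_space TS" and A_nonempty: "A \<noteq> {}"
    and p_continuous: "\<And>s a s\<^sub>0 a\<^sub>0. (\<And>n. s n \<in> topspace TS) \<Longrightarrow> limitin TS s s\<^sub>0 sequentially \<Longrightarrow>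
      (\<And>n. a n \<in> A) \<Longrightarrow> a\<^sub>0 \<in> A \<Longrightarrow> a \<longlonglongrightarrow> a\<^sub>0 \<Longrightarrow>
      limitin (weak_topology TS) (\<lambda>n. p (s n, a n)) (p (s\<^sub>0, a\<^sub>0)) sequentially"
    and C_lsc: "\<And>s a s\<^sub>0 a\<^sub>0. (\<And>n. s n \<in> topspace TS) \<Longrightarrow> limitin TS s s\<^sub>0 sequentially \<Longrightarrow>
      (\<And>n. a n \<in> A) \<Longrightarrow> a\<^sub>0 \<in> A \<Longrightarrow> a \<longlonglongrightarrow> a\<^sub>0 \<Longrightarrow> C (s\<^sub>0, a\<^sub>0) \<le> liminf (\<lambda>n. C (s n, a n))"
    and C_proper: "\<And>s a s\<^sub>0 l. (\<And>n. s n \<in> topspace TS) \<Longrightarrow> limitin TS s s\<^sub>0 sequentially \<Longrightarrow>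
      (\<And>n. a n \<in> A) \<Longrightarrow> (\<And>n. C (s n, a n) \<le> ennreal l) \<Longrightarrow>
      \<exists>r a\<^sub>0. strict_mono (r :: nat \<Rightarrow> nat) \<and> a\<^sub>0 \<in> A \<and> (\<lambda>n. a (r n)) \<longlonglongrightarrow> a\<^sub>0"
begin

lemma Q_lsc:
  assumes u: "seq_lsc TS u" and s: "\<And>n. s n \<in> topspace TS" "limitin TS s s\<^sub>0 sequentially"
    and a: "\<And>n. a n \<in> A" "a\<^sub>0 \<in> A" "a \<longlonglongrightarrow> a\<^sub>0"
  shows "Q u (s\<^sub>0, a\<^sub>0) \<le> liminf (\<lambda>n. Q u (s n, a n))"
proof -
  have P: "p (s n, a n) \<in> prob_measures TS" for n using s a by (intro p_in) auto
  have "(\<integral>\<^sup>+x. u x \<partial>p (s\<^sub>0, a\<^sub>0)) \<le> liminf (\<lambda>n. \<integral>\<^sup>+x. u x \<partial>p (s n, a n))"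
    using u by (intro fatou_weak_convergence[OF TS P p_continuous[OF s a]]) (auto simp: seq_lsc_def)
  then have "Q u (s\<^sub>0, a\<^sub>0) \<le> liminf (\<lambda>n. C (s n, a n)) +
      ennreal \<alpha> * liminf (\<lambda>n. \<integral>\<^sup>+x. u x \<partial>p (s n, a n))"
    unfolding Q_def by (intro add_mono C_lsc[OF s a] mult_left_mono) auto
  also have "\<dots> \<le> liminf (\<lambda>n. C (s n, a n)) + liminf (\<lambda>n. ennreal \<alpha> * (\<integral>\<^sup>+x. u x \<partial>p (s n, a n)))"
    by (intro add_left_mono mult_liminf_le_ennreal)
  also have "\<dots> \<le> liminf (\<lambda>n. Q u (s n, a n))"
    unfolding Q_def by (rule liminf_add_le_ennreal)
  finally show ?thesis .
qed

lemma Q_proper: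
  assumes s: "\<And>n. s n \<in> topspace TS" "limitin TS s s\<^sub>0 sequentially"
    and a: "\<And>n. a n \<in> A" and le: "\<And>n. Q u (s n, a n) \<le> ennreal l"
  shows "\<exists>r a\<^sub>0. strict_mono (r :: nat \<Rightarrow> nat) \<and> a\<^sub>0 \<in> A \<and> (\<lambda>n. a (r n)) \<longlonglongrightarrow> a\<^sub>0"
proof (rule C_proper[OF s a])
  show "C (s n, a n) \<le> ennreal l" for n
    using le[of n] unfolding Q_def by (rule order_trans[rotated]) (simp add: add_increasing2)
qed

text \<open>Near-minimizers along a subsequence that realizes the lower limit have bounded cost, so by properness
  they accumulate at an action, and lower semicontinuity of \<open>Q u\<close> bounds its value. This single
  statement gives lower semicontinuity of the minimum (take \<open>s\<close> convergent) and its existence (take \<open>s\<close>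
  constant). The closed set \<open>F\<close> is needed for the selection of minimizers.\<close>

lemma inf_Q_limit:
  assumes u: "seq_lsc TS u" and F: "closed F" "A \<inter> F \<noteq> {}"
    and s: "\<And>n. s n \<in> topspace TS" "limitin TS s s\<^sub>0 sequentially"
    and fin: "liminf (\<lambda>n. INF a\<in>A \<inter> F. Q u (s n, a)) < top"
  shows "\<exists>a\<in>A \<inter> F. Q u (s\<^sub>0, a) \<le> liminf (\<lambda>n. INF a\<in>A \<inter> F. Q u (s n, a))"
proof -
  define w where "w n = (INF a\<in>A \<inter> F. Q u (s n, a))" for n
  define L where "L = liminf w"
  have Lfin: "L < top" using fin by (simp add: L_def w_def[abs_def])
  obtain r :: "nat \<Rightarrow> nat" where r: "strict_mono r" "(w \<circ> r) \<longlonglongrightarrow> L"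
    using liminf_subseq_lim[of w] by (auto simp: L_def)
  have "\<forall>n. \<exists>a\<in>A \<inter> F. Q u (s (r n), a) \<le> w (r n) + ennreal (1 / Suc n)"
  proof
    fix n
    show "\<exists>a\<in>A \<inter> F. Q u (s (r n), a) \<le> w (r n) + ennreal (1 / Suc n)"
    proof (cases "w (r n) = top")
      case True then show ?thesis using F(2) by auto
    next
      case False
      then have "w (r n) < w (r n) + ennreal (1 / Suc n)"
        by (intro ennreal_less_add_pos) (auto simp: top.not_eq_extremum)
      then obtain a where "a \<in> A \<inter> F" "Q u (s (r n), a) < w (r n) + ennreal (1 / Suc n)"
        unfolding w_def INF_less_iff by blast
      then show ?thesis by (auto intro: less_imp_le)
    qed
  qed
  then obtain a where a: "\<And>n. a n \<in> A" "\<And>n. a n \<in> F"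
    and Qa: "\<And>n. Q u (s (r n), a n) \<le> w (r n) + ennreal (1 / Suc n)" by (metis IntD1 IntD2)
  have "(\<lambda>n. w (r n) + ennreal (1 / Suc n)) \<longlonglongrightarrow> L + ennreal 0"
    using r(2) by (intro tendsto_add tendsto_ennrealI LIMSEQ_Suc[OF lim_const_over_n]) (auto simp: comp_def)
  then have lim: "(\<lambda>n. w (r n) + ennreal (1 / Suc n)) \<longlonglongrightarrow> L" by simp
  \<comment> \<open>any finite bound above the lower limit serves for properness\<close>
  obtain l where l: "L < ennreal l" 
  proof -
    obtain x where "L = ennreal x" "0 \<le> x" using Lfin by (cases L) auto
    then have "L < ennreal (x + 1)" by (simp add: ennreal_less_iff)
    then show thesis by (rule that)
  qed
  obtain N where N: "\<And>n. N \<le> n \<Longrightarrow> w (r n) + ennreal (1 / Suc n) < ennreal l"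
    using order_tendstoD(2)[OF lim l] by (auto simp: eventually_sequentially)
  have rN: "filterlim (\<lambda>n. r (n + N)) sequentially sequentially"
    using filterlim_compose[OF filterlim_subseq[OF r(1)] filterlim_add_const_nat_at_top] .
  have "\<exists>r' a\<^sub>0. strict_mono (r' :: nat \<Rightarrow> nat) \<and> a\<^sub>0 \<in> A \<and> (\<lambda>n. a (r' n + N)) \<longlonglongrightarrow> a\<^sub>0"
  proof (rule Q_proper)
    show "s (r (n + N)) \<in> topspace TS" for n using s by auto
    show "limitin TS (\<lambda>n. s (r (n + N))) s\<^sub>0 sequentially"
      using limitin_compose_filterlim[OF s(2) rN] .
    show "a (n + N) \<in> A" for n using a by auto
    show "Q u (s (r (n + N)), a (n + N)) \<le> ennreal l" for n
      using Qa[of "n + N"] N[of "n + N"] by (auto intro: order_trans less_imp_le)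
  qed
  then obtain r' a\<^sub>0 where r': "strict_mono (r' :: nat \<Rightarrow> nat)" and a0: "a\<^sub>0 \<in> A" "(\<lambda>n. a (r' n + N)) \<longlonglongrightarrow> a\<^sub>0"
    by blast
  have q: "filterlim (\<lambda>n. r' n + N) sequentially sequentially" 
    using filterlim_compose[OF filterlim_add_const_nat_at_top filterlim_subseq[OF r']] .
  have a0F: "a\<^sub>0 \<in> F" using closed_sequentially[OF F(1) _ a0(2)] a(2) by blast
  have "Q u (s\<^sub>0, a\<^sub>0) \<le> liminf (\<lambda>n. Q u (s (r (r' n + N)), a (r' n + N)))"
  proof (rule Q_lsc[OF u])
    show "limitin TS (\<lambda>n. s (r (r' n + N))) s\<^sub>0 sequentially"
      using limitin_compose_filterlim[OF s(2) filterlim_compose[OF filterlim_subseq[OF r(1)] q]] .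
  qed (use s a a0 in auto)
  also have "\<dots> \<le> liminf (\<lambda>n. w (r (r' n + N)) + ennreal (1 / Suc (r' n + N)))"
    by (intro Liminf_mono always_eventually allI Qa)
  also have "\<dots> = L"
    using lim_imp_Liminf[OF sequentially_bot filterlim_compose[OF lim q]] by simp
  finally show ?thesis using a0(1) a0F unfolding L_def w_def[abs_def] by blast
qed

lemma inf_Q_lsc:
  assumes u: "seq_lsc TS u" and F: "closed F"
  shows "seq_lsc TS (\<lambda>z. INF a\<in>A \<inter> F. Q u (z, a))"
  unfolding seq_lsc_def
proof (intro allI impI)
  fix s s\<^sub>0 assume s: "(\<forall>n. s n \<in> topspace TS) \<and> limitin TS s s\<^sub>0 sequentially"
  show "(INF a\<in>A \<inter> F. Q u (s\<^sub>0, a)) \<le> liminf (\<lambda>n. INF a\<in>A \<inter> F. Q u (s n, a))"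
  proof (cases "A \<inter> F = {} \<or> liminf (\<lambda>n. INF a\<in>A \<inter> F. Q u (s n, a)) = top")
    case True
    then show ?thesis by (auto simp: Liminf_const)
  next
    case False
    then obtain a where "a \<in> A \<inter> F" "Q u (s\<^sub>0, a) \<le> liminf (\<lambda>n. INF a\<in>A \<inter> F. Q u (s n, a))"
      using inf_Q_limit[OF u F, of s s\<^sub>0] s by (auto simp: top.not_eq_extremum)
    then show ?thesis by (auto intro: INF_lower2)
  qed
qed

lemma inf_Q_attained:
  assumes u: "seq_lsc TS u" and F: "closed F" and z: "z \<in> topspace TS"
    and fin: "(INF a\<in>A \<inter> F. Q u (z, a)) < top"
  shows "\<exists>a\<in>A \<inter> F. Q u (z, a) = (INF a\<in>A \<inter> F. Q u (z, a))"
proof -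
  have "A \<inter> F \<noteq> {}" using fin by auto
  then have "\<exists>a\<in>A \<inter> F. Q u (z, a) \<le> (INF a\<in>A \<inter> F. Q u (z, a))"
    using inf_Q_limit[OF u F, of "\<lambda>_. z" z] z fin by (simp add: Liminf_const limitin_const_iff)
  then show ?thesis by (metis INF_lower antisym)
qed

text \<open>The Bellman operator.\<close>

definition T_op :: "('s \<Rightarrow> ennreal) \<Rightarrow> 's \<Rightarrow> ennreal" where
  "T_op u z = (INF a\<in>A. Q u (z, a))"

lemma T_op_lsc: "seq_lsc TS u \<Longrightarrow> seq_lsc TS (T_op u)"
  using inf_Q_lsc[of u UNIV] by (simp add: T_op_def[abs_def])

lemma T_op_le: "a \<in> A \<Longrightarrow> T_op u z \<le> Q u (z, a)"
  unfolding T_op_def by (rule INF_lower)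

lemma T_op_attained:
  assumes u: "seq_lsc TS u" and z: "z \<in> topspace TS"
  shows "\<exists>a\<in>A. Q u (z, a) = T_op u z"
proof (cases "T_op u z = top")
  case True
  then show ?thesis using A_nonempty T_op_le by (metis ex_in_conv top.extremum_uniqueI)
next
  case False
  then show ?thesis
    using inf_Q_attained[OF u closed_UNIV z] unfolding T_op_def by (simp only: Int_UNIV_right top.not_eq_extremum)
qed

lemma minimizers_compact:
  assumes u: "seq_lsc TS u" and z: "z \<in> topspace TS" and fin: "T_op u z < top"
  shows "compact {a \<in> A. Q u (z, a) = T_op u z}"
proof -
  obtain l where l: "T_op u z = ennreal l" using fin by (cases "T_op u z") auto
  show ?thesis
    unfolding compact_eq_seq_compact_metric seq_compact_def
  proof (intro allI impI)
    fix a :: "nat \<Rightarrow> 'a" assume a: "\<forall>n. a n \<in> {a \<in> A. Q u (z, a) = T_op u z}"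
    have lim: "limitin TS (\<lambda>_. z) z sequentially" using z by (simp add: limitin_const_iff)
    have "\<exists>r a\<^sub>0. strict_mono (r :: nat \<Rightarrow> nat) \<and> a\<^sub>0 \<in> A \<and> (\<lambda>n. a (r n)) \<longlonglongrightarrow> a\<^sub>0"
      using a z l by (intro Q_proper[OF _ lim, of a u l]) auto
    then obtain r a\<^sub>0 where r: "strict_mono (r :: nat \<Rightarrow> nat)" "a\<^sub>0 \<in> A" "(\<lambda>n. a (r n)) \<longlonglongrightarrow> a\<^sub>0" by blast
    have "Q u (z, a\<^sub>0) \<le> liminf (\<lambda>n. Q u (z, a (r n)))"
      using a z r by (intro Q_lsc[OF u _ lim]) auto
    also have "\<dots> = T_op u z" using a by (simp add: Liminf_const)
    finally have "Q u (z, a\<^sub>0) = T_op u z" using T_op_le[OF r(2), of u z] by (simp add: antisym)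
    then show "\<exists>l\<in>{a \<in> A. Q u (z, a) = T_op u z}. \<exists>r. strict_mono r \<and> (a \<circ> r) \<longlonglongrightarrow> l"
      using r by (auto simp: comp_def)
  qed
qed

text \<open>A closed set \<open>F\<close> contains a minimizer exactly if the minimum over \<open>F\<close> equals the
  overall minimum, which compares two lower semicontinuous functions of the state. Where the minimum is
  infinite every action minimizes and a constant one is taken, which keeps the sets compact.\<close>

lemma measurable_minimizer:
  assumes u: "seq_lsc TS u"
  obtains \<phi> where "\<phi> \<in> borel_of TS \<rightarrow>\<^sub>M borel_on A" "\<And>z. z \<in> topspace TS \<Longrightarrow> Q u (z, \<phi> z) = T_op u z"
proof -
  obtain a0 where a0: "a0 \<in> A" using A_nonempty by blast
  define G where "G z = (if T_op u z < top then {a \<in> A. Q u (z, a) = T_op u z} else {a0})" for z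
  have GA: "G z \<subseteq> A" for z using a0 by (auto simp: G_def)
  have GQ: "Q u (z, a) = T_op u z" if "a \<in> G z" for z a
    using that T_op_le[of a u z] GA[of z] by (auto simp: G_def split: if_splits intro: top.extremum_uniqueI)
      (metis top.extremum_uniqueI top.not_eq_extremum)
  have [measurable]: "T_op u \<in> borel_measurable (borel_of TS)"
    using seq_lsc_measurable[OF TS T_op_lsc[OF u]] .
  have "\<exists>\<phi>. \<phi> \<in> borel_measurable (borel_of TS) \<and> (\<forall>z\<in>topspace TS. \<phi> z \<in> G z)"
  proof (rule measurable_selection_compact[of "borel_of TS" G])
    show "compact (G z)" if "z \<in> space (borel_of TS)" for z
      using that minimizers_compact[OF u, of z] by (auto simp: G_def)
    show "G z \<noteq> {}" if "z \<in> space (borel_of TS)" for z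
      using that T_op_attained[OF u, of z] by (auto simp: G_def)
    fix F :: "'a set" assume F: "closed F"
    have [measurable]: "(\<lambda>z. INF a\<in>A \<inter> F. Q u (z, a)) \<in> borel_measurable (borel_of TS)"
      using seq_lsc_measurable[OF TS inf_Q_lsc[OF u F]] .
    have "{z \<in> space (borel_of TS). G z \<inter> F \<noteq> {}} =
      {z \<in> space (borel_of TS). (T_op u z < top \<and> (INF a\<in>A \<inter> F. Q u (z, a)) \<le> T_op u z) \<or>
         (\<not> T_op u z < top \<and> a0 \<in> F)}"
    proof (rule Collect_cong, rule conj_cong[OF refl])
      fix z assume z: "z \<in> space (borel_of TS)"
      show "(G z \<inter> F \<noteq> {}) = ((T_op u z < top \<and> (INF a\<in>A \<inter> F. Q u (z, a)) \<le> T_op u z) \<or>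
         (\<not> T_op u z < top \<and> a0 \<in> F))"
      proof (cases "T_op u z < top")
        case True
        have "(INF a\<in>A \<inter> F. Q u (z, a)) \<le> T_op u z" if ne: "G z \<inter> F \<noteq> {}"
        proof -
          obtain a where "a \<in> A \<inter> F" "Q u (z, a) = T_op u z" using ne True by (auto simp: G_def)
          then show ?thesis by (metis INF_lower)
        qed
        moreover have "G z \<inter> F \<noteq> {}" if le: "(INF a\<in>A \<inter> F. Q u (z, a)) \<le> T_op u z"
        proof -
          obtain a where a: "a \<in> A \<inter> F" "Q u (z, a) = (INF a\<in>A \<inter> F. Q u (z, a))"
            using inf_Q_attained[OF u F, of z] z le True by (auto dest: le_less_trans)
          then have "Q u (z, a) = T_op u z" using le T_op_le[of a u z] by (auto intro: antisym)
          then show ?thesis using a True by (auto simp: G_def)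
        qed
        ultimately show ?thesis using True by blast
      qed (auto simp: G_def)
    qed
    also have "\<dots> \<in> sets (borel_of TS)" by measurable
    finally show "{z \<in> space (borel_of TS). G z \<inter> F \<noteq> {}} \<in> sets (borel_of TS)" .
  qed auto
  then obtain \<phi> where \<phi>: "\<phi> \<in> borel_measurable (borel_of TS)" "\<And>z. z \<in> topspace TS \<Longrightarrow> \<phi> z \<in> G z" by blast
  have "\<phi> \<in> borel_of TS \<rightarrow>\<^sub>M borel_on A"
    using \<phi> GA by (subst measurable_cong_sets[OF refl sets_borel_on]) (intro measurable_restrict_space2, auto)
  with \<phi> GQ that show thesis by blast
qed

primrec v :: "nat \<Rightarrow> 's \<Rightarrow> ennreal" where
  "v 0 = (\<lambda>_. 0)"
| "v (Suc n) = T_op (v n)"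

definition v_inf :: "'s \<Rightarrow> ennreal" where
  "v_inf z = (SUP n. v n z)"

lemma v_lsc: "seq_lsc TS (v n)"
  by (induction n) (auto simp: seq_lsc_def[of _ "\<lambda>_. 0"] T_op_lsc)

lemma v_inf_lsc: "seq_lsc TS v_inf"
  unfolding v_inf_def[abs_def] using v_lsc by (intro seq_lsc_SUP)

lemma v_measurable [measurable]: "v n \<in> borel_measurable (borel_of TS)"
  by (rule seq_lsc_measurable[OF TS v_lsc])

lemma v_inf_measurable [measurable]: "v_inf \<in> borel_measurable (borel_of TS)"
  by (rule seq_lsc_measurable[OF TS v_inf_lsc])

lemma T_op_mono:
  assumes "z \<in> topspace TS" "\<And>z. z \<in> topspace TS \<Longrightarrow> u z \<le> w z"
  shows "T_op u z \<le> T_op w z"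
  unfolding T_op_def
proof (rule INF_mono)
  fix a assume a: "a \<in> A"
  have "Q u (z, a) \<le> Q w (z, a)" using assms a by (intro Q_mono) auto
  then show "\<exists>b\<in>A. Q u (z, b) \<le> Q w (z, a)" using a by blast
qed

lemma v_mono: "z \<in> topspace TS \<Longrightarrow> v n z \<le> v (Suc n) z"
  by (induction n arbitrary: z) (auto intro: T_op_mono)

lemma v_mono': "z \<in> topspace TS \<Longrightarrow> m \<le> n \<Longrightarrow> v m z \<le> v n z"
  by (rule lift_Suc_mono_le[of "\<lambda>n. v n z"]) (rule v_mono)

lemma v_le_v_inf: "v n z \<le> v_inf z"
  unfolding v_inf_def by (rule SUP_upper) simp

lemma Q_v_inf: "z \<in> topspace TS \<Longrightarrow> a \<in> A \<Longrightarrow> Q v_inf (z, a) = (SUP n. Q (v n) (z, a))"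
  unfolding v_inf_def[abs_def] using v_mono by (intro Q_SUP) (auto simp del: v.simps)

text \<open>One inequality is monotonicity. For the other, minimizers \<open>a\<^sub>n\<close> for the horizons \<open>n\<close> accumulate at an
  action \<open>a\<^sub>0\<close>; for each fixed \<open>m\<close>, \<open>Q (v m) (z, a\<^sub>0)\<close> is bounded by the lower limit of
  \<open>Q (v m) (z, a\<^sub>n) \<le> Q (v n) (z, a\<^sub>n) \<le> v_inf z\<close>, and monotone convergence in \<open>m\<close> finishes.\<close>

lemma v_inf_fixed_point:
  assumes z: "z \<in> topspace TS"
  shows "v_inf z = T_op v_inf z"
proof (rule antisym)
  show "v_inf z \<le> T_op v_inf z"
    unfolding v_inf_def
  proof (rule SUP_least)
    fix n
    have "v n z \<le> T_op (v n) z" using v_mono[OF z, of n] by simp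
    also have "\<dots> \<le> T_op v_inf z" using z by (intro T_op_mono v_le_v_inf)
    finally show "v n z \<le> T_op (\<lambda>z. SUP n. v n z) z" by (simp add: v_inf_def[abs_def])
  qed
  show "T_op v_inf z \<le> v_inf z"
  proof (cases "v_inf z = top")
    case False
    then obtain l where l: "v_inf z = ennreal l" by (cases "v_inf z") auto
    have "\<forall>n. \<exists>a\<in>A. Q (v n) (z, a) = v (Suc n) z" using T_op_attained[OF v_lsc z] by simp
    then obtain a where a: "\<And>n. a n \<in> A" "\<And>n. Q (v n) (z, a n) = v (Suc n) z" by metis
    have lim: "limitin TS (\<lambda>_. z) z sequentially" using z by (simp add: limitin_const_iff)
    have "C (z, a n) \<le> ennreal l" for n
    proof -
      have "C (z, a n) \<le> Q (v n) (z, a n)" by (simp add: Q_def add_increasing2)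
      also have "\<dots> \<le> v_inf z" unfolding a(2) by (rule v_le_v_inf)
      finally show ?thesis using l by simp
    qed
    then have "\<exists>r a\<^sub>0. strict_mono (r :: nat \<Rightarrow> nat) \<and> a\<^sub>0 \<in> A \<and> (\<lambda>n. a (r n)) \<longlonglongrightarrow> a\<^sub>0"
      using z by (intro C_proper[OF _ lim a(1)])
    then obtain r a\<^sub>0 where r: "strict_mono (r :: nat \<Rightarrow> nat)" "a\<^sub>0 \<in> A" "(\<lambda>n. a (r n)) \<longlonglongrightarrow> a\<^sub>0" by blast
    have "Q (v m) (z, a\<^sub>0) \<le> v_inf z" for m
    proof -
      have "Q (v m) (z, a\<^sub>0) \<le> liminf (\<lambda>n. Q (v m) (z, a (r n)))"
        using a z r by (intro Q_lsc[OF v_lsc _ lim]) auto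
      also have "\<dots> \<le> liminf (\<lambda>n. v_inf z)"
      proof (rule Liminf_mono)
        show "\<forall>\<^sub>F n in sequentially. Q (v m) (z, a (r n)) \<le> v_inf z"
          using eventually_ge_at_top[of m]
        proof eventually_elim
          case (elim n)
          then have "m \<le> r n" using seq_suble[OF r(1), of n] by simp
          then have "Q (v m) (z, a (r n)) \<le> Q (v (r n)) (z, a (r n))"
            using z a(1) by (intro Q_mono v_mono') auto
          also have "\<dots> \<le> v_inf z" unfolding a(2) by (rule v_le_v_inf)
          finally show ?case .
        qed
      qed
      finally show ?thesis by (simp add: Liminf_const)
    qed
    then have "Q v_inf (z, a\<^sub>0) \<le> v_inf z" unfolding Q_v_inf[OF z r(2)] by (rule SUP_least)
    then show ?thesis using T_op_le[OF r(2)] order_trans by blast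
  qed simp
qed

lemma finite_horizon_lower_bound:
  assumes "\<delta> \<in> policies (borel_of TS) (borel_on A)" "z \<in> topspace TS"
  shows "v n z \<le> V n \<delta> z"
proof -
  have "v (n - 0) z \<le> V n \<delta> z + ennreal (\<alpha> ^ n) * (\<integral>\<^sup>+\<omega>. v (n - n) (state_at z \<omega> n) \<partial>mdp_law (borel_of TS) (borel_on A) p \<delta> z)"
  proof (rule policy_lower_bound)
    fix k z a assume "k < n" and a: "a \<in> space (borel_on A)"
    then have "n - k = Suc (n - Suc k)" by simp
    then show "v (n - k) z \<le> Q (v (n - Suc k)) (z, a)" using T_op_le[of a] a by simp
  qed (use assms in auto)
  then show ?thesis by simp
qed

text \<open>The decision rule with index \<open>n - 1 - t\<close> is the one in use when \<open>t + 1\<close> steps remain.\<close>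

lemma finite_horizon_optimal:
  assumes \<phi>: "\<And>k. \<phi> k \<in> borel_of TS \<rightarrow>\<^sub>M borel_on A" and z: "z \<in> topspace TS"
    and opt: "\<And>t z. t < n \<Longrightarrow> z \<in> topspace TS \<Longrightarrow> Q (v t) (z, \<phi> (n - 1 - t) z) = v (Suc t) z"
  shows "V n (markov_policy (borel_on A) \<phi>) z = v n z"
proof -
  \<comment> \<open>with \<open>k\<close> steps elapsed, \<open>n - k\<close> remain\<close>
  have "v (n - 0) z = V n (markov_policy (borel_on A) \<phi>) z + ennreal (\<alpha> ^ n) *
    (\<integral>\<^sup>+\<omega>. v (n - n) (state_at z \<omega> n) \<partial>mdp_law (borel_of TS) (borel_on A) p (markov_policy (borel_on A) \<phi>) z)"
  proof (rule markov_policy_value[OF \<phi>])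
    fix k z assume k: "k < n" and z: "z \<in> space (borel_of TS)"
    have "n - 1 - (n - Suc k) = k" "n - k = Suc (n - Suc k)" using k by auto
    then show "v (n - k) z = Q (v (n - Suc k)) (z, \<phi> k z)" using opt[of "n - Suc k" z] k z by simp
  qed (use z in auto)
  then show ?thesis by simp
qed

lemma finite_horizon_optimal_exists:
  obtains \<phi> where "\<And>k. \<phi> k \<in> borel_of TS \<rightarrow>\<^sub>M borel_on A"
    "\<And>t z. t < n \<Longrightarrow> z \<in> topspace TS \<Longrightarrow> Q (v t) (z, \<phi> (n - 1 - t) z) = v (Suc t) z"
proof -
  have "\<forall>t. \<exists>\<phi>. \<phi> \<in> borel_of TS \<rightarrow>\<^sub>M borel_on A \<and> (\<forall>z\<in>topspace TS. Q (v t) (z, \<phi> z) = v (Suc t) z)"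
  proof
    fix t
    from measurable_minimizer[OF v_lsc[of t]]
    show "\<exists>\<phi>. \<phi> \<in> borel_of TS \<rightarrow>\<^sub>M borel_on A \<and> (\<forall>z\<in>topspace TS. Q (v t) (z, \<phi> z) = v (Suc t) z)"
      by (metis v.simps(2))
  qed
  then obtain \<psi> where \<psi>: "\<And>t. \<psi> t \<in> borel_of TS \<rightarrow>\<^sub>M borel_on A"
    "\<And>t z. z \<in> topspace TS \<Longrightarrow> Q (v t) (z, \<psi> t z) = v (Suc t) z" by metis
  show thesis
  proof (rule that[of "\<lambda>k. \<psi> (n - 1 - k)"])
    fix t z assume "t < n" "z \<in> topspace TS"
    moreover from \<open>t < n\<close> have "n - 1 - (n - 1 - t) = t" by simp
    ultimately show "Q (v t) (z, \<psi> (n - 1 - (n - 1 - t)) z) = v (Suc t) z" using \<psi>(2) by simp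
  qed (rule \<psi>(1))
qed

lemma infinite_horizon_lower_bound:
  assumes "\<delta> \<in> policies (borel_of TS) (borel_on A)" "z \<in> topspace TS"
  shows "v_inf z \<le> V_inf \<delta> z"
  unfolding v_inf_def using assms
  by (subst V_inf_eq_SUP) (auto intro!: SUP_mono' finite_horizon_lower_bound)

text \<open>Truncating at \<open>n\<close> steps and charging \<open>v_inf\<close> as terminal cost gives exactly \<open>v_inf\<close>; the terminal cost
  is nonnegative and can be dropped, so \<open>v_inf\<close> bounds every partial cost.\<close>

lemma stationary_optimal:
  assumes \<phi>: "\<phi> \<in> borel_of TS \<rightarrow>\<^sub>M borel_on A" and z: "z \<in> topspace TS"
    and opt: "\<And>z. z \<in> topspace TS \<Longrightarrow> Q v_inf (z, \<phi> z) = v_inf z"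
  shows "V_inf (markov_policy (borel_on A) (\<lambda>_. \<phi>)) z = v_inf z"
proof (rule antisym)
  let ?\<delta> = "markov_policy (borel_on A) (\<lambda>_. \<phi>)"
  have \<delta>: "?\<delta> \<in> policies (borel_of TS) (borel_on A)" using \<phi> by (rule markov_policy_in_policies)
  have "V n ?\<delta> z \<le> v_inf z" for n
  proof -
    have "v_inf z = V n ?\<delta> z + ennreal (\<alpha> ^ n) *
        (\<integral>\<^sup>+\<omega>. v_inf (state_at z \<omega> n) \<partial>mdp_law (borel_of TS) (borel_on A) p ?\<delta> z)"
      by (rule markov_policy_value[where u="\<lambda>_. v_inf"]) (use \<phi> z opt in auto)
    then show ?thesis by (simp add: add_increasing2)
  qed
  then show "V_inf ?\<delta> z \<le> v_inf z"
    using z by (subst V_inf_eq_SUP[OF \<delta>]) (auto intro: SUP_least)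
  show "v_inf z \<le> V_inf ?\<delta> z" using \<delta> z by (rule infinite_horizon_lower_bound)
qed

text \<open>The values for finite horizons are computed by iterating \<open>u \<mapsto> Q u (z, \<phi> z)\<close> from \<open>0\<close>, so monotone
  convergence turns the iteration into an equation for the total cost. Together with \<open>stationary_optimal\<close>
  it characterizes optimal stationary policies.\<close>

lemma stationary_value_equation:
  assumes \<phi>: "\<phi> \<in> borel_of TS \<rightarrow>\<^sub>M borel_on A" and z: "z \<in> topspace TS"
  shows "V_inf (markov_policy (borel_on A) (\<lambda>_. \<phi>)) z =
    Q (V_inf (markov_policy (borel_on A) (\<lambda>_. \<phi>))) (z, \<phi> z)"
proof -
  let ?\<delta> = "markov_policy (borel_on A) (\<lambda>_. \<phi>)"
  have \<delta>: "?\<delta> \<in> policies (borel_of TS) (borel_on A)" using \<phi> by (rule markov_policy_in_policies)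
  define u where "u = rec_nat (\<lambda>_. 0) (\<lambda>n f z. Q f (z, \<phi> z))"
  have u0: "u 0 = (\<lambda>_. 0)" and uSuc: "u (Suc n) = (\<lambda>z. Q (u n) (z, \<phi> z))" for n
    by (simp_all add: u_def)
  have um [measurable]: "u n \<in> borel_measurable (borel_of TS)" for n
  proof (induction n)
    case (Suc n)
    note [measurable] = Q_measurable[OF Suc] \<phi>
    show ?case unfolding uSuc by measurable
  qed (simp add: u0)
  have uV: "V n ?\<delta> z = u n z" if z: "z \<in> topspace TS" for n z
  proof -
    have "u (n - 0) z = V n ?\<delta> z + ennreal (\<alpha> ^ n) *
        (\<integral>\<^sup>+\<omega>. u (n - n) (state_at z \<omega> n) \<partial>mdp_law (borel_of TS) (borel_on A) p ?\<delta> z)"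
    proof (rule markov_policy_value[where u="\<lambda>k. u (n - k)"])
      fix k z assume "k < n"
      then have "n - k = Suc (n - Suc k)" by simp
      then show "u (n - k) z = Q (u (n - Suc k)) (z, \<phi> z)" by (simp add: uSuc)
    qed (use \<phi> z in auto)
    then show ?thesis by (simp add: u0)
  qed
  have VI: "V_inf ?\<delta> z = (SUP n. u n z)" if "z \<in> topspace TS" for z
    using that by (subst V_inf_eq_SUP[OF \<delta>]) (auto simp: uV)
  have mono: "u n z \<le> u (Suc n) z" if "z \<in> topspace TS" for n z
    using V_mono[of n ?\<delta> z] uV[OF that] by simp
  have a: "\<phi> z \<in> A" if "z \<in> topspace TS" for z using measurable_space[OF \<phi>, of z] that by simp
  have "Q (V_inf ?\<delta>) (z, \<phi> z) = Q (\<lambda>z. SUP n. u n z) (z, \<phi> z)"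
    using z a VI by (intro Q_cong) auto
  also have "\<dots> = (SUP n. u (Suc n) z)"
    using z a mono by (subst Q_SUP) (auto simp: uSuc)
  also have "\<dots> = (SUP n. u n z)"
  proof (rule antisym)
    show "(SUP n. u (Suc n) z) \<le> (SUP n. u n z)" by (intro SUP_mono) blast
    show "(SUP n. u n z) \<le> (SUP n. u (Suc n) z)" using mono[OF z] by (intro SUP_mono) blast
  qed
  finally show ?thesis using VI[OF z] by simp
qed

lemma stationary_optimal_iff:
  assumes \<phi>: "\<phi> \<in> borel_of TS \<rightarrow>\<^sub>M borel_on A"
  shows "(\<forall>z\<in>topspace TS. V_inf (markov_policy (borel_on A) (\<lambda>_. \<phi>)) z = v_inf z) \<longleftrightarrow>
    (\<forall>z\<in>topspace TS. Q v_inf (z, \<phi> z) = v_inf z)"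
proof
  assume opt: "\<forall>z\<in>topspace TS. V_inf (markov_policy (borel_on A) (\<lambda>_. \<phi>)) z = v_inf z"
  show "\<forall>z\<in>topspace TS. Q v_inf (z, \<phi> z) = v_inf z"
  proof
    fix z assume z: "z \<in> topspace TS"
    then have a: "\<phi> z \<in> A" using measurable_space[OF \<phi>, of z] by simp
    have "Q v_inf (z, \<phi> z) = Q (V_inf (markov_policy (borel_on A) (\<lambda>_. \<phi>))) (z, \<phi> z)"
      using z a opt by (intro Q_cong) auto
    then show "Q v_inf (z, \<phi> z) = v_inf z"
      using stationary_value_equation[OF \<phi> z] opt z by simp
  qed
qed (use stationary_optimal[OF \<phi>] in blast)

lemma stationary_optimal_exists:
  obtains \<phi> where "\<phi> \<in> borel_of TS \<rightarrow>\<^sub>M borel_on A" "\<And>z. z \<in> topspace TS \<Longrightarrow> Q v_inf (z, \<phi> z) = v_inf z"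
  using measurable_minimizer[OF v_inf_lsc] v_inf_fixed_point by metis

end

section \<open>Costs bounded below\<close>

lemma ereal_integral_cong:
  "(\<And>x. x \<in> space M \<Longrightarrow> f x = g x) \<Longrightarrow> ereal_integral M f = ereal_integral M g"
  unfolding ereal_integral_def by (auto intro!: arg_cong2[where f="(-)"] arg_cong[where f=enn2ereal] nn_integral_cong)

text \<open>All the extended real integrals that occur are of this form; the right-hand side separates the part
  to which monotone convergence applies from a finite constant. Since \<open>b \<le> 0\<close>, the negative part of the
  integrand is at most \<open>- b\<close>.\<close>

lemma ereal_integral_shift:
  fixes b :: real
  assumes M: "prob_space M" and u: "u \<in> borel_measurable M" and b: "b \<le> 0"
  shows "ereal_integral M (\<lambda>x. enn2ereal (u x) + ereal b) = enn2ereal (\<integral>\<^sup>+x. u x \<partial>M) + ereal b"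
proof -
  interpret prob_space M by fact
  let ?f = "\<lambda>x. enn2ereal (u x) + ereal b"
  \<comment> \<open>positive and negative part of \<open>u + b\<close>, rearranged to avoid subtraction\<close>
  have eq: "u x + e2ennreal (- ?f x) = e2ennreal (?f x) + ennreal (- b)" for x
  proof (cases "u x")
    case (real r)
    then show ?thesis using b
      by (cases "r + b \<ge> 0") (auto simp: ennreal_neg simp flip: ennreal_plus)
  next
    case top
    then show ?thesis by (simp add: top_ennreal.rep_eq)
  qed
  have le: "e2ennreal (- ?f x) \<le> ennreal (- b)" for x
  proof (cases "u x")
    case (real r)
    then show ?thesis using b by (auto intro!: ennreal_leI)
  next
    case top
    then have "- ?f x = - \<infinity>" by (simp add: top_ennreal.rep_eq)
    then show ?thesis by (simp add: e2ennreal_neg)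
  qed
  define I N Pl where "I = (\<integral>\<^sup>+x. u x \<partial>M)" and "N = (\<integral>\<^sup>+x. e2ennreal (- ?f x) \<partial>M)"
    and "Pl = (\<integral>\<^sup>+x. e2ennreal (?f x) \<partial>M)"
  have [measurable]: "u \<in> borel_measurable M" by fact
  have "I + N = (\<integral>\<^sup>+x. u x + e2ennreal (- ?f x) \<partial>M)"
    unfolding I_def N_def by (rule nn_integral_add[symmetric]) measurable
  also have "\<dots> = (\<integral>\<^sup>+x. e2ennreal (?f x) + ennreal (- b) \<partial>M)" by (simp only: eq)
  also have "\<dots> = Pl + ennreal (- b)"
    unfolding Pl_def by (subst nn_integral_add) (auto simp: emeasure_space_1)
  finally have IN: "I + N = Pl + ennreal (- b)" .
  have "N \<le> (\<integral>\<^sup>+x. ennreal (- b) \<partial>M)" unfolding N_def by (intro nn_integral_mono le)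
  then have N: "N \<le> ennreal (- b)" by (simp add: emeasure_space_1)
  then obtain n where n: "N = ennreal n" "0 \<le> n"
    by (cases N) (auto simp: top_unique)
  have "enn2ereal Pl - enn2ereal N = enn2ereal I + ereal b"
  proof (cases I)
    case (real i)
    then obtain p where p: "Pl = ennreal p" "0 \<le> p"
      using IN n by (cases Pl) (auto simp flip: ennreal_plus)
    have "i + n = p - b" using IN real n p b by (auto simp flip: ennreal_plus ennreal_minus)
    then show ?thesis using real n p by simp
  next
    case top
    then have "Pl = top" using IN by (metis ennreal_add_eq_top ennreal_neq_top top_neq_ennreal)
    then show ?thesis using top n by (simp add: top_ennreal.rep_eq)
  qed
  then show ?thesis unfolding ereal_integral_def I_def N_def Pl_def .
qed

lemma ereal_mult_shift:
  assumes "0 \<le> r"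
  shows "ereal r * (enn2ereal x + ereal b) = enn2ereal (ennreal r * x) + ereal (r * b)"
proof (cases x)
  case (real y)
  then show ?thesis using assms by (simp add: algebra_simps flip: ennreal_mult)
next
  case top
  then show ?thesis
    using assms by (cases "r = 0") (auto simp: top_ennreal.rep_eq zero_ennreal.rep_eq ennreal_mult_top)
qed

lemma sums_shift:
  fixes x :: "nat \<Rightarrow> ennreal" and y :: "nat \<Rightarrow> real"
  assumes "summable y"
  shows "(\<Sum>t. enn2ereal (x t) + ereal (y t)) = enn2ereal (\<Sum>t. x t) + ereal (\<Sum>t. y t)"
proof -
  have part: "(\<Sum>t<n. enn2ereal (x t) + ereal (y t)) = enn2ereal (\<Sum>t<n. x t) + ereal (\<Sum>t<n. y t)" for n
    by (induction n) (simp_all add: plus_ennreal.rep_eq zero_ennreal.rep_eq ac_simps flip: plus_ereal.simps(1))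
  have "(\<lambda>n. \<Sum>t<n. x t) \<longlonglongrightarrow> (\<Sum>t. x t)" by (intro summable_LIMSEQ) simp
  then have "(\<lambda>n. enn2ereal (\<Sum>t<n. x t)) \<longlonglongrightarrow> enn2ereal (\<Sum>t. x t)" by (rule tendsto_enn2erealI)
  moreover have "(\<lambda>n. ereal (\<Sum>t<n. y t)) \<longlonglongrightarrow> ereal (\<Sum>t. y t)"
    using summable_LIMSEQ[OF assms] by simp
  ultimately have "(\<lambda>n. enn2ereal (\<Sum>t<n. x t) + ereal (\<Sum>t<n. y t)) \<longlonglongrightarrow>
      enn2ereal (\<Sum>t. x t) + ereal (\<Sum>t. y t)"
    by (intro tendsto_add_ereal_general) auto
  then show ?thesis by (intro sums_unique[symmetric]) (simp add: sums_def part)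
qed

lemma shift_eq_iff [simp]: "enn2ereal x + ereal b = enn2ereal y + ereal b \<longleftrightarrow> x = y"
  by (cases x; cases y) (auto simp: top_ennreal.rep_eq)

lemma shift_le_iff [simp]: "enn2ereal x + ereal b \<le> enn2ereal y + ereal b \<longleftrightarrow> x \<le> y"
  by (cases x; cases y) (auto simp: top_ennreal.rep_eq top_unique)

lemma shift_le_real_iff:
  "enn2ereal x + ereal b \<le> ereal l \<longleftrightarrow> b \<le> l \<and> x \<le> ennreal (l - b)"
  by (cases x) (auto simp: top_ennreal.rep_eq top_unique ennreal_le_iff2 algebra_simps)

lemma shift_eq_infinity_iff: "enn2ereal x + ereal b = \<infinity> \<longleftrightarrow> x = top"
  by (cases x) (auto simp: top_ennreal.rep_eq)

lemma lower_semicontinuous_shift: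
  assumes u: "seq_lsc T u" and f: "\<And>z. z \<in> topspace T \<Longrightarrow> f z = enn2ereal (u z) + ereal b"
  shows "lower_semicontinuous T f"
  unfolding lower_semicontinuous_def
proof (intro allI impI)
  fix s s0 assume s: "(\<forall>n. s n \<in> topspace T) \<and> limitin T s s0 sequentially"
  have cont: "continuous_on UNIV (\<lambda>x. enn2ereal x + ereal b)"
    unfolding continuous_on_def by (auto intro!: tendsto_add_ereal_general tendsto_enn2erealI)
  have "s0 \<in> topspace T" using s by (auto intro: limitin_topspace)
  then have "f s0 = enn2ereal (u s0) + ereal b" by (rule f)
  also have "\<dots> \<le> enn2ereal (liminf (\<lambda>n. u (s n))) + ereal b"
    using u s unfolding seq_lsc_def by (subst shift_le_iff) blast
  also have "\<dots> = liminf (\<lambda>n. enn2ereal (u (s n)) + ereal b)"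
    by (rule Liminf_compose_continuous_mono[symmetric, OF cont]) (auto simp: mono_def)
  also have "\<dots> = liminf (\<lambda>n. f (s n))" using f s by simp
  finally show "f s0 \<le> liminf (\<lambda>n. f (s n))" .
qed

text \<open>A cost bounded below by \<open>b\<close> is a nonnegative cost plus the constant \<open>b\<close>. Replacing \<open>b\<close> by \<open>min b 0\<close>
  loses nothing, and the accumulated constants are finite for the infinite horizon if the problem is
  discounted or \<open>b = 0\<close>.\<close>

locale shifted_mdp = continuous_mdp +
  fixes c :: "'a \<times> 'b \<Rightarrow> ereal" and b :: real
  assumes c: "\<And>z a. z \<in> topspace TS \<Longrightarrow> a \<in> A \<Longrightarrow> c (z, a) = enn2ereal (C (z, a)) + ereal b"
    and b: "b \<le> 0" and discounted: "b = 0 \<or> \<alpha> < 1"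
begin

abbreviation "S \<equiv> borel_of TS"
abbreviation "AM \<equiv> borel_on A"

definition shift :: "enat \<Rightarrow> real" where
  "shift T = (\<Sum>t. if enat t < T then \<alpha> ^ t * b else 0)"

lemma summable_shift: "summable (\<lambda>t. if enat t < T then \<alpha> ^ t * b else 0)"
proof (cases T)
  case (enat n)
  then show ?thesis by (intro summable_finite[of "{..<n}"]) auto
next
  case infinity
  then show ?thesis using discounted \<alpha> by (cases "b = 0") (auto intro!: summable_mult2 summable_geometric)
qed

lemma shift_enat: "shift (enat n) = (\<Sum>t<n. \<alpha> ^ t * b)"
  unfolding shift_def by (subst suminf_finite[of "{..<n}"]) auto

lemma shift_nonpos: "shift T \<le> 0"
proof -
  have "shift T \<le> (\<Sum>t. 0::real)"
    unfolding shift_def using b \<alpha> by (intro suminf_le summable_shift) (auto intro: mult_nonneg_nonpos)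
  then show ?thesis by simp
qed

lemma shift_Suc: "shift (enat (Suc n)) = b + \<alpha> * shift (enat n)"
  unfolding shift_enat by (subst sum.lessThan_Suc_shift) (simp add: sum_distrib_left mult.assoc)

lemma shift_LIMSEQ: "(\<lambda>n. shift (enat n)) \<longlonglongrightarrow> shift \<infinity>"
  using summable_LIMSEQ[OF summable_shift[of \<infinity>]] by (simp add: shift_enat shift_def[of \<infinity>])

lemma shift_infinity: "shift \<infinity> = b + \<alpha> * shift \<infinity>"
proof (rule LIMSEQ_unique)
  show "(\<lambda>n. shift (enat (Suc n))) \<longlonglongrightarrow> shift \<infinity>" using shift_LIMSEQ by (rule LIMSEQ_Suc)
  show "(\<lambda>n. shift (enat (Suc n))) \<longlonglongrightarrow> b + \<alpha> * shift \<infinity>"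
    unfolding shift_Suc by (intro tendsto_intros shift_LIMSEQ)
qed

definition VT :: "enat \<Rightarrow> ('a, 'b) policy \<Rightarrow> 'a \<Rightarrow> ennreal" where
  "VT T = (case T of enat n \<Rightarrow> V n | \<infinity> \<Rightarrow> V_inf)"

definition vT :: "enat \<Rightarrow> 'a \<Rightarrow> ennreal" where
  "vT T = (case T of enat n \<Rightarrow> v n | \<infinity> \<Rightarrow> v_inf)"

lemma vT_simps [simp]: "vT (enat n) = v n" "vT \<infinity> = v_inf" by (simp_all add: vT_def)
lemma VT_simps [simp]: "VT (enat n) = V n" "VT \<infinity> = V_inf" by (simp_all add: VT_def)

lemma VT_eq:
  "VT T \<delta> z = (\<integral>\<^sup>+\<omega>. (\<Sum>t. if enat t < T then ennreal (\<alpha> ^ t) * C (state_at z \<omega> t, action_at \<omega> t) else 0)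
     \<partial>mdp_law S AM p \<delta> z)"
proof (cases T)
  case (enat n)
  then show ?thesis
    unfolding enat VT_simps V_def by (intro nn_integral_cong) (subst suminf_finite[of "{..<n}"], auto)
qed (simp add: V_inf_def)

lemma mdp_value_shift:
  assumes \<delta>: "\<delta> \<in> policies S AM" and z: "z \<in> topspace TS"
  shows "mdp_value S AM p c \<alpha> T \<delta> z = enn2ereal (VT T \<delta> z) + ereal (shift T)"
proof -
  have z': "z \<in> space S" using z by simp
  let ?L = "mdp_law S AM p \<delta> z"
  let ?x = "\<lambda>\<omega> t. if enat t < T then ennreal (\<alpha> ^ t) * C (state_at z \<omega> t, action_at \<omega> t) else 0"
  have "mdp_value S AM p c \<alpha> T \<delta> z =
      ereal_integral ?L (\<lambda>\<omega>. enn2ereal (\<Sum>t. ?x \<omega> t) + ereal (shift T))"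
    unfolding mdp_value_def
  proof (rule ereal_integral_cong)
    fix \<omega> assume \<omega>: "\<omega> \<in> space ?L"
    have "state_at z \<omega> t \<in> topspace TS" "action_at \<omega> t \<in> A" for t
      using measurable_space[OF state_at_law[OF \<delta> z'] \<omega>] measurable_space[OF action_at_law[OF \<delta> z'] \<omega>]
      by simp_all
    then have "(if enat t < T then ereal (\<alpha> ^ t) * c (state_at z \<omega> t, action_at \<omega> t) else 0) =
        enn2ereal (?x \<omega> t) + ereal (if enat t < T then \<alpha> ^ t * b else 0)" for t
      using c ereal_mult_shift[of "\<alpha> ^ t"] \<alpha> by (simp add: zero_ennreal.rep_eq)
    then show "(\<Sum>t. if enat t < T then ereal (\<alpha> ^ t) * c (state_at z \<omega> t, action_at \<omega> t) else 0) =
        enn2ereal (\<Sum>t. ?x \<omega> t) + ereal (shift T)"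
      unfolding shift_def by (simp only: sums_shift[OF summable_shift])
  qed
  also have "\<dots> = enn2ereal (VT T \<delta> z) + ereal (shift T)"
    unfolding VT_eq
  proof (rule ereal_integral_shift[OF prob_space_law[OF \<delta> z'] _ shift_nonpos])
    note [measurable] = stage_cost_measurable[OF \<delta> z']
    show "(\<lambda>\<omega>. \<Sum>t. ?x \<omega> t) \<in> borel_measurable ?L" by measurable
  qed
  finally show ?thesis .
qed

lemma VT_lower_bound:
  "\<delta> \<in> policies S AM \<Longrightarrow> z \<in> topspace TS \<Longrightarrow> vT T z \<le> VT T \<delta> z"
  by (cases T) (auto intro: finite_horizon_lower_bound infinite_horizon_lower_bound)

lemma VT_attained:
  obtains \<phi> where "\<And>t. \<phi> t \<in> S \<rightarrow>\<^sub>M AM" "\<And>z. z \<in> topspace TS \<Longrightarrow> VT T (markov_policy AM \<phi>) z = vT T z"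
proof (cases T)
  case (enat n)
  obtain \<phi> where \<phi>: "\<And>k. \<phi> k \<in> S \<rightarrow>\<^sub>M AM"
    "\<And>t z. t < n \<Longrightarrow> z \<in> topspace TS \<Longrightarrow> Q (v t) (z, \<phi> (n - 1 - t) z) = v (Suc t) z"
    using finite_horizon_optimal_exists[of n] by metis
  show thesis using that[of \<phi>] \<phi> finite_horizon_optimal[OF \<phi>(1)] enat by simp
next
  case infinity
  obtain \<phi> where \<phi>: "\<phi> \<in> S \<rightarrow>\<^sub>M AM" "\<And>z. z \<in> topspace TS \<Longrightarrow> Q v_inf (z, \<phi> z) = v_inf z"
    using stationary_optimal_exists by metis
  show thesis using that[of "\<lambda>_. \<phi>"] \<phi> stationary_optimal[OF \<phi>(1)] infinity by simp
qed

lemma mdp_opt_value_shift: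
  assumes z: "z \<in> topspace TS"
  shows "mdp_opt_value S AM p c \<alpha> T z = enn2ereal (vT T z) + ereal (shift T)"
  unfolding mdp_opt_value_def
proof (rule antisym)
  obtain \<phi> where \<phi>: "\<And>t. \<phi> t \<in> S \<rightarrow>\<^sub>M AM" "VT T (markov_policy AM \<phi>) z = vT T z"
    using VT_attained[of T] z by metis
  have \<delta>: "markov_policy AM \<phi> \<in> policies S AM" using \<phi>(1) by (rule markov_policy_in_policies)
  show "(INF \<delta>\<in>policies S AM. mdp_value S AM p c \<alpha> T \<delta> z) \<le> enn2ereal (vT T z) + ereal (shift T)"
    by (rule INF_lower2[OF \<delta>]) (simp add: mdp_value_shift[OF \<delta> z] \<phi>(2))
  show "enn2ereal (vT T z) + ereal (shift T) \<le> (INF \<delta>\<in>policies S AM. mdp_value S AM p c \<alpha> T \<delta> z)"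
    using z by (intro INF_greatest) (simp add: mdp_value_shift VT_lower_bound)
qed

lemma mdp_optimal_iff:
  "mdp_optimal S AM p c \<alpha> T \<delta> \<longleftrightarrow>
     \<delta> \<in> policies S AM \<and> (\<forall>z\<in>topspace TS. VT T \<delta> z = vT T z)"
  unfolding mdp_optimal_def by (auto simp: mdp_value_shift mdp_opt_value_shift)

lemma bellman_shift:
  assumes z: "z \<in> topspace TS" "a \<in> A" and u: "u \<in> borel_measurable S" and \<beta>: "\<beta> \<le> 0"
    and w: "\<And>z. z \<in> topspace TS \<Longrightarrow> w z = enn2ereal (u z) + ereal \<beta>"
  shows "c (z, a) + ereal \<alpha> * ereal_integral (p (z, a)) w = enn2ereal (Q u (z, a)) + ereal (b + \<alpha> * \<beta>)"
proof -
  have P: "p (z, a) \<in> space (prob_algebra S)" using z by (intro p_in) auto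
  then have P': "prob_space (p (z, a))" "sets (p (z, a)) = sets S" "space (p (z, a)) = topspace TS"
    by (auto simp: space_prob_algebra dest: sets_eq_imp_space_eq)
  have "ereal_integral (p (z, a)) w = ereal_integral (p (z, a)) (\<lambda>z. enn2ereal (u z) + ereal \<beta>)"
    using P' w by (intro ereal_integral_cong) auto
  also have "\<dots> = enn2ereal (\<integral>\<^sup>+z. u z \<partial>p (z, a)) + ereal \<beta>"
    using P' u \<beta> by (intro ereal_integral_shift) (auto simp: measurable_cong_sets[OF P'(2) refl])
  finally have "c (z, a) + ereal \<alpha> * ereal_integral (p (z, a)) w = (enn2ereal (C (z, a)) + ereal b) +
      (enn2ereal (ennreal \<alpha> * (\<integral>\<^sup>+z. u z \<partial>p (z, a))) + ereal (\<alpha> * \<beta>))"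
    by (simp only: c[OF z] ereal_mult_shift[OF \<alpha>])
  then show ?thesis
    by (simp add: Q_def plus_ennreal.rep_eq ac_simps flip: plus_ereal.simps(1))
qed

lemma opt_value_LIMSEQ:
  assumes z: "z \<in> topspace TS"
  shows "(\<lambda>n. mdp_opt_value S AM p c \<alpha> (enat n) z) \<longlonglongrightarrow> mdp_opt_value S AM p c \<alpha> \<infinity> z"
proof -
  have "(\<lambda>n. v n z) \<longlonglongrightarrow> v_inf z"
    unfolding v_inf_def using v_mono[OF z] by (intro LIMSEQ_SUP incseq_SucI)
  then have "(\<lambda>n. enn2ereal (v n z) + ereal (shift (enat n))) \<longlonglongrightarrow> enn2ereal (v_inf z) + ereal (shift \<infinity>)"
    by (intro tendsto_add_ereal_general tendsto_enn2erealI) (auto intro: shift_LIMSEQ)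
  then show ?thesis using z by (simp add: mdp_opt_value_shift)
qed

text \<open>\<open>u\<close> dominates the cost of a minimizing action, so its sublevel sets are closed subsets of projections of
  compact sublevel sets of the cost.\<close>

lemma sublevel_compact:
  assumes ic: "inf_compact (prod_topology TS (top_of_set A)) c"
    and u: "seq_lsc TS u" and dominated: "\<And>z. z \<in> topspace TS \<Longrightarrow> T_op w z \<le> u z" and w: "seq_lsc TS w"
    and f: "\<And>z. z \<in> topspace TS \<Longrightarrow> f z = enn2ereal (u z) + ereal \<beta>"
  shows "inf_compact TS f"
  unfolding inf_compact_def
proof
  fix l :: real
  have eq: "{z \<in> topspace TS. f z \<le> ereal l} = {z \<in> topspace TS. enn2ereal (u z) + ereal \<beta> \<le> ereal l}"
    using f by auto
  have cl: "closedin TS {z \<in> topspace TS. f z \<le> ereal l}"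
  proof (cases "\<beta> \<le> l")
    case True
    then show ?thesis unfolding eq shift_le_real_iff using seq_lsc_sublevel_closed[OF TS u] by simp
  next
    case False
    then show ?thesis unfolding eq shift_le_real_iff by simp
  qed
  let ?K = "{s \<in> topspace (prod_topology TS (top_of_set A)). c s \<le> ereal (l - \<beta> + b)}"
  have "compactin TS (fst ` ?K)"
    using ic unfolding inf_compact_def
    by (intro image_compactin[OF _ continuous_map_fst[of TS "top_of_set A"]]) blast
  moreover have "{z \<in> topspace TS. f z \<le> ereal l} \<subseteq> fst ` ?K"
  proof
    fix z assume z: "z \<in> {z \<in> topspace TS. f z \<le> ereal l}"
    then have le: "\<beta> \<le> l" "u z \<le> ennreal (l - \<beta>)" by (auto simp: f shift_le_real_iff)
    obtain a where a: "a \<in> A" "Q w (z, a) = T_op w z" using T_op_attained[OF w, of z] z by blast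
    have "C (z, a) \<le> Q w (z, a)" by (simp add: Q_def add_increasing2)
    also have "\<dots> \<le> ennreal (l - \<beta>)" using a(2) dominated[of z] z le(2) by auto
    finally have "c (z, a) \<le> ereal (l - \<beta> + b)"
      using c[of z a] z a le by (simp add: shift_le_real_iff)
    then show "z \<in> fst ` ?K" using z a by (intro image_eqI[of _ _ "(z, a)"]) auto
  qed
  ultimately show "compactin TS {z \<in> topspace TS. f z \<le> ereal l}"
    using cl by (rule closed_compactin)
qed

lemma K_inf_compact_cost: "K_inf_compact TS (top_of_set A) c"
  unfolding K_inf_compact_def inf_compact_def
proof (intro allI impI)
  fix K and l :: real assume K: "compactin TS K"
  then have KS: "K \<subseteq> topspace TS" by (rule compactin_subset_topspace)
  let ?T = "prod_topology (subtopology TS K) (top_of_set A)"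
  let ?S = "{s \<in> topspace ?T. c s \<le> ereal l}"
  have "metrizable_space ?T"
    using metrizable_space_subtopology[OF TS, of K] metrizable_euclidean_subspace[of A]
    by (simp add: metrizable_space_prod_topology)
  then show "compactin ?T ?S"
  proof (rule compactin_metrizable_sequentially[THEN iffD2], intro conjI allI impI)
    fix s :: "nat \<Rightarrow> 'a \<times> 'b" assume s: "\<forall>n. s n \<in> ?S"
    define z a where "z n = fst (s n)" and "a n = snd (s n)" for n
    have za: "z n \<in> K" "z n \<in> topspace TS" "a n \<in> A" "c (z n, a n) \<le> ereal l" for n
      using s KS by (auto simp: z_def a_def mem_Times_iff)
    then have "enn2ereal (C (z n, a n)) + ereal b \<le> ereal l" for n using c[of "z n" "a n"] by metis
    then have bl: "b \<le> l" and Cl: "C (z n, a n) \<le> ennreal (l - b)" for n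
      by (auto simp: shift_le_real_iff)
    obtain z0 r where r: "z0 \<in> K" "strict_mono r" "limitin TS (z \<circ> r) z0 sequentially"
      using K za(1) unfolding compactin_metrizable_sequentially[OF TS] by blast
    have lim: "limitin TS (\<lambda>n. z (r n)) z0 sequentially" using r(3) by (simp add: comp_def)
    have "\<exists>r' a0. strict_mono (r' :: nat \<Rightarrow> nat) \<and> a0 \<in> A \<and> (\<lambda>n. a (r (r' n))) \<longlonglongrightarrow> a0"
      using za Cl by (intro C_proper[OF _ lim])
    then obtain r' a0 where r': "strict_mono (r' :: nat \<Rightarrow> nat)" "a0 \<in> A" "(\<lambda>n. a (r (r' n))) \<longlonglongrightarrow> a0"
      by blast
    have lim': "limitin TS (\<lambda>n. z (r (r' n))) z0 sequentially"
      using limitin_compose_filterlim[OF lim filterlim_subseq[OF r'(1)]] .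
    have "C (z0, a0) \<le> liminf (\<lambda>n. C (z (r (r' n)), a (r (r' n))))"
      using za r' by (intro C_lsc[OF _ lim']) auto
    also have "\<dots> \<le> liminf (\<lambda>n. ennreal (l - b))" using Cl by (intro Liminf_mono) auto
    finally have "C (z0, a0) \<le> ennreal (l - b)" by (simp add: Liminf_const)
    then have "c (z0, a0) \<le> ereal l"
      using r(1) KS r'(2) bl by (subst c) (auto simp: shift_le_real_iff)
    then have in_S: "(z0, a0) \<in> ?S" using r(1) KS r'(2) by auto
    have "limitin ?T (s \<circ> (r \<circ> r')) (z0, a0) sequentially"
      unfolding limitin_pairwise comp_def fst_conv snd_conv
      using lim' r' za r(1) by (simp add: limitin_subtopology z_def[symmetric] a_def[symmetric])
    moreover have "strict_mono (r \<circ> r')" using r(2) r'(1) by (simp add: strict_mono_def)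
    ultimately show "\<exists>l' r. l' \<in> ?S \<and> strict_mono r \<and> limitin ?T (s \<circ> r) l' sequentially"
      using in_S by blast
  qed auto
qed

end

section \<open>The filter and its transition kernel\<close>

lemma sets_belief_borel:
  fixes X :: "'x::polish_space set"
  shows "sets (borel_of (belief_topology X)) = sets (prob_algebra (borel_on X))"
  by (rule sets_borel_of_weak_topology[OF metrizable_euclidean_subspace second_countable_euclidean_subspace])

lemma metrizable_beliefs: "metrizable_space (belief_topology (X :: 'x::polish_space set))"
  by (rule metrizable_weak_topology[OF metrizable_euclidean_subspace second_countable_euclidean_subspace])

locale pomdp_kernels =
  fixes X :: "'x::polish_space set" and Y :: "'y::polish_space set" and A :: "'a::polish_space set"
    and P :: "'x \<times> 'a \<Rightarrow> 'x measure" and Q :: "'a \<times> 'x \<Rightarrow> 'y measure"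
  assumes P [measurable]: "P \<in> borel_on X \<Otimes>\<^sub>M borel_on A \<rightarrow>\<^sub>M prob_algebra (borel_on X)"
    and Q [measurable]: "Q \<in> borel_on A \<Otimes>\<^sub>M borel_on X \<rightarrow>\<^sub>M prob_algebra (borel_on Y)"
begin

abbreviation "BX \<equiv> borel_of (belief_topology X)"
abbreviation "R \<equiv> obs_kernel X Y P Q"

lemma belief_measurable [measurable]: "(\<lambda>z. z) \<in> BX \<rightarrow>\<^sub>M prob_algebra (borel_on X)"
  by (rule measurable_ident_sets) (rule sets_belief_borel)

lemma P_in: "x \<in> X \<Longrightarrow> a \<in> A \<Longrightarrow> P (x, a) \<in> beliefs X"
  using measurable_space[OF P, of "(x, a)"] by (simp add: space_pair_measure)

lemma Q_in: "x \<in> X \<Longrightarrow> a \<in> A \<Longrightarrow> Q (a, x) \<in> prob_measures (top_of_set Y)"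
  using measurable_space[OF Q, of "(a, x)"] by (simp add: space_pair_measure)

lemma joint_kernel_measurable:
  "joint_kernel X Y P Q \<in> BX \<Otimes>\<^sub>M borel_on A \<rightarrow>\<^sub>M prob_algebra (borel_on X \<Otimes>\<^sub>M borel_on Y)"
  unfolding joint_kernel_def by measurable

lemma obs_kernel_measurable [measurable]: "R \<in> BX \<Otimes>\<^sub>M borel_on A \<rightarrow>\<^sub>M prob_algebra (borel_on Y)"
  unfolding obs_kernel_def
  by (rule measurable_compose[OF joint_kernel_measurable measurable_distr_prob_space]) simp

lemma R_in: "z \<in> beliefs X \<Longrightarrow> a \<in> A \<Longrightarrow> R (z, a) \<in> prob_measures (top_of_set Y)"
  using measurable_space[OF obs_kernel_measurable, of "(z, a)"] by (simp add: space_pair_measure)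

lemma nn_integral_obs_kernel:
  assumes z: "z \<in> beliefs X" and a: "a \<in> A" and f [measurable]: "f \<in> borel_measurable (borel_on Y)"
  shows "(\<integral>\<^sup>+y. f y \<partial>R (z, a)) = (\<integral>\<^sup>+x. (\<integral>\<^sup>+x'. (\<integral>\<^sup>+y. f y \<partial>Q (a, x')) \<partial>P (x, a)) \<partial>z)"
proof -
  let ?N = "borel_on X \<Otimes>\<^sub>M borel_on Y"
  let ?K2 = "\<lambda>x'. Q (a, x') \<bind> (\<lambda>y. return ?N (x', y))"
  let ?K1 = "\<lambda>x. P (x, a) \<bind> ?K2"
  have a' [measurable]: "a \<in> space (borel_on A)" using a by simp
  have K2 [measurable]: "?K2 \<in> borel_on X \<rightarrow>\<^sub>M prob_algebra ?N" by measurable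
  have K1 [measurable]: "?K1 \<in> borel_on X \<rightarrow>\<^sub>M prob_algebra ?N" by measurable
  have g [measurable]: "(\<lambda>s. f (snd s)) \<in> borel_measurable ?N" by measurable
  note zP = prob_measuresD[OF z]
  have "joint_kernel X Y P Q (z, a) \<in> space (prob_algebra ?N)"
    using measurable_space[OF joint_kernel_measurable, of "(z, a)"] z a by (simp add: space_pair_measure)
  then have J: "sets (joint_kernel X Y P Q (z, a)) = sets ?N" by (simp add: space_prob_algebra)
  have "(\<integral>\<^sup>+y. f y \<partial>R (z, a)) = (\<integral>\<^sup>+s. f (snd s) \<partial>joint_kernel X Y P Q (z, a))"
    unfolding obs_kernel_def by (rule nn_integral_distr) (simp_all add: measurable_cong_sets[OF J refl])
  also have "\<dots> = (\<integral>\<^sup>+x. (\<integral>\<^sup>+s. f (snd s) \<partial>?K1 x) \<partial>z)"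
    unfolding joint_kernel_def prod.case
    by (rule nn_integral_bind[OF g]) (simp add: measurable_cong_sets[OF zP(2) refl] measurable_prob_algebraD[OF K1])
  also have "\<dots> = (\<integral>\<^sup>+x. (\<integral>\<^sup>+x'. (\<integral>\<^sup>+y. f y \<partial>Q (a, x')) \<partial>P (x, a)) \<partial>z)"
  proof (rule nn_integral_cong)
    fix x assume "x \<in> space z"
    then have x: "x \<in> X" using zP by simp
    note xP = prob_measuresD[OF P_in[OF x a]]
    have "(\<integral>\<^sup>+s. f (snd s) \<partial>?K1 x) = (\<integral>\<^sup>+x'. (\<integral>\<^sup>+s. f (snd s) \<partial>?K2 x') \<partial>P (x, a))"
      by (rule nn_integral_bind[OF g]) (simp add: measurable_cong_sets[OF xP(2) refl] measurable_prob_algebraD[OF K2])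
    also have "\<dots> = (\<integral>\<^sup>+x'. (\<integral>\<^sup>+y. f y \<partial>Q (a, x')) \<partial>P (x, a))"
    proof (rule nn_integral_cong)
      fix x' assume "x' \<in> space (P (x, a))"
      then have x': "x' \<in> X" using xP by simp
      note yP = prob_measuresD[OF Q_in[OF x' a]]
      have "(\<integral>\<^sup>+s. f (snd s) \<partial>?K2 x') = (\<integral>\<^sup>+y. (\<integral>\<^sup>+s. f (snd s) \<partial>return ?N (x', y)) \<partial>Q (a, x'))"
        using x' by (intro nn_integral_bind[OF g]) (simp add: measurable_cong_sets[OF yP(2) refl])
      also have "\<dots> = (\<integral>\<^sup>+y. f y \<partial>Q (a, x'))"
        using x' yP by (intro nn_integral_cong) (simp add: nn_integral_return space_pair_measure)
      finally show "(\<integral>\<^sup>+s. f (snd s) \<partial>?K2 x') = (\<integral>\<^sup>+y. f y \<partial>Q (a, x'))" .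
    qed
    finally show "(\<integral>\<^sup>+s. f (snd s) \<partial>?K1 x) = (\<integral>\<^sup>+x'. (\<integral>\<^sup>+y. f y \<partial>Q (a, x')) \<partial>P (x, a))" .
  qed
  finally show ?thesis .
qed

lemma filter_kernel_measurable:
  assumes H: "filter_kernel X Y A P Q H"
  shows "H \<in> BX \<Otimes>\<^sub>M borel_on A \<Otimes>\<^sub>M borel_on Y \<rightarrow>\<^sub>M BX"
  using H unfolding filter_kernel_def measurable_cong_sets[OF refl sets_belief_borel] by blast

lemma filter_section_measurable:
  assumes H: "filter_kernel X Y A P Q H" and z: "z \<in> beliefs X" and a: "a \<in> A"
  shows "(\<lambda>y. H (z, a, y)) \<in> borel_on Y \<rightarrow>\<^sub>M BX"
proof -
  note [measurable] = filter_kernel_measurable[OF H]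
  have [measurable]: "z \<in> space BX" "a \<in> space (borel_on A)" using z a by auto
  show ?thesis by measurable
qed

lemma filter_in:
  assumes H: "filter_kernel X Y A P Q H" and "z \<in> beliefs X" "a \<in> A" "y \<in> Y"
  shows "H (z, a, y) \<in> beliefs X"
  using measurable_space[OF filter_section_measurable[OF assms(1-3)], of y] assms(4) by simp

lemma comdp_kernel_measurable:
  assumes H: "filter_kernel X Y A P Q H"
  shows "comdp_kernel X Y P Q H \<in> BX \<Otimes>\<^sub>M borel_on A \<rightarrow>\<^sub>M prob_algebra BX"
proof -
  note [measurable] = filter_kernel_measurable[OF H]
  show ?thesis unfolding comdp_kernel_def by measurable
qed

lemma nn_integral_comdp_kernel:
  assumes H: "filter_kernel X Y A P Q H" and z: "z \<in> beliefs X" and a: "a \<in> A"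
    and u: "u \<in> borel_measurable BX"
  shows "(\<integral>\<^sup>+z'. u z' \<partial>comdp_kernel X Y P Q H (z, a)) = (\<integral>\<^sup>+y. u (H (z, a, y)) \<partial>R (z, a))"
proof -
  have "(\<lambda>y. H (z, a, y)) \<in> R (z, a) \<rightarrow>\<^sub>M BX"
    using filter_section_measurable[OF H z a]
    by (simp only: measurable_cong_sets[OF prob_measuresD(2)[OF R_in[OF z a]] refl])
  from nn_integral_distr[OF this, of u] u show ?thesis
    unfolding comdp_kernel_def prod.case by simp
qed

text \<open>The filtering equation determines \<open>H (B | z, a, y)\<close> up to a null set for each \<open>B\<close>; a countable
  generator makes the null set independent of \<open>B\<close>. Hence the transition kernel of the filter does not depend
  on the choice of \<open>H\<close>, and its continuity may be proved with the version that has the continuity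
  properties.\<close>

lemma filter_kernel_unique_AE:
  assumes H: "filter_kernel X Y A P Q H" and H': "filter_kernel X Y A P Q H'"
    and z: "z \<in> beliefs X" and a: "a \<in> A"
  shows "AE y in R (z, a). H (z, a, y) = H' (z, a, y)"
proof -
  note RP = prob_measuresD[OF R_in[OF z a]]
  interpret prob_space "R (z, a)" by (rule RP(1))
  obtain E where E: "countable E" "Int_stable E" "E \<subseteq> Pow X" "X \<in> E" "sets (borel_on X) = sigma_sets X E"
    by (rule countable_generator_borel_of[OF second_countable_euclidean_subspace[of X]]) (simp add: that)
  have "AE y in R (z, a). emeasure (H (z, a, y)) B = emeasure (H' (z, a, y)) B" if B: "B \<in> E" for B
  proof (rule density_unique2)
    have B': "B \<in> sets (borel_on X)" using B E(5) by (auto intro: sigma_sets.Basic)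
    have meas: "(\<lambda>y. emeasure (K (z, a, y)) B) \<in> borel_measurable (R (z, a))"
      if "filter_kernel X Y A P Q K" for K
    proof -
      have "(\<lambda>y. K (z, a, y)) \<in> borel_on Y \<rightarrow>\<^sub>M prob_algebra (borel_on X)"
        using filter_section_measurable[OF that z a] by (simp add: measurable_cong_sets[OF refl sets_belief_borel])
      from measurable_compose[OF measurable_prob_algebraD[OF this] measurable_emeasure_subprob_algebra[OF B']]
      show ?thesis by (simp add: measurable_cong_sets[OF RP(2) refl])
    qed
    show "(\<lambda>y. emeasure (H (z, a, y)) B) \<in> borel_measurable (R (z, a))"
      "(\<lambda>y. emeasure (H' (z, a, y)) B) \<in> borel_measurable (R (z, a))"
      using meas H H' by auto
    fix C assume "C \<in> sets (R (z, a))"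
    then have "C \<in> sets (borel_on Y)" using RP by simp
    then show "(\<integral>\<^sup>+y\<in>C. emeasure (H (z, a, y)) B \<partial>R (z, a)) = (\<integral>\<^sup>+y\<in>C. emeasure (H' (z, a, y)) B \<partial>R (z, a))"
      using z a B' H[unfolded filter_kernel_def, THEN conjunct2, rule_format, of z a B C]
        H'[unfolded filter_kernel_def, THEN conjunct2, rule_format, of z a B C] by simp
  qed
  then have "AE y in R (z, a). \<forall>B\<in>E. emeasure (H (z, a, y)) B = emeasure (H' (z, a, y)) B"
    using E(1) by (subst AE_ball_countable) auto
  then show ?thesis
  proof (rule AE_mp, intro AE_I2 impI)
    fix y assume y: "y \<in> space (R (z, a))" and eq: "\<forall>B\<in>E. emeasure (H (z, a, y)) B = emeasure (H' (z, a, y)) B"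
    have y': "y \<in> Y" using y RP by simp
    note HP = prob_measuresD[OF filter_in[OF H z a y']] and HP' = prob_measuresD[OF filter_in[OF H' z a y']]
    show "H (z, a, y) = H' (z, a, y)"
    proof (rule measure_eqI_generator_eq[OF E(2,3), where A="\<lambda>_. X"])
      show "emeasure (H (z, a, y)) X \<noteq> \<infinity>"
        using prob_space.emeasure_space_1[OF HP(1)] HP(3) by simp
    qed (use eq E HP HP' in auto)
  qed
qed

lemma comdp_kernel_unique:
  assumes H: "filter_kernel X Y A P Q H" and H': "filter_kernel X Y A P Q H'"
    and z: "z \<in> beliefs X" and a: "a \<in> A"
  shows "comdp_kernel X Y P Q H (z, a) = comdp_kernel X Y P Q H' (z, a)"
proof -
  have "(\<lambda>y. H (z, a, y)) \<in> R (z, a) \<rightarrow>\<^sub>M BX" "(\<lambda>y. H' (z, a, y)) \<in> R (z, a) \<rightarrow>\<^sub>M BX"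
    using filter_section_measurable[OF H z a] filter_section_measurable[OF H' z a]
    by (simp_all only: measurable_cong_sets[OF prob_measuresD(2)[OF R_in[OF z a]] refl])
  then show ?thesis
    unfolding comdp_kernel_def prod.case
    by (intro distr_cong_AE[OF refl refl filter_kernel_unique_AE[OF assms]])
qed

text \<open>Fatou's lemma for weak convergence is applied to the three integrals over \<open>y\<close>, \<open>x'\<close> and \<open>x\<close> in turn; each
  application provides the lower semicontinuity of the integrand that the next one needs.\<close>

lemma obs_kernel_weakly_continuous:
  assumes Pc: "weakly_continuous (prod_topology (top_of_set X) (top_of_set A)) (top_of_set X) P"
    and Qc: "weakly_continuous (prod_topology (top_of_set A) (top_of_set X)) (top_of_set Y) Q"
    and z: "\<And>n. z n \<in> beliefs X" "limitin (belief_topology X) z z\<^sub>0 sequentially"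
    and a: "\<And>n. a n \<in> A" "a\<^sub>0 \<in> A" "a \<longlonglongrightarrow> a\<^sub>0"
  shows "limitin (weak_topology (top_of_set Y)) (\<lambda>n. R (z n, a n)) (R (z\<^sub>0, a\<^sub>0)) sequentially"
proof (rule limitin_weak_topology_liminfI)
  have z0: "z\<^sub>0 \<in> beliefs X" using limitin_topspace[OF z(2)] by simp
  show "R (z n, a n) \<in> prob_measures (top_of_set Y)" for n using z a by (intro R_in)
  show "R (z\<^sub>0, a\<^sub>0) \<in> prob_measures (top_of_set Y)" using z0 a by (intro R_in)
  fix f assume f: "continuous_map (top_of_set Y) euclideanreal f"
  have fm: "(\<lambda>y. ennreal (f y)) \<in> borel_measurable (borel_on Y)"
    using continuous_map_borel_of[OF f] by simp
  have al: "(\<lambda>n. a (r n)) \<longlonglongrightarrow> a\<^sub>0" if "filterlim r sequentially sequentially" for r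
    using filterlim_compose[OF a(3) that] .
  let ?g = "\<lambda>a x'. \<integral>\<^sup>+y. ennreal (f y) \<partial>Q (a, x')"
  have 1: "?g a\<^sub>0 x \<le> liminf (\<lambda>n. ?g (a (r n)) (s n))"
    if r: "filterlim r sequentially sequentially" and s: "\<And>n. s n \<in> X" "limitin (top_of_set X) s x sequentially"
    for r s x
  proof (rule fatou_weak_convergence[OF metrizable_euclidean_subspace[of Y]])
    show "Q (a (r n), s n) \<in> prob_measures (top_of_set Y)" for n using s a by (intro Q_in)
    have "limitin (prod_topology (top_of_set A) (top_of_set X)) (\<lambda>n. (a (r n), s n)) (a\<^sub>0, x) sequentially"
      unfolding limitin_pairwise comp_def fst_conv snd_conv
      using al[OF r] a s by (simp add: limitin_top_of_set)
    then show "limitin (weak_topology (top_of_set Y)) (\<lambda>n. Q (a (r n), s n)) (Q (a\<^sub>0, x)) sequentially"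
      using Qc[unfolded weakly_continuous_def, rule_format, of "\<lambda>n. (a (r n), s n)" "(a\<^sub>0, x)"] a s by simp
  qed (use seq_lsc_ennreal_continuous[OF f] in \<open>auto simp: seq_lsc_def\<close>)
  let ?h = "\<lambda>a x. \<integral>\<^sup>+x'. ?g a x' \<partial>P (x, a)"
  have 2: "?h a\<^sub>0 x \<le> liminf (\<lambda>n. ?h (a (r n)) (s n))"
    if r: "filterlim r sequentially sequentially" and s: "\<And>n. s n \<in> X" "limitin (top_of_set X) s x sequentially"
    for r s x
  proof (rule fatou_weak_convergence[OF metrizable_euclidean_subspace[of X]])
    show "P (s n, a (r n)) \<in> prob_measures (top_of_set X)" for n using s a by (intro P_in)
    have "limitin (prod_topology (top_of_set X) (top_of_set A)) (\<lambda>n. (s n, a (r n))) (x, a\<^sub>0) sequentially"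
      unfolding limitin_pairwise comp_def fst_conv snd_conv
      using al[OF r] a s by (simp add: limitin_top_of_set)
    then show "limitin (weak_topology (top_of_set X)) (\<lambda>n. P (s n, a (r n))) (P (x, a\<^sub>0)) sequentially"
      using Pc[unfolded weakly_continuous_def, rule_format, of "\<lambda>n. (s n, a (r n))" "(x, a\<^sub>0)"] a s by simp
    fix r' :: "nat \<Rightarrow> nat" and s' x'
    assume "filterlim r' sequentially sequentially" "\<And>n. s' n \<in> topspace (top_of_set X)"
      "limitin (top_of_set X) s' x' sequentially"
    then show "?g a\<^sub>0 x' \<le> liminf (\<lambda>n. ?g (a (r (r' n))) (s' n))"
      using filterlim_compose[OF r] by (intro 1) auto
  qed
  have "(\<integral>\<^sup>+x. ?h a\<^sub>0 x \<partial>z\<^sub>0) \<le> liminf (\<lambda>n. \<integral>\<^sup>+x. ?h (a n) x \<partial>z n)"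
    using 2 by (intro fatou_weak_convergence[OF metrizable_euclidean_subspace[of X] z]) auto
  then show "(\<integral>\<^sup>+y. ennreal (f y) \<partial>R (z\<^sub>0, a\<^sub>0)) \<le> liminf (\<lambda>n. \<integral>\<^sup>+y. ennreal (f y) \<partial>R (z n, a n))"
    using z a z0 fm by (simp add: nn_integral_obs_kernel)
qed

text \<open>The integral of \<open>f (H' (z, a, y))\<close> over \<open>y\<close> is split into \<open>Y1\<close> and \<open>Y2\<close>. On \<open>Y1\<close> the integrand,
  extended by \<open>0\<close>, is lower semicontinuous jointly in \<open>(z, a, y)\<close> because \<open>Y1\<close> is open and \<open>f \<ge> 0\<close>, and the
  observation laws converge weakly. On \<open>Y2\<close> they converge setwise, and the integrands converge
  almost everywhere along a subsequence.\<close>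

lemma comdp_kernel_weakly_continuous:
  assumes H: "filter_kernel X Y A P Q H" and H': "filter_kernel X Y A P Q H'"
    and partition: "Y1 \<union> Y2 = Y" "Y1 \<inter> Y2 = {}" "openin (top_of_set Y) Y1"
    and Pc: "weakly_continuous (prod_topology (top_of_set X) (top_of_set A)) (top_of_set X) P"
    and Qc: "weakly_continuous (prod_topology (top_of_set A) (top_of_set X)) (top_of_set Y) Q"
    and setwise: "\<And>z a z\<^sub>0 a\<^sub>0 C.
      \<lbrakk>\<And>n. z n \<in> beliefs X; \<And>n. a n \<in> A;
       limitin (prod_topology (belief_topology X) (top_of_set A))
         (\<lambda>n. (z n, a n)) (z\<^sub>0, a\<^sub>0) sequentially;
       C \<in> sets (borel_on Y2)\<rbrakk> \<Longrightarrow>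
      (\<lambda>n. measure (R (z n, a n)) C) \<longlonglongrightarrow> measure (R (z\<^sub>0, a\<^sub>0)) C"
    and H1: "weakly_continuous
        (prod_topology (belief_topology X) (prod_topology (top_of_set A) (top_of_set Y1))) (top_of_set X) H'"
    and H2: "\<And>z a z\<^sub>0 a\<^sub>0. \<lbrakk>\<And>n. z n \<in> beliefs X; z\<^sub>0 \<in> beliefs X; limitin (belief_topology X) z z\<^sub>0 sequentially;
         \<And>n. a n \<in> A; a\<^sub>0 \<in> A; a \<longlonglongrightarrow> a\<^sub>0\<rbrakk> \<Longrightarrow>
         \<exists>(r :: nat \<Rightarrow> nat) C. strict_mono r \<and> C \<in> sets (borel_on Y2) \<and>
            measure (R (z\<^sub>0, a\<^sub>0)) (Y2 - C) = 0 \<and>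
            (\<forall>y\<in>C. limitin (belief_topology X) (\<lambda>k. H' (z (r k), a (r k), y)) (H' (z\<^sub>0, a\<^sub>0, y)) sequentially)"
    and z: "\<And>n. z n \<in> beliefs X" "limitin (belief_topology X) z z\<^sub>0 sequentially"
    and a: "\<And>n. a n \<in> A" "a\<^sub>0 \<in> A" "a \<longlonglongrightarrow> a\<^sub>0"
  shows "limitin (weak_topology (belief_topology X)) (\<lambda>n. comdp_kernel X Y P Q H (z n, a n))
    (comdp_kernel X Y P Q H (z\<^sub>0, a\<^sub>0)) sequentially"
proof -
  let ?q = "comdp_kernel X Y P Q H'"
  have z0: "z\<^sub>0 \<in> beliefs X" using limitin_topspace[OF z(2)] by simp
  have q_in: "?q (z, a) \<in> prob_measures (belief_topology X)" if "z \<in> beliefs X" "a \<in> A" for z a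
    using measurable_space[OF comdp_kernel_measurable[OF H'], of "(z, a)"] that by (simp add: space_pair_measure)
  have Y1: "Y1 \<in> sets (borel_on Y)" using partition(3) by (rule openin_in_borel_of)
  have Y2: "Y2 \<in> sets (borel_on Y)"
  proof -
    have "Y2 = space (borel_on Y) - Y1" using partition by auto
    then show ?thesis using Y1 by (metis sets.compl_sets)
  qed
  have Y2_sets: "C \<in> sets (borel_on Y2)" if "C \<in> sets (borel_on Y)" "C \<subseteq> Y2" for C
  proof -
    obtain B where B: "B \<in> sets borel" "C = Y \<inter> B"
      using \<open>C \<in> sets (borel_on Y)\<close> by (auto simp: sets_borel_on sets_restrict_space)
    then have "C = Y2 \<inter> B" using that(2) partition by auto
    then show ?thesis using B(1) by (auto simp: sets_borel_on sets_restrict_space)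
  qed
  have Y2_sets': "C \<in> sets (borel_on Y)" "C \<subseteq> Y2" if C: "C \<in> sets (borel_on Y2)" for C
  proof -
    obtain B where B: "B \<in> sets borel" "C = Y2 \<inter> B"
      using C by (auto simp: sets_borel_on sets_restrict_space)
    have "Y \<inter> B \<in> sets (borel_on Y)" using B(1) by (auto simp: sets_borel_on sets_restrict_space)
    then have "Y2 \<inter> (Y \<inter> B) \<in> sets (borel_on Y)" using Y2 by blast
    moreover have "C = Y2 \<inter> (Y \<inter> B)" using B partition by auto
    ultimately show "C \<in> sets (borel_on Y)" "C \<subseteq> Y2" by auto
  qed
  have "limitin (weak_topology (belief_topology X)) (\<lambda>n. ?q (z n, a n)) (?q (z\<^sub>0, a\<^sub>0)) sequentially"
  proof (rule limitin_if_subsequences)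
    show "?q (z\<^sub>0, a\<^sub>0) \<in> topspace (weak_topology (belief_topology X))" using q_in z0 a by simp
    fix r :: "nat \<Rightarrow> nat" assume r: "strict_mono r"
    have "\<exists>(r' :: nat \<Rightarrow> nat) C. strict_mono r' \<and> C \<in> sets (borel_on Y2) \<and>
            measure (R (z\<^sub>0, a\<^sub>0)) (Y2 - C) = 0 \<and>
            (\<forall>y\<in>C. limitin (belief_topology X) (\<lambda>k. H' (z (r (r' k)), a (r (r' k)), y)) (H' (z\<^sub>0, a\<^sub>0, y)) sequentially)"
      using z a z0 limitin_compose_filterlim[OF z(2) filterlim_subseq[OF r]] filterlim_compose[OF a(3) filterlim_subseq[OF r]]
      by (intro H2) auto
    then obtain r' C where r': "strict_mono (r' :: nat \<Rightarrow> nat)" and C: "C \<in> sets (borel_on Y2)"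
      "measure (R (z\<^sub>0, a\<^sub>0)) (Y2 - C) = 0"
      "\<And>y. y \<in> C \<Longrightarrow> limitin (belief_topology X) (\<lambda>k. H' (z (r (r' k)), a (r (r' k)), y)) (H' (z\<^sub>0, a\<^sub>0, y)) sequentially"
      by blast
    have rr: "filterlim (\<lambda>n. r (r' n)) sequentially sequentially"
      using filterlim_compose[OF filterlim_subseq[OF r] filterlim_subseq[OF r']] .
    define z' where "z' n = z (r (r' n))" for n
    define a' where "a' n = a (r (r' n))" for n
    have z': "\<And>n. z' n \<in> beliefs X" "limitin (belief_topology X) z' z\<^sub>0 sequentially"
      using z limitin_compose_filterlim[OF z(2) rr] by (auto simp: z'_def[abs_def])
    have a': "\<And>n. a' n \<in> A" "a' \<longlonglongrightarrow> a\<^sub>0"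
      using a filterlim_compose[OF a(3) rr] by (auto simp: a'_def[abs_def])
    note RP = prob_measuresD[OF R_in[OF z0 a(2)]] and RP' = prob_measuresD[OF R_in[OF z'(1) a'(1)]]
    have "limitin (weak_topology (belief_topology X)) (\<lambda>n. ?q (z' n, a' n)) (?q (z\<^sub>0, a\<^sub>0)) sequentially"
    proof (rule limitin_weak_topology_liminfI)
      show "?q (z' n, a' n) \<in> prob_measures (belief_topology X)" for n using z' a' by (intro q_in)
      show "?q (z\<^sub>0, a\<^sub>0) \<in> prob_measures (belief_topology X)" using z0 a by (intro q_in)
      fix f assume f: "continuous_map (belief_topology X) euclideanreal f"
      have fm [measurable]: "(\<lambda>z. ennreal (f z)) \<in> borel_measurable BX" using continuous_map_borel_of[OF f] by simp
      have flsc: "seq_lsc (belief_topology X) (\<lambda>z. ennreal (f z))" using f by (rule seq_lsc_ennreal_continuous)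
      let ?F = "\<lambda>n y. ennreal (f (H' (z' n, a' n, y)))" and ?G = "\<lambda>y. ennreal (f (H' (z\<^sub>0, a\<^sub>0, y)))"
      have Fm: "?F n \<in> borel_measurable (borel_on Y)" for n
        using measurable_compose[OF filter_section_measurable[OF H' z'(1) a'(1)] fm] .
      have F0m: "?G \<in> borel_measurable (borel_on Y)"
        using measurable_compose[OF filter_section_measurable[OF H' z0 a(2)] fm] .
      have split: "(\<integral>\<^sup>+y. g y \<partial>\<rho>) = (\<integral>\<^sup>+y\<in>Y1. g y \<partial>\<rho>) + (\<integral>\<^sup>+y\<in>Y2. g y \<partial>\<rho>)"
        if "g \<in> borel_measurable (borel_on Y)" "sets \<rho> = sets (borel_on Y)" "space \<rho> = Y" for g :: "'y \<Rightarrow> ennreal" and \<rho>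
      proof -
        have "(\<integral>\<^sup>+y. g y \<partial>\<rho>) = (\<integral>\<^sup>+y. g y * indicator Y1 y + g y * indicator Y2 y \<partial>\<rho>)"
          using partition that(3) by (intro nn_integral_cong) (auto split: split_indicator)
        also have "\<dots> = (\<integral>\<^sup>+y\<in>Y1. g y \<partial>\<rho>) + (\<integral>\<^sup>+y\<in>Y2. g y \<partial>\<rho>)"
          using that Y1 Y2 by (intro nn_integral_add) (auto simp: measurable_cong_sets[OF that(2) refl])
        finally show ?thesis .
      qed
      have part1: "(\<integral>\<^sup>+y\<in>Y1. ?G y \<partial>R (z\<^sub>0, a\<^sub>0)) \<le> liminf (\<lambda>n. \<integral>\<^sup>+y\<in>Y1. ?F n y \<partial>R (z' n, a' n))"
      proof (rule fatou_weak_convergence[OF metrizable_euclidean_subspace[of Y]])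
        show "R (z' n, a' n) \<in> prob_measures (top_of_set Y)" for n using z' a' by (intro R_in)
        show "limitin (weak_topology (top_of_set Y)) (\<lambda>n. R (z' n, a' n)) (R (z\<^sub>0, a\<^sub>0)) sequentially"
          using Pc Qc z' a' a by (intro obs_kernel_weakly_continuous)
        fix \<rho> s y assume \<rho>: "filterlim \<rho> sequentially sequentially"
          and s: "\<And>n. s n \<in> topspace (top_of_set Y)" "limitin (top_of_set Y) s y sequentially"
        show "?G y * indicator Y1 y \<le> liminf (\<lambda>n. ?F (\<rho> n) (s n) * indicator Y1 (s n))"
        proof (cases "y \<in> Y1")
          case True
          have ev: "\<forall>\<^sub>F n in sequentially. s n \<in> Y1" using s(2) partition(3) True by (auto simp: limitin_def)
          then obtain N where N: "\<And>n. n \<ge> N \<Longrightarrow> s n \<in> Y1" by (auto simp: eventually_sequentially)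
          \<comment> \<open>drop the initial segment, on which \<open>s\<close> may leave \<open>Y1\<close>\<close>
          define s' where "s' n = s (n + N)" for n
          have s': "\<And>n. s' n \<in> Y1" "s' \<longlonglongrightarrow> y"
            using N s LIMSEQ_ignore_initial_segment[of s y N] by (auto simp: s'_def[abs_def] limitin_top_of_set)
          have \<rho>N: "filterlim (\<lambda>n. \<rho> (n + N)) sequentially sequentially"
            using filterlim_compose[OF \<rho> filterlim_add_const_nat_at_top] .
          have "limitin (prod_topology (belief_topology X) (prod_topology (top_of_set A) (top_of_set Y1)))
              (\<lambda>n. (z' (\<rho> (n + N)), a' (\<rho> (n + N)), s' n)) (z\<^sub>0, a\<^sub>0, y) sequentially"
            using limitin_compose_filterlim[OF z'(2) \<rho>N] filterlim_compose[OF a'(2) \<rho>N] s' True a a'(1)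
            unfolding limitin_pairwise comp_def fst_conv snd_conv by (simp add: limitin_top_of_set)
          then have lim: "limitin (belief_topology X) (\<lambda>n. H' (z' (\<rho> (n + N)), a' (\<rho> (n + N)), s' n)) (H' (z\<^sub>0, a\<^sub>0, y)) sequentially"
            using H1[unfolded weakly_continuous_def, rule_format, of "\<lambda>n. (z' (\<rho> (n + N)), a' (\<rho> (n + N)), s' n)" "(z\<^sub>0, a\<^sub>0, y)"]
              z' a' s' by simp
          have "H' (z' (\<rho> (n + N)), a' (\<rho> (n + N)), s' n) \<in> beliefs X" for n
            using z' a' s'(1)[of n] partition by (intro filter_in[OF H']) auto
          then have "?G y \<le> liminf (\<lambda>n. ?F (\<rho> (n + N)) (s' n))"
            using flsc lim unfolding seq_lsc_def by simp
          also have "\<dots> = liminf (\<lambda>n. ?F (\<rho> (n + N)) (s (n + N)) * indicator Y1 (s (n + N)))"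
            using s'(1) by (simp add: s'_def)
          also have "\<dots> = liminf (\<lambda>n. ?F (\<rho> n) (s n) * indicator Y1 (s n))"
            by (rule liminf_shift_k[of "\<lambda>n. ?F (\<rho> n) (s n) * indicator Y1 (s n)"])
          finally show ?thesis using True by simp
        qed simp
      qed
      have part2: "(\<integral>\<^sup>+y\<in>Y2. ?G y \<partial>R (z\<^sub>0, a\<^sub>0)) \<le> liminf (\<lambda>n. \<integral>\<^sup>+y\<in>Y2. ?F n y \<partial>R (z' n, a' n))"
      proof (rule fatou_setwise_convergence[OF RP'(2) RP(2) Y2])
        show "?F n \<in> borel_measurable (borel_on Y)" for n by (rule Fm)
        fix D assume "D \<in> sets (borel_on Y)" "D \<subseteq> Y2"
        then have "D \<in> sets (borel_on Y2)" by (rule Y2_sets)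
        moreover have "limitin (prod_topology (belief_topology X) (top_of_set A)) (\<lambda>n. (z' n, a' n)) (z\<^sub>0, a\<^sub>0) sequentially"
          unfolding limitin_pairwise comp_def fst_conv snd_conv
          using z' a' a by (simp add: limitin_top_of_set)
        ultimately have "(\<lambda>n. measure (R (z' n, a' n)) D) \<longlonglongrightarrow> measure (R (z\<^sub>0, a\<^sub>0)) D"
          using z' a' by (intro setwise)
        then have "(\<lambda>n. ennreal (measure (R (z' n, a' n)) D)) \<longlonglongrightarrow> ennreal (measure (R (z\<^sub>0, a\<^sub>0)) D)"
          by (rule tendsto_ennrealI)
        moreover have "finite_measure (R (z' n, a' n))" "finite_measure (R (z\<^sub>0, a\<^sub>0))" for n
          using RP(1) RP'(1) by (auto simp: prob_space_def)
        ultimately show "(\<lambda>n. emeasure (R (z' n, a' n)) D) \<longlonglongrightarrow> emeasure (R (z\<^sub>0, a\<^sub>0)) D"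
          by (simp add: finite_measure.emeasure_eq_measure)
      next
        have "finite_measure (R (z\<^sub>0, a\<^sub>0))" using RP(1) by (simp add: prob_space_def)
        then have "emeasure (R (z\<^sub>0, a\<^sub>0)) (Y2 - C) = 0"
          using C(2) by (simp add: finite_measure.emeasure_eq_measure)
        moreover have "Y2 - C \<in> sets (R (z\<^sub>0, a\<^sub>0))" using Y2 Y2_sets'[OF C(1)] RP by auto
        ultimately have "Y2 - C \<in> null_sets (R (z\<^sub>0, a\<^sub>0))" by (rule null_setsI)
        then have "AE y in R (z\<^sub>0, a\<^sub>0). y \<notin> Y2 - C" by (rule AE_not_in)
        then show "AE y in R (z\<^sub>0, a\<^sub>0). y \<in> Y2 \<longrightarrow> ?G y \<le> liminf (\<lambda>n. ?F n y)"
        proof (rule AE_mp, intro AE_I2 impI)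
          fix y assume "y \<notin> Y2 - C" "y \<in> Y2"
          then have y: "y \<in> C" by simp
          then have "y \<in> Y" using Y2_sets'[OF C(1)] partition by auto
          then have "H' (z' n, a' n, y) \<in> beliefs X" for n using z' a' by (intro filter_in[OF H'])
          moreover have "limitin (belief_topology X) (\<lambda>k. H' (z' k, a' k, y)) (H' (z\<^sub>0, a\<^sub>0, y)) sequentially"
            using C(3)[OF y] by (simp add: z'_def a'_def)
          ultimately show "?G y \<le> liminf (\<lambda>n. ?F n y)"
            using flsc unfolding seq_lsc_def by simp
        qed
      qed
      have "(\<integral>\<^sup>+x. ennreal (f x) \<partial>?q (z\<^sub>0, a\<^sub>0)) = (\<integral>\<^sup>+y\<in>Y1. ?G y \<partial>R (z\<^sub>0, a\<^sub>0)) + (\<integral>\<^sup>+y\<in>Y2. ?G y \<partial>R (z\<^sub>0, a\<^sub>0))"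
        using nn_integral_comdp_kernel[OF H' z0 a(2) fm] split[OF F0m RP(2)] RP(3) by simp
      also have "\<dots> \<le> liminf (\<lambda>n. (\<integral>\<^sup>+y\<in>Y1. ?F n y \<partial>R (z' n, a' n)) + (\<integral>\<^sup>+y\<in>Y2. ?F n y \<partial>R (z' n, a' n)))"
        using add_mono[OF part1 part2] liminf_add_le_ennreal by (rule order_trans)
      also have "\<dots> = liminf (\<lambda>n. \<integral>\<^sup>+x. ennreal (f x) \<partial>?q (z' n, a' n))"
        using nn_integral_comdp_kernel[OF H' z'(1) a'(1) fm] split[OF Fm RP'(2)] RP'(3) by simp
      finally show "(\<integral>\<^sup>+x. ennreal (f x) \<partial>?q (z\<^sub>0, a\<^sub>0)) \<le> liminf (\<lambda>n. \<integral>\<^sup>+x. ennreal (f x) \<partial>?q (z' n, a' n))" .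
    qed
    then show "\<exists>r'. strict_mono r' \<and> limitin (weak_topology (belief_topology X)) (\<lambda>n. ?q (z (r (r' n)), a (r (r' n)))) (?q (z\<^sub>0, a\<^sub>0)) sequentially"
      using r' by (auto simp: z'_def a'_def)
  qed
  then show ?thesis using comdp_kernel_unique[OF H H'] z a z0 by simp
qed

end

section \<open>Costs averaged over beliefs\<close>

text \<open>Applied to the compact set formed by a convergent sequence of states and its limit,
  K-inf-compactness gives properness in the action and lower semicontinuity at once.\<close>

lemma K_inf_compact_sequentially:
  fixes X :: "'x::metric_space set" and A :: "'a::metric_space set"
  assumes K: "K_inf_compact (top_of_set X) (top_of_set A) c"
    and x: "\<And>n. x n \<in> X" "x\<^sub>0 \<in> X" "x \<longlonglongrightarrow> x\<^sub>0" and a: "\<And>n. a n \<in> A"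
    and le: "\<And>n. c (x n, a n) \<le> ereal l"
  shows "\<exists>r a\<^sub>0. strict_mono (r :: nat \<Rightarrow> nat) \<and> a\<^sub>0 \<in> A \<and> (\<lambda>n. a (r n)) \<longlonglongrightarrow> a\<^sub>0 \<and> c (x\<^sub>0, a\<^sub>0) \<le> ereal l"
proof -
  let ?K = "insert x\<^sub>0 (range x)"
  have "compactin (top_of_set X) ?K"
    using x by (intro compactin_sequence_with_limit[where \<sigma>=x]) (auto simp: limitin_top_of_set)
  then have "compactin (prod_topology (subtopology (top_of_set X) ?K) (top_of_set A))
      {s \<in> topspace (prod_topology (subtopology (top_of_set X) ?K) (top_of_set A)). c s \<le> ereal l}"
    using K unfolding K_inf_compact_def inf_compact_def by blast
  moreover have "subtopology (top_of_set X) ?K = top_of_set ?K"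
    using x by (subst subtopology_subtopology) (auto intro: arg_cong[where f="subtopology euclidean"])
  ultimately have "compact {s \<in> ?K \<times> A. c s \<le> ereal l}"
    by (simp add: compactin_subtopology)
  moreover have "(x n, a n) \<in> {s \<in> ?K \<times> A. c s \<le> ereal l}" for n using a le by auto
  ultimately obtain s r where s: "s \<in> {s \<in> ?K \<times> A. c s \<le> ereal l}" "strict_mono (r :: nat \<Rightarrow> nat)"
    "((\<lambda>n. (x n, a n)) \<circ> r) \<longlonglongrightarrow> s"
    unfolding compact_eq_seq_compact_metric by (elim seq_compactE[where f="\<lambda>n. (x n, a n)"]) blast+
  have "(\<lambda>n. x (r n)) \<longlonglongrightarrow> fst s" "(\<lambda>n. a (r n)) \<longlonglongrightarrow> snd s"
    using tendsto_fst[OF s(3)] tendsto_snd[OF s(3)] by (simp_all add: comp_def)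
  moreover have "(\<lambda>n. x (r n)) \<longlonglongrightarrow> x\<^sub>0" using filterlim_compose[OF x(3) filterlim_subseq[OF s(2)]] .
  ultimately have "fst s = x\<^sub>0" "(\<lambda>n. a (r n)) \<longlonglongrightarrow> snd s" using LIMSEQ_unique by blast+
  then show ?thesis using s(1,2) by (intro exI[of _ r] exI[of _ "snd s"]) auto
qed

text \<open>\<open>cn\<close> is the nonnegative part of the cost above its lower bound \<open>b\<close>, and \<open>C\<close> is its average over a
  belief.\<close>

locale proper_cost =
  fixes X :: "'x::polish_space set" and A :: "'a::polish_space set"
    and c :: "'x \<times> 'a \<Rightarrow> ereal" and b :: real and cn :: "'x \<times> 'a \<Rightarrow> ennreal"
  assumes K: "K_inf_compact (top_of_set X) (top_of_set A) c"
    and cn_meas: "cn \<in> borel_measurable (borel_on X \<Otimes>\<^sub>M borel_on A)"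
    and cn: "\<And>s. s \<in> X \<times> A \<Longrightarrow> c s = enn2ereal (cn s) + ereal b"
begin

lemma cn_section: "a \<in> A \<Longrightarrow> (\<lambda>x. cn (x, a)) \<in> borel_measurable (borel_on X)"
proof -
  assume "a \<in> A"
  then have [measurable]: "a \<in> space (borel_on A)" by simp
  note [measurable] = cn_meas
  show ?thesis by measurable
qed

lemma cn_proper:
  assumes x: "\<And>n. x n \<in> X" "x\<^sub>0 \<in> X" "x \<longlonglongrightarrow> x\<^sub>0" and a: "\<And>n. a n \<in> A"
    and le: "\<And>n. cn (x n, a n) \<le> ennreal l" and l: "0 \<le> l"
  shows "\<exists>r a\<^sub>0. strict_mono (r :: nat \<Rightarrow> nat) \<and> a\<^sub>0 \<in> A \<and> (\<lambda>n. a (r n)) \<longlonglongrightarrow> a\<^sub>0 \<and> cn (x\<^sub>0, a\<^sub>0) \<le> ennreal l"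
proof -
  have iff: "c s \<le> ereal (l + b) \<longleftrightarrow> cn s \<le> ennreal l" if "s \<in> X \<times> A" for s
    using cn[OF that] l by (simp add: shift_le_real_iff)
  have "\<exists>r a\<^sub>0. strict_mono (r :: nat \<Rightarrow> nat) \<and> a\<^sub>0 \<in> A \<and> (\<lambda>n. a (r n)) \<longlonglongrightarrow> a\<^sub>0 \<and> c (x\<^sub>0, a\<^sub>0) \<le> ereal (l + b)"
    using x a le iff by (intro K_inf_compact_sequentially[OF K]) auto
  then show ?thesis using iff x by blast
qed

lemma cn_lsc:
  assumes x: "\<And>n. x n \<in> X" "x\<^sub>0 \<in> X" "x \<longlonglongrightarrow> x\<^sub>0" and a: "\<And>n. a n \<in> A" "a\<^sub>0 \<in> A" "a \<longlonglongrightarrow> a\<^sub>0"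
  shows "cn (x\<^sub>0, a\<^sub>0) \<le> liminf (\<lambda>n. cn (x n, a n))"
proof (rule ccontr)
  assume "\<not> ?thesis"
  then have "liminf (\<lambda>n. cn (x n, a n)) < cn (x\<^sub>0, a\<^sub>0)" by (simp only: not_le)
  then obtain t where t: "liminf (\<lambda>n. cn (x n, a n)) < t" "t < cn (x\<^sub>0, a\<^sub>0)"
    using dense by blast
  then obtain l where l: "t = ennreal l" "0 \<le> l" by (cases t) auto
  obtain r :: "nat \<Rightarrow> nat" where r: "strict_mono r" "(\<lambda>n. cn (x (r n), a (r n))) \<longlonglongrightarrow> liminf (\<lambda>n. cn (x n, a n))"
    using liminf_subseq_lim[of "\<lambda>n. cn (x n, a n)"] by (auto simp: comp_def)
  obtain N where N: "\<And>n. n \<ge> N \<Longrightarrow> cn (x (r n), a (r n)) < t"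
    using order_tendstoD(2)[OF r(2) t(1)] by (auto simp: eventually_sequentially)
  have rN: "filterlim (\<lambda>n. r (n + N)) sequentially sequentially"
    using filterlim_compose[OF filterlim_subseq[OF r(1)] filterlim_add_const_nat_at_top] .
  have "\<exists>r' a'. strict_mono (r' :: nat \<Rightarrow> nat) \<and> a' \<in> A \<and> (\<lambda>n. a (r (r' n + N))) \<longlonglongrightarrow> a' \<and> cn (x\<^sub>0, a') \<le> ennreal l"
  proof (rule cn_proper)
    show "(\<lambda>n. x (r (n + N))) \<longlonglongrightarrow> x\<^sub>0" using filterlim_compose[OF x(3) rN] .
    show "cn (x (r (n + N)), a (r (n + N))) \<le> ennreal l" for n using N[of "n + N"] l by simp
  qed (use x a l in auto)
  then obtain r' a' where r': "strict_mono (r' :: nat \<Rightarrow> nat)" "(\<lambda>n. a (r (r' n + N))) \<longlonglongrightarrow> a'" "cn (x\<^sub>0, a') \<le> ennreal l"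
    by blast
  have "(\<lambda>n. a (r (r' n + N))) \<longlonglongrightarrow> a\<^sub>0"
    using filterlim_compose[OF filterlim_compose[OF a(3) rN] filterlim_subseq[OF r'(1)]] .
  then have "a' = a\<^sub>0" using r'(2) LIMSEQ_unique by blast
  then show False using r'(3) t(2) l by simp
qed

definition C :: "'x measure \<times> 'a \<Rightarrow> ennreal" where
  "C s = (\<integral>\<^sup>+x. cn (x, snd s) \<partial>fst s)"

lemma C_measurable: "C \<in> borel_measurable (borel_of (belief_topology X) \<Otimes>\<^sub>M borel_on A)"
proof -
  note [measurable] = cn_meas
  have "(\<lambda>z. z) \<in> borel_of (belief_topology X) \<rightarrow>\<^sub>M prob_algebra (borel_on X)"
    by (rule measurable_ident_sets) (rule sets_belief_borel)
  then have id: "(\<lambda>z. z) \<in> borel_of (belief_topology X) \<rightarrow>\<^sub>M subprob_algebra (borel_on X)"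
    by (rule measurable_prob_algebraD)
  have [measurable]: "fst \<in> borel_of (belief_topology X) \<Otimes>\<^sub>M borel_on A \<rightarrow>\<^sub>M subprob_algebra (borel_on X)"
    using measurable_compose[OF measurable_fst id] .
  then show ?thesis unfolding C_def
    by (intro nn_integral_measurable_subprob_algebra2[where N="borel_on X"]) measurable
qed

lemma comdp_cost_eq:
  assumes z: "z \<in> beliefs X" and a: "a \<in> A" and b: "b \<le> 0"
  shows "comdp_cost c (z, a) = enn2ereal (C (z, a)) + ereal b"
proof -
  note P = prob_measuresD[OF z]
  have "comdp_cost c (z, a) = ereal_integral z (\<lambda>x. enn2ereal (cn (x, a)) + ereal b)"
    unfolding comdp_cost_def prod.case using P a cn by (intro ereal_integral_cong) auto
  then show ?thesis
    unfolding C_def fst_conv snd_conv using P cn_section[OF a] b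
    by (simp add: ereal_integral_shift measurable_cong_sets[OF P(2) refl])
qed

lemma C_lower_semicontinuous:
  assumes z: "\<And>n. z n \<in> beliefs X" "limitin (belief_topology X) z z\<^sub>0 sequentially"
    and a: "\<And>n. a n \<in> A" "a\<^sub>0 \<in> A" "a \<longlonglongrightarrow> a\<^sub>0"
  shows "C (z\<^sub>0, a\<^sub>0) \<le> liminf (\<lambda>n. C (z n, a n))"
  unfolding C_def fst_conv snd_conv
proof (rule fatou_weak_convergence[OF metrizable_euclidean_subspace z])
  fix r :: "nat \<Rightarrow> nat" and s x
  assume r: "filterlim r sequentially sequentially" and s: "\<And>n. s n \<in> topspace (top_of_set X)" "limitin (top_of_set X) s x sequentially"
  show "cn (x, a\<^sub>0) \<le> liminf (\<lambda>n. cn (s n, a (r n)))"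
    using s a filterlim_compose[OF a(3) r] by (intro cn_lsc) (auto simp: limitin_top_of_set)
qed

text \<open>The union \<open>W N\<close> of the open sets that miss all \<open>G n\<close> with \<open>n \<ge> N\<close> has \<open>z n\<close>-measure at most \<open>1 / 2\<close> for
  \<open>n \<ge> N\<close>, hence \<open>z\<^sub>0\<close>-measure at most \<open>1 / 2\<close>. If no point were as claimed, the increasing sets \<open>W N\<close> would
  exhaust \<open>X\<close> and their measures would tend to \<open>1\<close>.\<close>

lemma sublevel_accumulation_point:
  assumes z: "\<And>n. z n \<in> beliefs X" "limitin (belief_topology X) z z\<^sub>0 sequentially"
    and G: "\<And>n. G n \<in> sets (borel_on X)" "\<And>n. 1 / 2 \<le> measure (z n) (G n)"
  shows "\<exists>x\<in>X. \<forall>U N. openin (top_of_set X) U \<and> x \<in> U \<longrightarrow> (\<exists>n\<ge>N. U \<inter> G n \<noteq> {})"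
proof (rule ccontr)
  assume contra: "\<not> ?thesis"
  have no: "\<exists>U N. openin (top_of_set X) U \<and> x \<in> U \<and> (\<forall>n\<ge>N. U \<inter> G n = {})" if "x \<in> X" for x
  proof -
    have "\<not> (\<forall>U N. openin (top_of_set X) U \<and> x \<in> U \<longrightarrow> (\<exists>n\<ge>N. U \<inter> G n \<noteq> {}))"
    proof
      assume *: "\<forall>U N. openin (top_of_set X) U \<and> x \<in> U \<longrightarrow> (\<exists>n\<ge>N. U \<inter> G n \<noteq> {})"
      show False by (rule notE[OF contra]) (rule bexI[OF _ that], rule *)
    qed
    then show ?thesis by simp
  qed
  define W where "W N = \<Union>{U. openin (top_of_set X) U \<and> (\<forall>n\<ge>N. U \<inter> G n = {})}" for N :: nat
  have W_open: "openin (top_of_set X) (W N)" for N unfolding W_def by (rule openin_Union) auto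
  have W_G: "W N \<inter> G n = {}" if "N \<le> n" for N n using that unfolding W_def by blast
  have W_mono: "incseq W" 
  proof (rule monoI)
    fix m n :: nat assume "m \<le> n"
    then show "W m \<subseteq> W n" unfolding W_def by (intro Union_mono Collect_mono) auto
  qed
  have W_UN: "(\<Union>N. W N) = X"
  proof
    show "(\<Union>N. W N) \<subseteq> X" using openin_subset[OF W_open] by auto
    show "X \<subseteq> (\<Union>N. W N)"
    proof
      fix x assume "x \<in> X"
      then obtain U N where "openin (top_of_set X) U" "x \<in> U" "\<forall>n\<ge>N. U \<inter> G n = {}" using no by meson
      then have "x \<in> W N" unfolding W_def by (intro UnionI[of U]) simp_all
      then show "x \<in> (\<Union>N. W N)" by blast
    qed
  qed
  have z0: "z\<^sub>0 \<in> beliefs X" using limitin_topspace[OF z(2)] by simp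
  note P0 = prob_measuresD[OF z0] and P = prob_measuresD[OF z(1)]
  have W_sets: "W N \<in> sets (borel_on X)" for N using openin_in_borel_of[OF W_open] .
  interpret z0: prob_space z\<^sub>0 by (rule P0(1))
  have "(SUP N. emeasure z\<^sub>0 (W N)) = emeasure z\<^sub>0 (\<Union>N. W N)"
    using W_mono W_sets P0 by (intro SUP_emeasure_incseq) auto
  also have "\<dots> = 1" unfolding W_UN using z0.emeasure_space_1 P0 by simp
  finally have SUP: "(SUP N. emeasure z\<^sub>0 (W N)) = 1" .
  have "ennreal (1 / 2) < ennreal 1" by (subst ennreal_less_iff) auto
  then have "ennreal (1 / 2) < (SUP N. emeasure z\<^sub>0 (W N))" by (simp only: SUP ennreal_1)
  then obtain N where N: "ennreal (1 / 2) < emeasure z\<^sub>0 (W N)" by (auto simp: less_SUP_iff)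
  have "emeasure z\<^sub>0 (W N) = (\<integral>\<^sup>+x. indicator (W N) x \<partial>z\<^sub>0)" using W_sets P0 by simp
  also have "\<dots> \<le> liminf (\<lambda>n. \<integral>\<^sup>+x. indicator (W N) x \<partial>z n)"
    using seq_lsc_open_indicator[OF W_open[of N]]
    by (intro fatou_weak_convergence[OF metrizable_euclidean_subspace z]) (auto simp: seq_lsc_def)
  also have "\<dots> = liminf (\<lambda>n. emeasure (z n) (W N))" using W_sets P by simp
  also have "\<dots> \<le> liminf (\<lambda>n. ennreal (1 / 2))"
  proof (rule Liminf_mono)
    show "\<forall>\<^sub>F n in sequentially. emeasure (z n) (W N) \<le> ennreal (1 / 2)"
      using eventually_ge_at_top[of N]
    proof eventually_elim
      case (elim n)
      interpret zn: prob_space "z n" by (rule P(1))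
      have "measure (z n) (W N) + measure (z n) (G n) = measure (z n) (W N \<union> G n)"
        using W_G[OF elim] W_sets G(1) P by (intro zn.finite_measure_Union[symmetric]) auto
      also have "\<dots> \<le> 1" by (rule zn.prob_le_1)
      finally have "measure (z n) (W N) \<le> 1 / 2" using G(2)[of n] by linarith
      then show ?case unfolding zn.emeasure_eq_measure by (rule ennreal_leI)
    qed
  qed
  finally have "emeasure z\<^sub>0 (W N) \<le> ennreal (1 / 2)" by (simp add: Liminf_const)
  with N show False by simp
qed

text \<open>By Markov's inequality the sublevel sets of the costs \<open>cn (_, a n)\<close> carry half of the mass of \<open>z n\<close>, so they
  accumulate at a point \<open>x\<close>. Choosing states \<open>y k\<close> in them with \<open>y k \<rightarrow> x\<close> reduces the claim to properness of
  the cost of the hidden state.\<close>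

lemma C_proper:
  assumes z: "\<And>n. z n \<in> beliefs X" "limitin (belief_topology X) z z\<^sub>0 sequentially"
    and a: "\<And>n. a n \<in> A" and le: "\<And>n. C (z n, a n) \<le> ennreal l"
  shows "\<exists>r a\<^sub>0. strict_mono (r :: nat \<Rightarrow> nat) \<and> a\<^sub>0 \<in> A \<and> (\<lambda>n. a (r n)) \<longlonglongrightarrow> a\<^sub>0"
proof -
  \<comment> \<open>twice a positive bound of the averages, so that at most half of the mass exceeds it\<close>
  define L where "L = 2 * max l 1"
  have L: "0 < L" by (simp add: L_def)
  note P = prob_measuresD[OF z(1)]
  define G where "G n = {x \<in> X. cn (x, a n) \<le> ennreal L}" for n
  have G_sets: "G n \<in> sets (borel_on X)" for n
  proof -
    note [measurable] = cn_section[OF a[of n]]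
    have "{x \<in> space (borel_on X). cn (x, a n) \<le> ennreal L} \<in> sets (borel_on X)" by measurable
    then show ?thesis by (simp add: G_def)
  qed
  have G_half: "1 / 2 \<le> measure (z n) (G n)" for n
  proof -
    interpret prob_space "z n" by (rule P(1))
    have "ennreal L * emeasure (z n) (X - G n) = (\<integral>\<^sup>+x. ennreal L * indicator (X - G n) x \<partial>z n)"
      using G_sets[of n] P by (subst nn_integral_cmult_indicator) (auto simp: sets.compl_sets[of _ "borel_on X", simplified])
    also have "\<dots> \<le> C (z n, a n)"
      unfolding C_def fst_conv snd_conv
      by (intro nn_integral_mono) (auto simp: G_def split: split_indicator)
    also have "\<dots> \<le> ennreal l" by (rule le)
    also have "\<dots> \<le> ennreal (L / 2)" by (intro ennreal_leI) (simp add: L_def)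
    finally have "ennreal (L * measure (z n) (X - G n)) \<le> ennreal (L / 2)"
      using L by (simp add: emeasure_eq_measure ennreal_mult)
    then have "L * measure (z n) (X - G n) \<le> L / 2" using L by (subst (asm) ennreal_le_iff) auto
    then have "measure (z n) (X - G n) \<le> 1 / 2" using L by (simp add: field_simps)
    moreover have "measure (z n) (X - G n) = 1 - measure (z n) (G n)"
      using prob_compl[of "G n"] G_sets[of n] P by simp
    ultimately show ?thesis by simp
  qed
  obtain x where x: "x \<in> X" "\<And>U N. openin (top_of_set X) U \<Longrightarrow> x \<in> U \<Longrightarrow> \<exists>n\<ge>N. U \<inter> G n \<noteq> {}"
    using sublevel_accumulation_point[OF z G_sets G_half] by blast
  have "\<exists>n\<ge>N. \<exists>y\<in>G n. dist x y < 1 / Suc k" for k N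
  proof -
    have "openin (top_of_set X) (X \<inter> ball x (1 / Suc k))" by (rule openin_open_Int) simp
    from x(2)[OF this, of N] x(1) show ?thesis by (auto simp: ball_def)
  qed
  note near = this
  have "\<exists>q. \<forall>k. (\<exists>y\<in>G (q k). dist x y < 1 / Suc k) \<and> q k < q (Suc k)"
  proof (rule dependent_nat_choice)
    show "\<exists>n. \<exists>y\<in>G n. dist x y < 1 / real (Suc 0)" using near[of 0 0] by blast
    show "\<exists>m. (\<exists>y\<in>G m. dist x y < 1 / real (Suc (Suc k))) \<and> n < m" for n k
      using near[of "Suc n" "Suc k"] by (auto simp: Suc_le_eq)
  qed
  then obtain q y where q: "\<And>k. q k < q (Suc k)" and y: "\<And>k. y k \<in> G (q k)" "\<And>k. dist x (y k) < 1 / Suc k"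
    by metis
  have qm: "strict_mono q" using q by (rule strict_mono_Suc_iff[THEN iffD2, rule_format])
  have "(\<lambda>k. dist (y k) x) \<longlonglongrightarrow> 0"
  proof (rule tendsto_sandwich[where f="\<lambda>_. 0" and h="\<lambda>k. 1 / real (Suc k)"])
    show "\<forall>\<^sub>F k in sequentially. dist (y k) x \<le> 1 / real (Suc k)"
      using y(2) by (intro always_eventually allI less_imp_le) (simp add: dist_commute)
    show "(\<lambda>k. 1 / real (Suc k)) \<longlonglongrightarrow> 0" by (rule LIMSEQ_Suc[OF lim_const_over_n])
  qed auto
  then have ylim: "y \<longlonglongrightarrow> x" using tendsto_dist_iff by blast
  have "\<exists>r a\<^sub>0. strict_mono (r :: nat \<Rightarrow> nat) \<and> a\<^sub>0 \<in> A \<and> (\<lambda>n. a (q (r n))) \<longlonglongrightarrow> a\<^sub>0 \<and> cn (x, a\<^sub>0) \<le> ennreal L"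
    using x(1) ylim y(1) a L by (intro cn_proper[where x=y]) (auto simp: G_def)
  then obtain r a\<^sub>0 where "strict_mono (r :: nat \<Rightarrow> nat)" "a\<^sub>0 \<in> A" "(\<lambda>n. a (q (r n))) \<longlonglongrightarrow> a\<^sub>0" by blast
  then show ?thesis using qm by (intro exI[of _ "\<lambda>n. q (r n)"] exI[of _ a\<^sub>0]) (auto simp: strict_mono_def)
qed

end

section \<open>The optimality properties of the filtered process\<close>

locale comdp = pomdp_kernels X Y A P Q +
  M: shifted_mdp "belief_topology X" A "comdp_kernel X Y P Q H" C \<alpha> "comdp_cost c" b
  for X :: "'x::polish_space set" and Y :: "'y::polish_space set" and A :: "'a::polish_space set"
    and P Q and H :: "'x measure \<times> 'a \<times> 'y \<Rightarrow> 'x measure" and C \<alpha> and c :: "'x \<times> 'a \<Rightarrow> ereal" and b +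
  assumes H: "filter_kernel X Y A P Q H"
begin

abbreviation "opt_value \<equiv> comdp_opt_value X Y A P Q c \<alpha> H"

text \<open>The iterated integral over \<open>x\<close>, \<open>x'\<close> and \<open>y\<close> is the integral over the observation law, whose image under
  \<open>H (z, a, _)\<close> is the transition kernel; the constant \<open>\<beta>\<close> passes through each integral.\<close>

lemma bellman_filter_eq:
  assumes z: "z \<in> beliefs X" and a: "a \<in> A" and u: "u \<in> borel_measurable BX" and \<beta>: "\<beta> \<le> 0"
    and v: "\<And>z. z \<in> beliefs X \<Longrightarrow> v z = enn2ereal (u z) + ereal \<beta>"
  shows "bellman_filter P Q c \<alpha> H v z a = bellman X Y P Q c \<alpha> H v z a"
proof -
  have a' [measurable]: "a \<in> space (borel_on A)" using a by simp
  let ?f = "\<lambda>y. u (H (z, a, y))"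
  have f [measurable]: "?f \<in> borel_measurable (borel_on Y)"
    using measurable_compose[OF filter_section_measurable[OF H z a] u] .
  have [measurable]: "(\<lambda>x. Q (a, x)) \<in> borel_on X \<rightarrow>\<^sub>M subprob_algebra (borel_on Y)"
    by (rule measurable_prob_algebraD) measurable
  have [measurable]: "(\<lambda>x. P (x, a)) \<in> borel_on X \<rightarrow>\<^sub>M subprob_algebra (borel_on X)"
    by (rule measurable_prob_algebraD) measurable
  let ?g = "\<lambda>x'. \<integral>\<^sup>+y. ?f y \<partial>Q (a, x')"
  have g [measurable]: "?g \<in> borel_measurable (borel_on X)" by measurable
  let ?h = "\<lambda>x. \<integral>\<^sup>+x'. ?g x' \<partial>P (x, a)"
  have h [measurable]: "?h \<in> borel_measurable (borel_on X)" by measurable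
  have 1: "ereal_integral (Q (a, x')) (\<lambda>y. v (H (z, a, y))) = enn2ereal (?g x') + ereal \<beta>" if x': "x' \<in> X" for x'
  proof -
    note D = prob_measuresD[OF Q_in[OF x' a]]
    have "ereal_integral (Q (a, x')) (\<lambda>y. v (H (z, a, y))) = ereal_integral (Q (a, x')) (\<lambda>y. enn2ereal (?f y) + ereal \<beta>)"
      using D v filter_in[OF H z a] by (intro ereal_integral_cong) auto
    also have "\<dots> = enn2ereal (?g x') + ereal \<beta>"
      using D f \<beta> by (intro ereal_integral_shift) (simp_all add: measurable_cong_sets[OF D(2) refl])
    finally show ?thesis .
  qed
  have 2: "ereal_integral (P (x, a)) (\<lambda>x'. ereal_integral (Q (a, x')) (\<lambda>y. v (H (z, a, y)))) = enn2ereal (?h x) + ereal \<beta>"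
    if x: "x \<in> X" for x
  proof -
    note D = prob_measuresD[OF P_in[OF x a]]
    have "ereal_integral (P (x, a)) (\<lambda>x'. ereal_integral (Q (a, x')) (\<lambda>y. v (H (z, a, y)))) =
        ereal_integral (P (x, a)) (\<lambda>x'. enn2ereal (?g x') + ereal \<beta>)"
      using D 1 by (intro ereal_integral_cong) auto
    also have "\<dots> = enn2ereal (?h x) + ereal \<beta>"
      using D g \<beta> by (intro ereal_integral_shift) (simp_all add: measurable_cong_sets[OF D(2) refl])
    finally show ?thesis .
  qed
  note D = prob_measuresD[OF z]
  have "ereal_integral z (\<lambda>x. ereal_integral (P (x, a)) (\<lambda>x'. ereal_integral (Q (a, x')) (\<lambda>y. v (H (z, a, y))))) =
      ereal_integral z (\<lambda>x. enn2ereal (?h x) + ereal \<beta>)"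
    using D 2 by (intro ereal_integral_cong) auto
  also have "\<dots> = enn2ereal (\<integral>\<^sup>+x. ?h x \<partial>z) + ereal \<beta>"
    using D h \<beta> by (intro ereal_integral_shift) (simp_all add: measurable_cong_sets[OF D(2) refl])
  also have "(\<integral>\<^sup>+x. ?h x \<partial>z) = (\<integral>\<^sup>+z'. u z' \<partial>comdp_kernel X Y P Q H (z, a))"
    using nn_integral_obs_kernel[OF z a f] nn_integral_comdp_kernel[OF H z a u] by simp
  also have "enn2ereal \<dots> + ereal \<beta> = ereal_integral (comdp_kernel X Y P Q H (z, a)) v"
  proof -
    have "comdp_kernel X Y P Q H (z, a) \<in> prob_measures (belief_topology X)" using z a by (intro M.p_in) auto
    note D = prob_measuresD[OF this]
    have "ereal_integral (comdp_kernel X Y P Q H (z, a)) v =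
        ereal_integral (comdp_kernel X Y P Q H (z, a)) (\<lambda>z. enn2ereal (u z) + ereal \<beta>)"
      using D v by (intro ereal_integral_cong) auto
    then show ?thesis
      using D u \<beta> by (simp add: ereal_integral_shift measurable_cong_sets[OF D(2) refl])
  qed
  finally show ?thesis
    unfolding bellman_filter_def bellman_def by (simp add: comdp_cost_def)
qed

lemma comdp_opt_value_eq:
  "z \<in> beliefs X \<Longrightarrow> opt_value T z = enn2ereal (M.vT T z) + ereal (M.shift T)"
  unfolding comdp_opt_value_def by (rule M.mdp_opt_value_shift) simp

lemma comdp_optimal_iff:
  assumes "\<And>t. \<phi> t \<in> BX \<rightarrow>\<^sub>M borel_on A"
  shows "comdp_optimal X Y A P Q c \<alpha> H T \<phi> \<longleftrightarrow>
    (\<forall>z\<in>beliefs X. M.VT T (markov_policy (borel_on A) \<phi>) z = M.vT T z)"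
  unfolding comdp_optimal_def M.mdp_optimal_iff using markov_policy_in_policies[of \<phi>, OF assms] by simp

lemma vT_measurable [measurable]: "M.vT T \<in> borel_measurable BX"
  by (cases T) auto

lemma vT_lsc: "seq_lsc (belief_topology X) (M.vT T)"
  by (cases T) (auto intro: M.v_lsc M.v_inf_lsc)

lemma bellman_eq:
  assumes "z \<in> beliefs X" "a \<in> A"
  shows "bellman X Y P Q c \<alpha> H (opt_value T) z a =
    enn2ereal (M.Q (M.vT T) (z, a)) + ereal (b + \<alpha> * M.shift T)"
  unfolding bellman_def using assms comdp_opt_value_eq
  by (intro M.bellman_shift[OF _ _ vT_measurable M.shift_nonpos]) auto

lemma opt_actions_eq:
  assumes z: "z \<in> beliefs X" and s: "M.shift T' = b + \<alpha> * M.shift T"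
  shows "opt_actions X Y A P Q c \<alpha> H (opt_value T') (opt_value T) z =
    {a \<in> A. M.Q (M.vT T) (z, a) = M.vT T' z}"
  unfolding opt_actions_def using bellman_eq[OF z] comdp_opt_value_eq[OF z] s
  by (auto simp: eq_commute)

text \<open>Subtracting the constants \<open>shift\<close> on both sides, the optimality equation becomes
  \<open>vT T' = T_op (vT T)\<close>; \<open>T' = T + 1\<close> and \<open>T' = T = \<infinity>\<close> are the cases of interest.\<close>

lemma optimality_equation_holds:
  assumes s: "M.shift T' = b + \<alpha> * M.shift T"
    and v: "\<And>z. z \<in> beliefs X \<Longrightarrow> M.vT T' z = M.T_op (M.vT T) z"
  shows "optimality_equation X Y A P Q c \<alpha> H (opt_value T') (opt_value T)"
proof -
  let ?w = "opt_value T'" and ?v = "opt_value T"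
  have point: "is_min (?w z) (bellman X Y P Q c \<alpha> H ?v z) A \<and>
         is_min (?w z) (bellman_filter P Q c \<alpha> H ?v z) A \<and>
         opt_actions X Y A P Q c \<alpha> H ?w ?v z \<noteq> {} \<and>
         (?w z = \<infinity> \<longrightarrow> opt_actions X Y A P Q c \<alpha> H ?w ?v z = A) \<and>
         (?w z < \<infinity> \<longrightarrow> compact (opt_actions X Y A P Q c \<alpha> H ?w ?v z))" if z: "z \<in> beliefs X" for z
  proof -
    have z': "z \<in> topspace (belief_topology X)" using z by simp
    obtain a where a: "a \<in> A" "M.Q (M.vT T) (z, a) = M.vT T' z"
      using M.T_op_attained[OF vT_lsc z'] v[OF z] by metis
    have le: "M.vT T' z \<le> M.Q (M.vT T) (z, a)" if "a \<in> A" for a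
      using M.T_op_le[OF that] v[OF z] by metis
    have B: "bellman X Y P Q c \<alpha> H ?v z a = enn2ereal (M.Q (M.vT T) (z, a)) + ereal (M.shift T')" if "a \<in> A" for a
      using bellman_eq[OF z that] s by simp
    have W: "?w z = enn2ereal (M.vT T' z) + ereal (M.shift T')" by (rule comdp_opt_value_eq[OF z])
    have BF: "bellman_filter P Q c \<alpha> H ?v z a = bellman X Y P Q c \<alpha> H ?v z a" if "a \<in> A" for a
      using z that comdp_opt_value_eq by (intro bellman_filter_eq[OF _ _ vT_measurable M.shift_nonpos])
    note G = opt_actions_eq[OF z s]
    show ?thesis
    proof (intro conjI impI)
      show m: "is_min (?w z) (bellman X Y P Q c \<alpha> H ?v z) A"
        unfolding is_min_def W using a le B by (auto intro!: bexI[of _ a])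
      then show "is_min (?w z) (bellman_filter P Q c \<alpha> H ?v z) A"
        unfolding is_min_def using BF by auto
      show "opt_actions X Y A P Q c \<alpha> H ?w ?v z \<noteq> {}" unfolding G using a by blast
      show "opt_actions X Y A P Q c \<alpha> H ?w ?v z = A" if "?w z = \<infinity>"
        using that le unfolding G W shift_eq_infinity_iff by (auto simp: top_unique)
      show "compact (opt_actions X Y A P Q c \<alpha> H ?w ?v z)" if "?w z < \<infinity>"
      proof -
        have "M.vT T' z \<noteq> top" using that unfolding W by (metis less_irrefl shift_eq_infinity_iff)
        then show ?thesis
          unfolding G v[OF z] using M.minimizers_compact[OF vT_lsc z', of T] v[OF z]
          by (simp add: top.not_eq_extremum)
      qed
    qed
  qed
  have "{(z, a). z \<in> beliefs X \<and> a \<in> opt_actions X Y A P Q c \<alpha> H ?w ?v z} =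
      {s \<in> space (BX \<Otimes>\<^sub>M borel_on A). M.Q (M.vT T) s = M.vT T' (fst s)}"
    using opt_actions_eq[OF _ s] by (auto simp: space_pair_measure)
  also have "\<dots> \<in> sets (BX \<Otimes>\<^sub>M borel_on A)"
  proof -
    have [measurable]: "M.Q (M.vT T) \<in> borel_measurable (BX \<Otimes>\<^sub>M borel_on A)"
      by (rule M.Q_measurable) measurable
    show ?thesis by measurable
  qed
  finally show ?thesis unfolding optimality_equation_def Let_def using point by blast
qed

lemma optimality_properties_hold: "optimality_properties X Y A P Q c \<alpha> H"
proof -
  let ?v = opt_value
  let ?opt = "comdp_optimal X Y A P Q c \<alpha> H"
  let ?G = "\<lambda>t. opt_actions X Y A P Q c \<alpha> H (?v (enat (Suc t))) (?v (enat t))"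
  let ?GI = "opt_actions X Y A P Q c \<alpha> H (?v \<infinity>) (?v \<infinity>)"
  have lsc: "lower_semicontinuous (belief_topology X) (?v T)" for T
    using comdp_opt_value_eq by (intro lower_semicontinuous_shift[OF vT_lsc]) simp
  have conv: "(\<lambda>t. ?v (enat t) z) \<longlonglongrightarrow> ?v \<infinity> z" if "z \<in> beliefs X" for z
    unfolding comdp_opt_value_def using that by (intro M.opt_value_LIMSEQ) simp
  have eq_fin: "optimality_equation X Y A P Q c \<alpha> H (?v (enat (Suc t))) (?v (enat t))" for t
    by (rule optimality_equation_holds[OF M.shift_Suc]) simp
  have eq_inf: "optimality_equation X Y A P Q c \<alpha> H (?v \<infinity>) (?v \<infinity>)"
    by (rule optimality_equation_holds[OF M.shift_infinity]) (simp add: M.v_inf_fixed_point)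
  have G: "?G t z = {a \<in> A. M.Q (M.v t) (z, a) = M.v (Suc t) z}" if "z \<in> beliefs X" for t z
    using opt_actions_eq[OF that M.shift_Suc] by simp
  have GI: "?GI z = {a \<in> A. M.Q M.v_inf (z, a) = M.v_inf z}" if "z \<in> beliefs X" for z
    using opt_actions_eq[OF that M.shift_infinity] by simp
  have fin_exists: "\<exists>\<phi>. (\<forall>t. \<phi> t \<in> BX \<rightarrow>\<^sub>M borel_on A) \<and> ?opt (enat T) \<phi>" for T
  proof -
    obtain \<phi> where "\<And>t. \<phi> t \<in> BX \<rightarrow>\<^sub>M borel_on A"
      "\<And>z. z \<in> topspace (belief_topology X) \<Longrightarrow> M.VT (enat T) (markov_policy (borel_on A) \<phi>) z = M.vT (enat T) z"
      using M.VT_attained by metis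
    then show ?thesis by (intro exI[of _ \<phi>]) (simp add: comdp_optimal_iff)
  qed
  have fin_opt: "?opt (enat T) \<phi>"
    if \<phi>: "\<forall>t. \<phi> t \<in> BX \<rightarrow>\<^sub>M borel_on A" and sel: "\<forall>t<T. \<forall>z\<in>beliefs X. \<phi> (T - 1 - t) z \<in> ?G t z" for T \<phi>
    using \<phi> sel G M.finite_horizon_optimal[of \<phi> _ T] by (subst comdp_optimal_iff) auto
  have stat_iff: "?opt \<infinity> (\<lambda>_. \<phi>) \<longleftrightarrow> (\<forall>z\<in>beliefs X. \<phi> z \<in> ?GI z)" if \<phi>: "\<phi> \<in> BX \<rightarrow>\<^sub>M borel_on A" for \<phi>
  proof -
    have "\<phi> z \<in> A" if "z \<in> beliefs X" for z using measurable_space[OF \<phi>, of z] that by simp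
    then show ?thesis
      using \<phi> GI M.stationary_optimal_iff[OF \<phi>] by (subst comdp_optimal_iff) auto
  qed
  have stat_exists: "\<exists>\<phi>. \<phi> \<in> BX \<rightarrow>\<^sub>M borel_on A \<and> ?opt \<infinity> (\<lambda>_. \<phi>)"
  proof -
    obtain \<phi> where \<phi>: "\<phi> \<in> BX \<rightarrow>\<^sub>M borel_on A"
      "\<And>z. z \<in> topspace (belief_topology X) \<Longrightarrow> M.Q M.v_inf (z, \<phi> z) = M.v_inf z"
      using M.stationary_optimal_exists by metis
    then have "\<phi> z \<in> ?GI z" if "z \<in> beliefs X" for z
      using GI[OF that] that measurable_space[OF \<phi>(1), of z] by simp
    then show ?thesis using stat_iff[OF \<phi>(1)] \<phi>(1) by blast
  qed
  have ic: "(\<forall>t\<ge>1. inf_compact (belief_topology X) (?v (enat t))) \<and> inf_compact (belief_topology X) (?v \<infinity>)"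
    if ic: "inf_compact (prod_topology (belief_topology X) (top_of_set A)) (comdp_cost c)"
  proof (intro conjI allI impI)
    show "inf_compact (belief_topology X) (?v (enat t))" if "1 \<le> t" for t
    proof (rule M.sublevel_compact[OF ic vT_lsc[of "enat t"] _ M.v_lsc[of "t - 1"]])
      show "M.T_op (M.v (t - 1)) z \<le> M.vT (enat t) z" for z using \<open>1 \<le> t\<close> by (cases t) auto
      show "?v (enat t) z = enn2ereal (M.vT (enat t) z) + ereal (M.shift (enat t))"
        if "z \<in> topspace (belief_topology X)" for z using that comdp_opt_value_eq by simp
    qed
    show "inf_compact (belief_topology X) (?v \<infinity>)"
    proof (rule M.sublevel_compact[OF ic vT_lsc[of \<infinity>] _ M.v_inf_lsc])
      show "M.T_op M.v_inf z \<le> M.vT \<infinity> z" if "z \<in> topspace (belief_topology X)" for z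
        using M.v_inf_fixed_point[OF that] by simp
      show "?v \<infinity> z = enn2ereal (M.vT \<infinity> z) + ereal (M.shift \<infinity>)"
        if "z \<in> topspace (belief_topology X)" for z using that comdp_opt_value_eq by simp
    qed
  qed
  show ?thesis
    unfolding optimality_properties_def Let_def
    using lsc conv eq_fin eq_inf fin_exists fin_opt stat_iff stat_exists ic
    by (intro conjI allI impI ballI) blast+
qed

end

theorem theorem7p1:
  fixes X :: "'x::polish_space set" and Y Y1 Y2 :: "'y::polish_space set"
    and A :: "'a::polish_space set"
    and P :: "'x \<times> 'a \<Rightarrow> 'x measure" and Q :: "'a \<times> 'x \<Rightarrow> 'y measure"
    and c :: "'x \<times> 'a \<Rightarrow> ereal" and \<alpha> :: real
    and H :: "'x measure \<times> 'a \<times> 'y \<Rightarrow> 'x measure"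
  assumes pomdp: "pomdp X Y A P Q c"
    and H: "filter_kernel X Y A P Q H"
    and partition: "Y1 \<union> Y2 = Y" "Y1 \<inter> Y2 = {}" "openin (top_of_set Y) Y1"
    and a: "weakly_continuous (prod_topology (top_of_set X) (top_of_set A)) (top_of_set X) P"
      "weakly_continuous (prod_topology (top_of_set A) (top_of_set X)) (top_of_set Y) Q"
    and b: "\<And>z a z\<^sub>0 a\<^sub>0 C.
      \<lbrakk>\<And>n. z n \<in> beliefs X; \<And>n. a n \<in> A;
       limitin (prod_topology (belief_topology X) (top_of_set A))
         (\<lambda>n. (z n, a n)) (z\<^sub>0, a\<^sub>0) sequentially;
       C \<in> sets (borel_on Y2)\<rbrakk> \<Longrightarrow>
      (\<lambda>n. measure (obs_kernel X Y P Q (z n, a n)) C) \<longlonglongrightarrow>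
        measure (obs_kernel X Y P Q (z\<^sub>0, a\<^sub>0)) C"
    and c: "\<exists>H'. filter_kernel X Y A P Q H' \<and>
      weakly_continuous
        (prod_topology (belief_topology X) (prod_topology (top_of_set A) (top_of_set Y1)))
        (top_of_set X) H' \<and>
      (\<forall>z a z\<^sub>0 a\<^sub>0. (\<forall>n. z n \<in> beliefs X) \<and> z\<^sub>0 \<in> beliefs X \<and>
         limitin (belief_topology X) z z\<^sub>0 sequentially \<and>
         (\<forall>n. a n \<in> A) \<and> a\<^sub>0 \<in> A \<and> a \<longlonglongrightarrow> a\<^sub>0 \<longrightarrow>
         (\<exists>(r :: nat \<Rightarrow> nat) C. strict_mono r \<and> C \<in> sets (borel_on Y2) \<and>
            measure (obs_kernel X Y P Q (z\<^sub>0, a\<^sub>0)) (Y2 - C) = 0 \<and>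
            (\<forall>y\<in>C. limitin (belief_topology X)
               (\<lambda>k. H' (z (r k), a (r k), y)) (H' (z\<^sub>0, a\<^sub>0, y)) sequentially)))"
  shows "weakly_continuous (prod_topology (belief_topology X) (top_of_set A)) (belief_topology X)
      (comdp_kernel X Y P Q H) \<and>
    ((assumption_D X A c \<alpha> \<or> assumption_P X A c \<alpha>) \<and>
       K_inf_compact (top_of_set X) (top_of_set A) c \<longrightarrow>
     W_star X Y A P Q c H \<and> optimality_properties X Y A P Q c \<alpha> H)"
proof -
  interpret pomdp_kernels X Y A P Q
    using pomdp by unfold_locales (auto simp: pomdp_def)
  obtain H' where H': "filter_kernel X Y A P Q H'"
    and H1: "weakly_continuous
        (prod_topology (belief_topology X) (prod_topology (top_of_set A) (top_of_set Y1)))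
        (top_of_set X) H'"
    and H2: "\<forall>z a z\<^sub>0 a\<^sub>0. (\<forall>n. z n \<in> beliefs X) \<and> z\<^sub>0 \<in> beliefs X \<and>
         limitin (belief_topology X) z z\<^sub>0 sequentially \<and>
         (\<forall>n. a n \<in> A) \<and> a\<^sub>0 \<in> A \<and> a \<longlonglongrightarrow> a\<^sub>0 \<longrightarrow>
         (\<exists>(r :: nat \<Rightarrow> nat) C. strict_mono r \<and> C \<in> sets (borel_on Y2) \<and>
            measure (R (z\<^sub>0, a\<^sub>0)) (Y2 - C) = 0 \<and>
            (\<forall>y\<in>C. limitin (belief_topology X)
               (\<lambda>k. H' (z (r k), a (r k), y)) (H' (z\<^sub>0, a\<^sub>0, y)) sequentially))"
    using c by (elim exE conjE) (rule that)
  have q_cont: "limitin (weak_topology (belief_topology X)) (\<lambda>n. comdp_kernel X Y P Q H (z n, a n))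
      (comdp_kernel X Y P Q H (z\<^sub>0, a\<^sub>0)) sequentially"
    if "\<And>n. z n \<in> beliefs X" "limitin (belief_topology X) z z\<^sub>0 sequentially"
      "\<And>n. a n \<in> A" "a\<^sub>0 \<in> A" "a \<longlonglongrightarrow> a\<^sub>0" for z z\<^sub>0 and a :: "nat \<Rightarrow> 'a" and a\<^sub>0
    by (rule comdp_kernel_weakly_continuous[OF H H' partition a b H1 H2[rule_format] that]) auto
  have q: "weakly_continuous (prod_topology (belief_topology X) (top_of_set A)) (belief_topology X)
      (comdp_kernel X Y P Q H)"
    unfolding weakly_continuous_def
  proof (intro allI impI)
    fix s s\<^sub>0 assume s: "(\<forall>n. s n \<in> topspace (prod_topology (belief_topology X) (top_of_set A))) \<and>
      limitin (prod_topology (belief_topology X) (top_of_set A)) s s\<^sub>0 sequentially"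
    then have mem: "fst (s n) \<in> beliefs X" "snd (s n) \<in> A" for n by (auto simp: mem_Times_iff)
    have "limitin (belief_topology X) (\<lambda>n. fst (s n)) (fst s\<^sub>0) sequentially"
      "limitin (top_of_set A) (\<lambda>n. snd (s n)) (snd s\<^sub>0) sequentially"
      using s unfolding limitin_pairwise comp_def by blast+
    then have "limitin (weak_topology (belief_topology X))
        (\<lambda>n. comdp_kernel X Y P Q H (fst (s n), snd (s n))) (comdp_kernel X Y P Q H (fst s\<^sub>0, snd s\<^sub>0)) sequentially"
      using mem by (intro q_cont) (auto simp: limitin_top_of_set)
    then show "limitin (weak_topology (belief_topology X)) (\<lambda>n. comdp_kernel X Y P Q H (s n))
        (comdp_kernel X Y P Q H s\<^sub>0) sequentially" by simp
  qed
  have "W_star X Y A P Q c H \<and> optimality_properties X Y A P Q c \<alpha> H"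
    if DP: "assumption_D X A c \<alpha> \<or> assumption_P X A c \<alpha>" and K: "K_inf_compact (top_of_set X) (top_of_set A) c"
  proof -
    \<comment> \<open>for nonnegative costs \<open>0\<close> is a lower bound; otherwise the problem is discounted\<close>
    have "\<exists>\<beta>::real. \<beta> \<le> 0 \<and> (\<beta> = 0 \<or> \<alpha> < 1) \<and> 0 \<le> \<alpha> \<and> (\<forall>s\<in>X \<times> A. ereal \<beta> \<le> c s)"
      using DP
    proof
      assume "assumption_D X A c \<alpha>"
      then obtain \<beta> :: real where \<beta>: "\<forall>s\<in>X \<times> A. ereal \<beta> \<le> c s" "0 \<le> \<alpha>" "\<alpha> < 1" by (auto simp: assumption_D_def)
      have "ereal (min \<beta> 0) \<le> c s" if "s \<in> X \<times> A" for s
        using \<beta>(1) that by (intro order_trans[of "ereal (min \<beta> 0)" "ereal \<beta>" "c s"]) auto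
      with \<beta> show ?thesis by (intro exI[of _ "min \<beta> 0"]) auto
    next
      assume "assumption_P X A c \<alpha>"
      then show ?thesis by (intro exI[of _ 0]) (auto simp: assumption_P_def zero_ereal_def)
    qed
    then obtain \<beta> :: real where \<beta>: "\<beta> \<le> 0" "\<beta> = 0 \<or> \<alpha> < 1" "0 \<le> \<alpha>" "\<And>s. s \<in> X \<times> A \<Longrightarrow> ereal \<beta> \<le> c s"
      by blast
    have c_meas: "c \<in> borel_measurable (borel_on X \<Otimes>\<^sub>M borel_on A)" using pomdp by (simp add: pomdp_def)
    define cn where "cn s = e2ennreal (c s - ereal \<beta>)" for s
    interpret C: proper_cost X A c \<beta> cn
    proof
      note [measurable] = c_meas
      show "cn \<in> borel_measurable (borel_on X \<Otimes>\<^sub>M borel_on A)" unfolding cn_def by measurable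
      show "c s = enn2ereal (cn s) + ereal \<beta>" if "s \<in> X \<times> A" for s
        using \<beta>(4)[OF that] unfolding cn_def by (cases "c s") (auto simp: enn2ereal_e2ennreal)
    qed fact+
    interpret comdp X Y A P Q H C.C \<alpha> c \<beta>
    proof unfold_locales
      show "comdp_kernel X Y P Q H \<in> BX \<Otimes>\<^sub>M borel_on A \<rightarrow>\<^sub>M prob_algebra BX" by (rule comdp_kernel_measurable[OF H])
      show "C.C \<in> borel_measurable (BX \<Otimes>\<^sub>M borel_on A)" by (rule C.C_measurable)
      show "metrizable_space (belief_topology X)" by (rule metrizable_beliefs)
      show "A \<noteq> {}" using pomdp by (simp add: pomdp_def)
      show "\<exists>r a\<^sub>0. strict_mono (r :: nat \<Rightarrow> nat) \<and> a\<^sub>0 \<in> A \<and> (\<lambda>n. a (r n)) \<longlonglongrightarrow> a\<^sub>0"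
        if "\<And>n. s n \<in> topspace (belief_topology X)" "limitin (belief_topology X) s s\<^sub>0 sequentially"
          "\<And>n. a n \<in> A" "\<And>n. C.C (s n, a n) \<le> ennreal l" for s s\<^sub>0 and a :: "nat \<Rightarrow> 'a" and l
        using that by (intro C.C_proper[of s s\<^sub>0 a l]) simp_all
    qed (use \<beta> H q_cont C.C_lower_semicontinuous C.comdp_cost_eq in auto)
    show ?thesis
      unfolding W_star_def using M.K_inf_compact_cost q optimality_properties_hold by blast
  qed
  with q show ?thesis by blast
qed

end
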